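(* Assume that (1) $\operatorname{pos}(\operatorname{dom}_uEf-\bar u)$ is linear and strongly closed; (2) for every $t=0,\dots,T$ and every $z\in\mathcal X$ with $(z,\bar u)\in\operatorname{dom}Ef$, there exists $\bar z\in\mathcal X$ with $(\bar z,\bar u)\in\operatorname{dom}Ef$ and $\bar z^t=E_tz^t$. Then, for every $(p,y)\in\mathcal X_a^\circ\times\mathcal U^*$, there exists $(\tilde p,\tilde y)\in\mathcal X_a^\perp\times\mathcal Y$ with \[ \varphi^*(\tilde p,\tilde y)-\langle\bar u,\tilde y\rangle\le\varphi^*(p,y)-\langle\bar u,y\rangle . \]
   Context: $(\Omega,\mathcal F,P)$ is a probability space with a filtration $(\mathcal F_t)_{t=0}^T$; $E_t$ is the conditional expectation given $\mathcal F_t$. $\mathcal N$ is the linear space of all processes $x=(x_t)_{t=0}^T$ with $x_t$ $\mathbb R^{n_t}$-valued and $\mathcal F_t$-measurable; $n=n_0+\dots+n_T$; $x^t:=(x_0,\dots,x_t)$. $f:\mathbb R^n\times\mathbb R^m\times\Omega\to\overline{\mathbb R}$ is a convex normal integrand: $f(\cdot,\omega)$ is a closed convex function for every $\omega$ and $\omega\mapsto\operatorname{epi}f(\cdot,\omega)$ is a measurable set-valued mapping. $Ef(x,u):=\int f(x(\omega),u(\omega),\omega)\,dP(\omega)$, where the integral of an extended real-valued random variable is $+\infty$ unless its positive part is integrable. $\mathcal X,\mathcal V\subset L^0(\Omega,\mathcal F,P;\mathbb R^n)$ and $\mathcal U,\mathcal Y\subset L^0(\Omega,\mathcal F,P;\mathbb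 R^m)$ are linear spaces; $\mathcal X$ and $\mathcal V$ are in separating duality under $\langle x,v\rangle=E[x\cdot v]$ and $\mathcal U$ and $\mathcal Y$ under $\langle u,y\rangle=E[u\cdot y]$. All four spaces are decomposable ($1_Ax+1_{\Omega\setminus A}x'$ belongs to the space for every $x$ in the space, $x'\in L^\infty$, $A\in\mathcal F$) and solid (if $\bar x$ is in the space and $x\in L^0$ has $|x^i|\le|\bar x^i|$ a.s. for every component $i$, then $x$ is in the space). $\mathcal X$ and $\mathcal U$ are endowed with "strong" topologies, at least as strong as the Mackey topologies $\tau(\mathcal X,\mathcal V)$, $\tau(\mathcal U,\mathcal Y)$, under which they are Fréchet spaces and their topological duals are $\mathcal X^*=\mathcal V\oplus\mathcal V^s$, $\mathcal U^*=\mathcal Y\oplus\mathcal Y^s$: each $y\in\mathcal U^*$ is uniquely of the form $\langle u,y\rangle=E[u\cdot y^c]+\langle u,y^s\rangle$ with $y^c\in\mathcal Y$, $y^s\in\mathcal Y^s$, and similarly for $\mathcal X^*$. Here $\mathcal Y^s$ is the set of singular elements: those $y\in\mathcal U^*$ such that for every $u\in\mathcal U$ there is a decreasing sequence $(A^\nu)\subset\mathcal F$ with $P(A^\nu)\searrow0$ and $\langle1_{\Omega\setminus A^\nu}u,y\rangle=0$ for all $\nu$; similarly for $\mathcal V^s$. Assume $E_t\mathcal X\subseteq\mathcal X$ for all $t$. $\bar u\in\mathcal U$ is fixed, $\mathcal X_a:=\mathcal X\cap\mathcal N$, $\mathcal X_a^\perp:=\{p\in\mathcal V\mid E[x\cdot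 p]=0\ \forall x\in\mathcal X_a\}$, $\mathcal X_a^\circ:=\{p\in\mathcal X^*\mid\langle x,p\rangle=0\ \forall x\in\mathcal X_a\}$. $\operatorname{dom}Ef=\{(x,u)\in\mathcal X\times\mathcal U\mid Ef(x,u)<\infty\}$, $\operatorname{dom}_uEf$ is its projection to $\mathcal U$, and $\operatorname{pos}C=\bigcup_{\lambda>0}\lambda C$. "Linear" means being a linear subspace. The optimum value function on $\mathcal X\times\mathcal U$ is $\varphi(z,u):=\inf_{x\in\mathcal X}\{Ef(x,u)\mid x-z\in\mathcal N\}$ and its conjugate is $\varphi^*(p,y)=\sup_{z\in\mathcal X,u\in\mathcal U}\{\langle z,p\rangle+\langle u,y\rangle-\varphi(z,u)\}$ for $(p,y)\in\mathcal X^*\times\mathcal U^*$. *)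

theory Defs
  imports "HOL-Probability.Probability" "HOL-Library.Function_Algebras"
begin

text \<open>
  Elements of \<open>L\<^sup>0\<close> are represented by measurable functions on the sample space, identified
  when they agree almost surely.  The spaces of random variables below are solid, hence
  closed under almost sure equality, so they are unions of equivalence classes.  Topologies are
  put on the representatives; two representatives of one class are not separated by them.
\<close>

instantiation "fun" :: (type, real_vector) real_vector
begin

definition scaleR_fun :: "real \<Rightarrow> ('a \<Rightarrow> 'b) \<Rightarrow> 'a \<Rightarrow> 'b" where
  "scaleR_fun c g = (\<lambda>a. c *\<^sub>R g a)"

instance
  by standard (auto simp: scaleR_fun_def fun_eq_iff scaleR_add_right scaleR_add_left)

end

definition ae_eq :: "'w measure \<Rightarrow> ('w \<Rightarrow> 'b) \<Rightarrow> ('w \<Rightarrow> 'b) \<Rightarrow> bool" where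
  "ae_eq M x x' \<longleftrightarrow> (AE \<omega> in M. x \<omega> = x' \<omega>)"

definition pairing :: "'w measure \<Rightarrow> ('w \<Rightarrow> 'b::euclidean_space) \<Rightarrow> ('w \<Rightarrow> 'b) \<Rightarrow> real" where
  "pairing M v x = (\<integral>\<omega>. x \<omega> \<bullet> v \<omega> \<partial>M)"


subsection \<open>Spaces of random variables\<close>

definition random_variable_space :: "'w measure \<Rightarrow> ('w \<Rightarrow> 'b::euclidean_space) set \<Rightarrow> bool" where
  "random_variable_space M X \<longleftrightarrow> X \<subseteq> borel_measurable M \<and> subspace X"

definition separating_duality ::
    "'w measure \<Rightarrow> ('w \<Rightarrow> 'b::euclidean_space) set \<Rightarrow> ('w \<Rightarrow> 'b) set \<Rightarrow> bool" where
  "separating_duality M X V \<longleftrightarrow>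
     (\<forall>x\<in>X. \<forall>v\<in>V. integrable M (\<lambda>\<omega>. x \<omega> \<bullet> v \<omega>)) \<and>
     (\<forall>x\<in>X. (\<forall>v\<in>V. pairing M v x = 0) \<longrightarrow> ae_eq M x 0) \<and>
     (\<forall>v\<in>V. (\<forall>x\<in>X. pairing M v x = 0) \<longrightarrow> ae_eq M v 0)"

definition L_infinity :: "'w measure \<Rightarrow> ('w \<Rightarrow> 'b::euclidean_space) set" where
  "L_infinity M = {x \<in> borel_measurable M. \<exists>C. AE \<omega> in M. norm (x \<omega>) \<le> C}"

definition decomposable :: "'w measure \<Rightarrow> ('w \<Rightarrow> 'b::euclidean_space) set \<Rightarrow> bool" where
  "decomposable M X \<longleftrightarrow>
     (\<forall>x\<in>X. \<forall>x'\<in>L_infinity M. \<forall>A\<in>sets M.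
        (\<lambda>\<omega>. indicator A \<omega> *\<^sub>R x \<omega> + indicator (space M - A) \<omega> *\<^sub>R x' \<omega>) \<in> X)"

definition solid :: "'w measure \<Rightarrow> ('w \<Rightarrow> real^'k) set \<Rightarrow> bool" where
  "solid M X \<longleftrightarrow>
     (\<forall>x0\<in>X. \<forall>x\<in>borel_measurable M.
        (\<forall>i. AE \<omega> in M. \<bar>x \<omega> $ i\<bar> \<le> \<bar>x0 \<omega> $ i\<bar>) \<longrightarrow> x \<in> X)"


subsection \<open>Strong topologies, duals and singular functionals\<close>

definition weak_topology ::
    "'w measure \<Rightarrow> ('w \<Rightarrow> 'b::euclidean_space) set \<Rightarrow> ('w \<Rightarrow> 'b) set \<Rightarrow> ('w \<Rightarrow> 'b) topology" where
  "weak_topology M V X =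
     topology_generated_by {{v\<in>V. pairing M v x \<in> G} |x G. x \<in> X \<and> open G}"

text \<open>
  The Mackey topology is that of uniform convergence on the absolutely convex \<open>\<sigma>(V,X)\<close>-compact
  subsets \<open>K\<close> of \<open>V\<close>.  Since suprema over \<open>K\<close> are attained, the sets below are the open balls of
  the corresponding seminorms.
\<close>

definition mackey_topology ::
    "'w measure \<Rightarrow> ('w \<Rightarrow> 'b::euclidean_space) set \<Rightarrow> ('w \<Rightarrow> 'b) set \<Rightarrow> ('w \<Rightarrow> 'b) topology" where
  "mackey_topology M X V =
     topology_generated_by
       {{x'\<in>X. \<forall>v\<in>K. \<bar>pairing M v (x' - x)\<bar> < \<epsilon>} |x K \<epsilon>.
          x \<in> X \<and> \<epsilon> > 0 \<and> compactin (weak_topology M V X) K \<and>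
          convex K \<and> (\<forall>v\<in>K. \<forall>c. \<bar>c\<bar> \<le> 1 \<longrightarrow> c *\<^sub>R v \<in> K)}"

text \<open>
  A metric on the space of almost sure equivalence classes is the same as a pseudometric on the
  representatives that vanishes exactly on almost surely equal pairs.
\<close>

definition ae_metric_on ::
    "'w measure \<Rightarrow> ('w \<Rightarrow> 'b) set \<Rightarrow> (('w \<Rightarrow> 'b) \<Rightarrow> ('w \<Rightarrow> 'b) \<Rightarrow> real) \<Rightarrow> bool" where
  "ae_metric_on M X d \<longleftrightarrow>
     (\<forall>x\<in>X. \<forall>y\<in>X. 0 \<le> d x y \<and> d x y = d y x \<and> (d x y = 0 \<longleftrightarrow> ae_eq M x y)) \<and>
     (\<forall>x\<in>X. \<forall>y\<in>X. \<forall>z\<in>X. d x z \<le> d x y + d y z)"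

text \<open>
  A Frechet space is a locally convex topological vector space whose topology is induced by a
  complete translation invariant metric.
\<close>

definition frechet_space ::
    "'w measure \<Rightarrow> ('w \<Rightarrow> 'b::euclidean_space) topology \<Rightarrow> bool" where
  "frechet_space M S \<longleftrightarrow>
     subspace (topspace S) \<and>
     continuous_map (prod_topology S S) S (\<lambda>(x, y). x + y) \<and>
     continuous_map (prod_topology euclideanreal S) S (\<lambda>(c, x). c *\<^sub>R x) \<and>
     (\<forall>G. openin S G \<and> 0 \<in> G \<longrightarrow> (\<exists>C. openin S C \<and> convex C \<and> 0 \<in> C \<and> C \<subseteq> G)) \<and>
     (\<exists>d. ae_metric_on M (topspace S) d \<and>
        (\<forall>x\<in>topspace S. \<forall>y\<in>topspace S. \<forall>z\<in>topspace S. d (x + z) (y + z) = d x y) \<and>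
        (\<forall>G. openin S G \<longleftrightarrow>
           G \<subseteq> topspace S \<and> (\<forall>x\<in>G. \<exists>\<epsilon>>0. \<forall>y\<in>topspace S. d x y < \<epsilon> \<longrightarrow> y \<in> G)) \<and>
        (\<forall>\<sigma>::nat \<Rightarrow> 'w \<Rightarrow> 'b. range \<sigma> \<subseteq> topspace S \<and>
           (\<forall>\<epsilon>>0. \<exists>K. \<forall>j\<ge>K. \<forall>k\<ge>K. d (\<sigma> j) (\<sigma> k) < \<epsilon>) \<longrightarrow>
           (\<exists>x\<in>topspace S. (\<lambda>k. d (\<sigma> k) x) \<longlonglongrightarrow> 0)))"

text \<open>Only the values of a functional on the space \<^term>\<open>topspace S\<close> are meaningful.\<close>

definition top_dual :: "('w \<Rightarrow> 'b::real_vector) topology \<Rightarrow> (('w \<Rightarrow> 'b) \<Rightarrow> real) set" where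
  "top_dual S =
     {p. continuous_map S euclideanreal p \<and>
         (\<forall>x\<in>topspace S. \<forall>y\<in>topspace S. p (x + y) = p x + p y) \<and>
         (\<forall>c. \<forall>x\<in>topspace S. p (c *\<^sub>R x) = c * p x)}"

definition singular_dual ::
    "'w measure \<Rightarrow> ('w \<Rightarrow> 'b::real_vector) topology \<Rightarrow> (('w \<Rightarrow> 'b) \<Rightarrow> real) set" where
  "singular_dual M S =
     {p \<in> top_dual S. \<forall>x\<in>topspace S. \<exists>A::nat \<Rightarrow> 'w set.
        range A \<subseteq> sets M \<and> decseq A \<and> (\<lambda>\<nu>. measure M (A \<nu>)) \<longlonglongrightarrow> 0 \<and>
        (\<forall>\<nu>. p (\<lambda>\<omega>. indicator (space M - A \<nu>) \<omega> *\<^sub>R x \<omega>) = 0)}"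

text \<open>The dual is the direct sum of \<open>V\<close> and the singular functionals.\<close>

definition dual_decomposition ::
    "'w measure \<Rightarrow> ('w \<Rightarrow> 'b::euclidean_space) topology \<Rightarrow> ('w \<Rightarrow> 'b) set \<Rightarrow> bool" where
  "dual_decomposition M S V \<longleftrightarrow>
     (\<forall>v\<in>V. pairing M v \<in> top_dual S) \<and>
     (\<forall>p\<in>top_dual S. \<exists>v\<in>V. \<exists>s\<in>singular_dual M S.
        \<forall>x\<in>topspace S. p x = pairing M v x + s x) \<and>
     (\<forall>v\<in>V. \<forall>v'\<in>V. \<forall>s\<in>singular_dual M S. \<forall>s'\<in>singular_dual M S.
        (\<forall>x\<in>topspace S. pairing M v x + s x = pairing M v' x + s' x) \<longrightarrow>
        ae_eq M v v' \<and> (\<forall>x\<in>topspace S. s x = s' x))"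

definition strong_topology ::
    "'w measure \<Rightarrow> ('w \<Rightarrow> 'b::euclidean_space) set \<Rightarrow> ('w \<Rightarrow> 'b) set \<Rightarrow>
     ('w \<Rightarrow> 'b) topology \<Rightarrow> bool" where
  "strong_topology M X V S \<longleftrightarrow>
     topspace S = X \<and>
     (\<forall>G. openin (mackey_topology M X V) G \<longrightarrow> openin S G) \<and>
     frechet_space M S \<and>
     dual_decomposition M S V"


subsection \<open>Processes\<close>

definition filtration_upto :: "'w measure \<Rightarrow> (nat \<Rightarrow> 'w measure) \<Rightarrow> nat \<Rightarrow> bool" where
  "filtration_upto M F T \<longleftrightarrow>
     (\<forall>t\<le>T. subalgebra M (F t)) \<and> (\<forall>s t. s \<le> t \<and> t \<le> T \<longrightarrow> subalgebra (F t) (F s))"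

definition cond_expect :: "'w measure \<Rightarrow> 'w measure \<Rightarrow> ('w \<Rightarrow> real^'n) \<Rightarrow> 'w \<Rightarrow> real^'n" where
  "cond_expect M G x = (\<lambda>\<omega>. \<chi> i. real_cond_exp M G (\<lambda>\<omega>'. x \<omega>' $ i) \<omega>)"

text \<open>
  A process \<open>(x\<^sub>0, \<dots>, x\<^sub>T)\<close> with \<open>x\<^sub>t\<close> of dimension \<open>n\<^sub>t\<close> is a single random vector whose
  coordinates are labelled by their stage: \<open>x\<^sub>t\<close> consists of the \<open>n\<^sub>t\<close> coordinates \<open>i\<close> with
  \<open>stage i = t\<close>.  Measurability of a class in \<open>L\<^sup>0\<close> with respect to \<open>F t\<close> means that some
  representative is measurable.
\<close>

definition adapted ::
    "'w measure \<Rightarrow> (nat \<Rightarrow> 'w measure) \<Rightarrow> ('n \<Rightarrow> nat) \<Rightarrow> ('w \<Rightarrow> real^'n) set" where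
  "adapted M F stage =
     {x \<in> borel_measurable M.
        \<forall>i. \<exists>g\<in>borel_measurable (F (stage i)). ae_eq M (\<lambda>\<omega>. x \<omega> $ i) g}"

definition adapted_annihilator ::
    "'w measure \<Rightarrow> (nat \<Rightarrow> 'w measure) \<Rightarrow> ('n \<Rightarrow> nat) \<Rightarrow>
     ('w \<Rightarrow> real^'n) set \<Rightarrow> ('w \<Rightarrow> real^'n) set \<Rightarrow> ('w \<Rightarrow> real^'n) set" where
  "adapted_annihilator M F stage X V = {p\<in>V. \<forall>x \<in> X \<inter> adapted M F stage. pairing M p x = 0}"

definition adapted_polar ::
    "'w measure \<Rightarrow> (nat \<Rightarrow> 'w measure) \<Rightarrow> ('n \<Rightarrow> nat) \<Rightarrow>
     ('w \<Rightarrow> real^'n) topology \<Rightarrow> (('w \<Rightarrow> real^'n) \<Rightarrow> real) set" where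
  "adapted_polar M F stage S = {p \<in> top_dual S. \<forall>x \<in> topspace S \<inter> adapted M F stage. p x = 0}"


subsection \<open>Normal integrands and integral functionals\<close>

definition epigraph :: "('a \<Rightarrow> 'b \<Rightarrow> ereal) \<Rightarrow> ('a \<times> 'b \<times> real) set" where
  "epigraph g = {(x, u, r). g x u \<le> ereal r}"

definition measurable_set_valued :: "'w measure \<Rightarrow> ('w \<Rightarrow> 'a::topological_space set) \<Rightarrow> bool" where
  "measurable_set_valued M S \<longleftrightarrow> (\<forall>G. open G \<longrightarrow> {\<omega> \<in> space M. S \<omega> \<inter> G \<noteq> {}} \<in> sets M)"

definition convex_normal_integrand ::
    "'w measure \<Rightarrow> ('a::euclidean_space \<Rightarrow> 'b::euclidean_space \<Rightarrow> 'w \<Rightarrow> ereal) \<Rightarrow> bool" where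
  "convex_normal_integrand M f \<longleftrightarrow>
     (\<forall>\<omega>\<in>space M. closed (epigraph (\<lambda>x u. f x u \<omega>)) \<and> convex (epigraph (\<lambda>x u. f x u \<omega>))) \<and>
     measurable_set_valued M (\<lambda>\<omega>. epigraph (\<lambda>x u. f x u \<omega>))"

text \<open>
  \<^const>\<open>e2ennreal\<close> truncates negative values to \<open>0\<close>, so the two nonnegative integrals below are
  those of the positive and the negative part.
\<close>

definition extended_integral :: "'w measure \<Rightarrow> ('w \<Rightarrow> ereal) \<Rightarrow> ereal" where
  "extended_integral M g =
     (let pos_part = (\<integral>\<^sup>+\<omega>. e2ennreal (g \<omega>) \<partial>M);
          neg_part = (\<integral>\<^sup>+\<omega>. e2ennreal (- g \<omega>) \<partial>M)
      in if pos_part = \<infinity> then \<infinity> else enn2ereal pos_part - enn2ereal neg_part)"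

definition integral_functional ::
    "'w measure \<Rightarrow> ('a \<Rightarrow> 'b \<Rightarrow> 'w \<Rightarrow> ereal) \<Rightarrow> ('w \<Rightarrow> 'a) \<Rightarrow> ('w \<Rightarrow> 'b) \<Rightarrow> ereal" where
  "integral_functional M f x u = extended_integral M (\<lambda>\<omega>. f (x \<omega>) (u \<omega>) \<omega>)"

definition dom_Ef ::
    "'w measure \<Rightarrow> ('a \<Rightarrow> 'b \<Rightarrow> 'w \<Rightarrow> ereal) \<Rightarrow> ('w \<Rightarrow> 'a) set \<Rightarrow> ('w \<Rightarrow> 'b) set \<Rightarrow>
     (('w \<Rightarrow> 'a) \<times> ('w \<Rightarrow> 'b)) set" where
  "dom_Ef M f X U = {(x, u) \<in> X \<times> U. integral_functional M f x u < \<infinity>}"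

definition pos_hull :: "'a::real_vector set \<Rightarrow> 'a set" where
  "pos_hull C = {c *\<^sub>R x |c x. c > 0 \<and> x \<in> C}"

definition value_function ::
    "'w measure \<Rightarrow> (nat \<Rightarrow> 'w measure) \<Rightarrow> ('n \<Rightarrow> nat) \<Rightarrow> (real^'n \<Rightarrow> 'b \<Rightarrow> 'w \<Rightarrow> ereal) \<Rightarrow>
     ('w \<Rightarrow> real^'n) set \<Rightarrow> ('w \<Rightarrow> real^'n) \<Rightarrow> ('w \<Rightarrow> 'b) \<Rightarrow> ereal" where
  "value_function M F stage f X z u =
     (INF x\<in>{x\<in>X. x - z \<in> adapted M F stage}. integral_functional M f x u)"

definition conjugate ::
    "'a set \<Rightarrow> 'b set \<Rightarrow> ('a \<Rightarrow> 'b \<Rightarrow> ereal) \<Rightarrow> ('a \<Rightarrow> real) \<Rightarrow> ('b \<Rightarrow> real) \<Rightarrow> ereal" where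
  "conjugate X U \<phi> p y = (SUP (z, u)\<in>X \<times> U. ereal (p z) + ereal (y u) - \<phi> z u)"

end

theory Submission
  imports Defs
begin

text \<open>
  On adapted polars \<open>\<phi>\<^sup>*\<close> coincides with the conjugate of \<open>Ef\<close>, which decomposes as
  \<open>(Ef)\<^sup>*(p, y) \<ge> (Ef)\<^sup>*(p\<^sup>c, y\<^sup>c) + \<sigma>(p\<^sup>s, y\<^sup>s)\<close>, where \<open>\<sigma>\<close> is the support function of \<open>dom Ef\<close>.
  Working backwards from \<open>t = T\<close>, suppose that \<open>p\<^sup>s\<close> depends only on the components up to stage \<open>t\<close>.
  Then \<open>p\<^sup>s\<close> is replaced by \<open>p\<^sup>s \<circ> E\<^sub>t\<close>. By hypothesis (2) its support function over
  \<open>D = {x. (x, ubar) \<in> dom Ef}\<close> does not increase, and by hypothesis (1) and a Robinson--Ursescu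
  argument a multiplier \<open>y\<close> for the constraint \<open>u = ubar\<close> turns a bound over \<open>D\<close> into a bound over
  \<open>dom Ef\<close>. Since \<open>p\<close> annihilates adapted processes, the stage \<open>t\<close> component of \<open>p\<^sup>s \<circ> E\<^sub>t\<close> equals
  \<open>- E\<^sub>t p\<^sup>c\<^sub>t\<close>, so the new singular part depends only on the stages before \<open>t\<close>. After stage \<open>0\<close> no
  singular part of \<open>p\<close> is left, and dropping \<open>y\<^sup>s\<close> does not increase the value because \<open>ubar\<close> is feasible.
\<close>

section \<open>Complete metrizable spaces and sublinear functionals\<close>

text \<open>The order of the stages is forced. Hypothesis (2) controls only the components of
  \<open>E_t z\<close> up to \<open>t\<close>, so the singular part must already ignore the later
  ones; and \<open>E_t x\<close> is adapted only in its stage \<open>t\<close> component, so only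
  that one becomes absolutely continuous. Each step needs a new multiplier, since (2) speaks only of
  pairs with parameter \<open>ubar\<close>. Two obstacles shape the preparations. Nothing says that
  truncations, multiplication by bounded functions or \<open>E_t\<close> are continuous for the
  strong topologies; this is drawn from the closed graph theorem, tested against
  \<open>L_infinity\<close>. And a singular functional is only known to vanish on certain pieces of
  each element, with no control of their measurable parts; splicing two feasible pairs needs such
  control. Lower semicontinuity of \<open>Ef\<close>, required for Robinson--Ursescu, rests on an
  affine minorant in \<open>V\<close> and \<open>Y\<close>, available once the singular part is
  split off. Since topologies live on representatives, an F-seminorm \<open>N\<close> replaces the
  metric, and limits are unique only up to \<open>N = 0\<close>.\<close>

locale complete_F_seminorm =
  fixes E :: "'a::real_vector set" and N :: "'a \<Rightarrow> real"
  assumes subspace: "subspace E"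
    and nonneg: "x \<in> E \<Longrightarrow> 0 \<le> N x"
    and zero [simp]: "N 0 = 0"
    and minus: "x \<in> E \<Longrightarrow> N (- x) = N x"
    and triangle: "x \<in> E \<Longrightarrow> y \<in> E \<Longrightarrow> N (x + y) \<le> N x + N y"
    and scale: "0 < e \<Longrightarrow> \<exists>d>0. \<forall>x\<in>E. N x < d \<longrightarrow> N (c *\<^sub>R x) < e"
    and scale_zero: "x \<in> E \<Longrightarrow> 0 < e \<Longrightarrow> \<exists>d>0. \<forall>c. \<bar>c\<bar> < d \<longrightarrow> N (c *\<^sub>R x) < e"
    and complete: "(\<And>n::nat. s n \<in> E) \<Longrightarrow>
      (\<And>e. e > 0 \<Longrightarrow> \<exists>K. \<forall>j\<ge>K. \<forall>k\<ge>K. N (s j - s k) < e) \<Longrightarrow>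
      \<exists>x\<in>E. (\<lambda>k. N (s k - x)) \<longlonglongrightarrow> 0"
begin

lemma mem_0: "0 \<in> E" and mem_add: "x \<in> E \<Longrightarrow> y \<in> E \<Longrightarrow> x + y \<in> E"
  and mem_diff: "x \<in> E \<Longrightarrow> y \<in> E \<Longrightarrow> x - y \<in> E"
  and mem_scale: "x \<in> E \<Longrightarrow> c *\<^sub>R x \<in> E" and mem_minus: "x \<in> E \<Longrightarrow> - x \<in> E"
  using subspace by (auto simp: subspace_def intro: subspace_diff subspace_neg)

lemma diff_commute: "x \<in> E \<Longrightarrow> y \<in> E \<Longrightarrow> N (x - y) = N (y - x)"
  using minus[of "x - y"] mem_diff by simp

lemma diff_triangle: "x \<in> E \<Longrightarrow> y \<in> E \<Longrightarrow> z \<in> E \<Longrightarrow> N (x - z) \<le> N (x - y) + N (y - z)"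
  using triangle[of "x - y" "y - z"] mem_diff by simp

lemma complete_geometric:
  assumes s: "\<And>n::nat. s n \<in> E" and step: "\<And>n. N (s (Suc n) - s n) \<le> e * (1/2) ^ n" and "0 < e"
  obtains x where "x \<in> E" "(\<lambda>k. N (s k - x)) \<longlonglongrightarrow> 0" "\<And>n. N (x - s n) \<le> 2 * e * (1/2) ^ n"
proof -
  \<comment> \<open>The bound is the exact geometric sum from \<open>n\<close> to
    \<open>n + k\<close>, so that the induction closes without loss.\<close>
  have tail: "N (s (n + k) - s n) \<le> 2 * e * (1/2) ^ n - 2 * e * (1/2) ^ (n + k)" for n k
  proof (induction k)
    case (Suc k)
    have "N (s (n + Suc k) - s n) \<le> N (s (n + Suc k) - s (n + k)) + N (s (n + k) - s n)"
      by (intro diff_triangle s)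
    also have "\<dots> \<le> e * (1/2) ^ (n + k) + (2 * e * (1/2) ^ n - 2 * e * (1/2) ^ (n + k))"
      using step[of "n + k"] Suc by simp
    also have "\<dots> = 2 * e * (1/2) ^ n - 2 * e * (1/2) ^ (n + Suc k)" by simp
    finally show ?case .
  qed simp
  have tail': "N (s k - s n) \<le> 2 * e * (1/2) ^ n" if "n \<le> k" for n k
  proof -
    have "0 \<le> 2 * e * (1/2) ^ k" using \<open>0 < e\<close> by simp
    then show ?thesis using tail[of n "k - n"] that by simp
  qed
  have lim0: "(\<lambda>n. 2 * e * (1/2) ^ n) \<longlonglongrightarrow> 0"
    using tendsto_mult[OF tendsto_const LIMSEQ_power_zero[of "1/2::real"], of "2 * e"] by simp
  have "\<exists>K. \<forall>j\<ge>K. \<forall>k\<ge>K. N (s j - s k) < r" if r: "0 < r" for r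
  proof -
    have "\<forall>\<^sub>F K in sequentially. 2 * e * (1/2) ^ K < r / 2"
      using order_tendstoD(2)[OF lim0, of "r / 2"] r by simp
    then obtain K where K: "2 * e * (1/2) ^ K < r / 2"
      using eventually_happens'[OF sequentially_bot] by blast
    have "N (s j - s k) < r" if "j \<ge> K" "k \<ge> K" for j k
      using diff_triangle[OF s[of j] s[of K] s[of k]] tail'[OF that(1)] tail'[OF that(2)] K
        diff_commute[OF s s, of K k] by linarith
    then show ?thesis by blast
  qed
  then obtain x where x: "x \<in> E" "(\<lambda>k. N (s k - x)) \<longlonglongrightarrow> 0" using complete[of s] s by blast
  have "N (x - s n) \<le> 2 * e * (1/2) ^ n" for n
  proof -
    have "(\<lambda>k. N (s k - x) + 2 * e * (1/2) ^ n) \<longlonglongrightarrow> 0 + 2 * e * (1/2) ^ n"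
      by (intro tendsto_add x tendsto_const)
    moreover have "\<forall>\<^sub>F k in sequentially. N (x - s n) \<le> N (s k - x) + 2 * e * (1/2) ^ n"
      unfolding eventually_sequentially
    proof (intro exI[of _ n] allI impI)
      fix k assume "n \<le> k"
      then show "N (x - s n) \<le> N (s k - x) + 2 * e * (1/2) ^ n"
        using diff_triangle[OF x(1) s[of k] s[of n]] tail'[of n k] diff_commute[OF x(1) s, of k] by linarith
    qed
    ultimately show ?thesis using tendsto_lowerbound by fastforce
  qed
  then show thesis using that x by blast
qed

text \<open>Nested balls: if every \<open>B n\<close> failed to be dense in every ball, a centre at
  positive distance from \<open>B n\<close> could be picked in each ball in turn, and completeness
  would give a point outside all \<open>B n\<close>. Stating the conclusion as density in a ball
  keeps closures out of the argument.\<close>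

lemma Baire:
  assumes cover: "\<And>z. z \<in> E \<Longrightarrow> \<exists>n::nat. z \<in> B n"
  shows "\<exists>n. \<exists>z\<in>E. \<exists>r>0. \<forall>w\<in>E. N (w - z) < r \<longrightarrow> (\<forall>e>0. \<exists>b\<in>B n. N (w - b) < e)"
proof (rule ccontr)
  assume contr: "\<not> ?thesis"
  have avoid: "\<exists>w e. w \<in> E \<and> N (w - z) < r \<and> 0 < e \<and> (\<forall>b\<in>B n. e \<le> N (w - b))"
    if zr: "z \<in> E" "0 < r" for n z r
  proof -
    have "\<not> (\<forall>w\<in>E. N (w - z) < r \<longrightarrow> (\<forall>e>0. \<exists>b\<in>B n. N (w - b) < e))" using contr zr by blast
    then obtain w e where "w \<in> E" "N (w - z) < r" "0 < e" "\<not> (\<exists>b\<in>B n. N (w - b) < e)" by blast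
    then show ?thesis by (meson not_le)
  qed
  \<comment> \<open>\<open>Q n\<close> holds the \<open>n\<close>-th centre and radius. The factor 4
    leaves room: the limit is within \<open>2 * r (Suc n)\<close> of the centre
    \<open>s (Suc n)\<close>, while \<open>B n\<close> stays \<open>4 * r (Suc n)\<close> away from
    it.\<close>
  have "\<exists>Q :: nat \<Rightarrow> 'a \<times> real. \<forall>n. (fst (Q n) \<in> E \<and> 0 < snd (Q n)) \<and>
    (N (fst (Q (Suc n)) - fst (Q n)) < snd (Q n) \<and> snd (Q (Suc n)) \<le> snd (Q n) / 4 \<and>
     (\<forall>b\<in>B n. 4 * snd (Q (Suc n)) \<le> N (fst (Q (Suc n)) - b)))"
  proof (rule dependent_nat_choice)
    show "\<exists>q :: 'a \<times> real. fst q \<in> E \<and> 0 < snd q" using mem_0 by (intro exI[of _ "(0, 1)"]) simp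
    fix q :: "'a \<times> real" and n assume q: "fst q \<in> E \<and> 0 < snd q"
    then obtain w e where w: "w \<in> E" "N (w - fst q) < snd q" "0 < e" "\<And>b. b \<in> B n \<Longrightarrow> e \<le> N (w - b)"
      using avoid[of "fst q" "snd q" n] by blast
    have "4 * (min e (snd q) / 4) \<le> N (w - b)" if "b \<in> B n" for b using w(4)[OF that] by auto
    moreover have "0 < min e (snd q) / 4" "min e (snd q) / 4 \<le> snd q / 4" using w q by auto
    ultimately show "\<exists>y. (fst y \<in> E \<and> 0 < snd y) \<and> N (fst y - fst q) < snd q \<and> snd y \<le> snd q / 4 \<and>
      (\<forall>b\<in>B n. 4 * snd y \<le> N (fst y - b))"
      using w by (intro exI[of _ "(w, min e (snd q) / 4)"]) auto
  qed
  then obtain Q :: "nat \<Rightarrow> 'a \<times> real" where Q: "\<forall>n. (fst (Q n) \<in> E \<and> 0 < snd (Q n)) \<and>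
    (N (fst (Q (Suc n)) - fst (Q n)) < snd (Q n) \<and> snd (Q (Suc n)) \<le> snd (Q n) / 4 \<and>
     (\<forall>b\<in>B n. 4 * snd (Q (Suc n)) \<le> N (fst (Q (Suc n)) - b)))" by blast
  define s where "s n = fst (Q n)" for n
  define r where "r n = snd (Q n)" for n
  have sE: "s n \<in> E" and rp: "0 < r n" and step: "N (s (Suc n) - s n) < r n" and r4: "r (Suc n) \<le> r n / 4"
    and far: "\<And>b. b \<in> B n \<Longrightarrow> 4 * r (Suc n) \<le> N (s (Suc n) - b)" for n
    using Q by (auto simp: s_def r_def)
  have rk: "r (n + k) \<le> r n * (1/2) ^ k" for n k
  proof (induction k)
    case (Suc k) then show ?case using r4[of "n + k"] rp[of "n + k"] rp[of n] by simp
  qed simp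
  have "N (s (Suc n) - s n) \<le> r 0 * (1/2) ^ n" for n using step[of n] rk[of 0 n] by simp
  then obtain x where x: "x \<in> E" "(\<lambda>k. N (s k - x)) \<longlonglongrightarrow> 0"
    using complete_geometric[of s "r 0"] sE rp by metis
  obtain n where n: "x \<in> B n" using cover x by blast
  \<comment> \<open>The sequence restarted at \<open>Suc n\<close> gives a bound in terms of
    \<open>r (Suc n)\<close>. Its limit \<open>x'\<close> may differ from \<open>x\<close>, but only
    by \<open>N (x' - x) = 0\<close>.\<close>
  have "N (s (Suc n + Suc k) - s (Suc n + k)) \<le> r (Suc n) * (1/2) ^ k" for k
    using step[of "Suc n + k"] rk[of "Suc n" k] by simp
  then obtain x' where x': "x' \<in> E" "(\<lambda>k. N (s (Suc n + k) - x')) \<longlonglongrightarrow> 0"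
     "N (x' - s (Suc n + 0)) \<le> 2 * r (Suc n) * (1/2) ^ 0"
    using complete_geometric[of "\<lambda>k. s (Suc n + k)" "r (Suc n)"] sE rp by (metis add_Suc_right)
  have "(\<lambda>k. N (s (Suc n + k) - x)) \<longlonglongrightarrow> 0" using LIMSEQ_ignore_initial_segment[OF x(2), of "Suc n"]
    by (simp add: add.commute)
  then have "(\<lambda>k. N (s (Suc n + k) - x') + N (s (Suc n + k) - x)) \<longlonglongrightarrow> 0 + 0" by (intro tendsto_add x')
  moreover have "N (x' - x) \<le> N (s (Suc n + k) - x') + N (s (Suc n + k) - x)" for k
    using diff_triangle[OF x'(1) sE x(1), of "Suc n + k"] diff_commute[OF x'(1) sE, of "Suc n + k"] by linarith
  ultimately have "N (x' - x) \<le> 0" using tendsto_lowerbound by fastforce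
  then have "N (s (Suc n) - x) \<le> 2 * r (Suc n)"
    using diff_triangle[OF sE x'(1) x(1), of "Suc n"] x'(3) diff_commute[OF x'(1) sE, of "Suc n"] by simp
  also have "\<dots> < 4 * r (Suc n)" using rp[of "Suc n"] by simp
  finally show False using far[OF n] by simp
qed

text \<open>The integer dilates of \<open>A\<close> cover \<open>E\<close>, so by Baire one of them
  is dense in a ball around some \<open>z\<close>; averaging with a point of \<open>A\<close> on the
  opposite ray moves that ball to the origin.\<close>

lemma absorbing_convex_closure:
  assumes conv: "convex A" and AE: "A \<subseteq> E" and A0: "0 \<in> A"
    and absorbing: "\<And>z. z \<in> E \<Longrightarrow> \<exists>c>0. c *\<^sub>R z \<in> A"
  shows "\<exists>d>0. \<forall>z\<in>E. N z < d \<longrightarrow> (\<forall>e>0. \<exists>a\<in>A. N (z - a) < e)"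
proof -
  have "\<exists>n::nat. z \<in> (*\<^sub>R) (real (Suc n)) ` A" if z: "z \<in> E" for z
  proof -
    obtain c where c: "c > 0" "c *\<^sub>R z \<in> A" using absorbing z by blast
    obtain n :: nat where n: "1 / c < real (Suc n)" using reals_Archimedean2 by (metis less_SucI of_nat_less_iff order.strict_trans lessI)
    have "(1 / real (Suc n)) *\<^sub>R z = (1 - 1 / (c * real (Suc n))) *\<^sub>R 0 + (1 / (c * real (Suc n))) *\<^sub>R (c *\<^sub>R z)"
      using c by simp
    also have "\<dots> \<in> A"
    proof (rule convexD[OF conv A0 c(2)])
      have "1 \<le> c * real (Suc n)" using n c by (simp add: field_simps)
      then show "0 \<le> 1 - 1 / (c * real (Suc n))" by (simp add: field_simps)
    qed (use c in auto)
    finally have "real (Suc n) *\<^sub>R ((1 / real (Suc n)) *\<^sub>R z) \<in> (*\<^sub>R) (real (Suc n)) ` A" by (rule imageI)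
    then show ?thesis by auto
  qed
  from Baire[OF this] obtain n z r where z: "z \<in> E" and r: "r > 0"
    and ball: "\<And>w e. w \<in> E \<Longrightarrow> N (w - z) < r \<Longrightarrow> e > 0 \<Longrightarrow>
      \<exists>b\<in>(*\<^sub>R) (real (Suc n)) ` A. N (w - b) < e"
    by blast
  define m where "m = real (Suc n)"
  have m: "m > 0" by (simp add: m_def)
  obtain c where c: "c > 0" "c *\<^sub>R (- (1/m) *\<^sub>R z) \<in> A"
    using absorbing[of "- (1/m) *\<^sub>R z"] z mem_scale by blast
  \<comment> \<open>Chosen so that \<open>(1 - t) * c = t\<close>: then the multiples of
    \<open>z\<close> cancel in the combination \<open>?a\<close> below.\<close>
  define t where "t = c / (1 + c)"
  have t: "0 < t" "t < 1" "1 - t = 1 / (1 + c)" using c by (auto simp: t_def field_simps)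
  obtain d where d: "d > 0" "\<And>x. x \<in> E \<Longrightarrow> N x < d \<Longrightarrow> N ((m / t) *\<^sub>R x) < r" using scale[OF r] by blast
  have "\<exists>a\<in>A. N (x - a) < e" if x: "x \<in> E" "N x < d" and e: "e > 0" for x e
  proof -
    obtain e' where e': "e' > 0" "\<And>y. y \<in> E \<Longrightarrow> N y < e' \<Longrightarrow> N ((t / m) *\<^sub>R y) < e" using scale[OF e] by blast
    have "N (z + (m / t) *\<^sub>R x - z) < r" using d x by simp
    then obtain a where a: "a \<in> A" "N (z + (m / t) *\<^sub>R x - m *\<^sub>R a) < e'"
      using ball[of "z + (m / t) *\<^sub>R x", OF _ _ e'(1)] z x mem_add mem_scale m_def by auto
    let ?a = "t *\<^sub>R a + (1 - t) *\<^sub>R (c *\<^sub>R (- (1/m) *\<^sub>R z))"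
    have "?a \<in> A" by (rule convexD[OF conv a(1) c(2)]) (use t c in auto)
    moreover have "x - ?a = (t / m) *\<^sub>R (z + (m / t) *\<^sub>R x - m *\<^sub>R a)"
    proof -
      have "(1 - t) * c = t" using t c by (simp add: t_def)
      then have "(1 - t) *\<^sub>R (c *\<^sub>R (- (1/m) *\<^sub>R z)) = - (t / m) *\<^sub>R z"
        by (metis (no_types, lifting) divide_inverse mult_minus_right scaleR_scaleR mult_1 mult.assoc)
      moreover have "(t / m) *\<^sub>R (z + (m / t) *\<^sub>R x - m *\<^sub>R a) = (t / m) *\<^sub>R z + x - t *\<^sub>R a"
        using m t by (simp add: scaleR_add_right scaleR_diff_right)
      ultimately show ?thesis by simp
    qed
    moreover have "N \<dots> < e"
      by (rule e'(2)[OF _ a(2)]) (use z x a AE mem_add mem_diff mem_scale in auto)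
    ultimately show ?thesis by metis
  qed
  then show ?thesis using d by blast
qed

end

text \<open>Local convexity is split off because the open mapping argument below asks it only of the
  space of the \<open>x\<close>. The completeness of the space of the \<open>z\<close> enters
  through Baire's theorem.\<close>

locale frechet_seminorm = complete_F_seminorm +
  assumes locally_convex: "0 < e \<Longrightarrow>
    \<exists>C d. convex C \<and> C \<subseteq> E \<and> 0 < d \<and> (\<forall>x\<in>E. N x < d \<longrightarrow> x \<in> C) \<and> (\<forall>x\<in>C. N x < e)"

text \<open>The Robinson--Ursescu theorem, at the point \<open>(0, 0)\<close> of the graph. Applied to graphs of
  linear maps it is the closed graph theorem.\<close>

theorem convex_relation_open:
  fixes XE :: "'a::real_vector set" and ZE :: "'b::real_vector set"
  assumes X: "frechet_seminorm XE NX" and Z: "complete_F_seminorm ZE NZ"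
    and conv: "convex \<Gamma>" and \<Gamma>E: "\<Gamma> \<subseteq> XE \<times> ZE" and \<Gamma>0: "(0, 0) \<in> \<Gamma>"
    and closed: "\<And>x z x' z'. (\<And>n::nat. (x n, z n) \<in> \<Gamma>) \<Longrightarrow> x' \<in> XE \<Longrightarrow> z' \<in> ZE \<Longrightarrow>
      (\<lambda>n. NX (x n - x')) \<longlonglongrightarrow> 0 \<Longrightarrow> (\<lambda>n. NZ (z n - z')) \<longlonglongrightarrow> 0 \<Longrightarrow> (x', z') \<in> \<Gamma>"
    and absorbing: "\<And>z. z \<in> ZE \<Longrightarrow> \<exists>c>0. \<exists>x. (x, c *\<^sub>R z) \<in> \<Gamma>"
    and e: "0 < e"
  shows "\<exists>d>0. \<forall>z\<in>ZE. NZ z < d \<longrightarrow> (\<exists>x. NX x < e \<and> (x, z) \<in> \<Gamma>)"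
proof -
  interpret X: frechet_seminorm XE NX by fact
  interpret Z: complete_F_seminorm ZE NZ by fact
  \<comment> \<open>The corrections add up to at most \<open>2 * e' = e / 2\<close>, which leaves
    the strict inequality \<open>NX x < e\<close>.\<close>
  define e' where "e' = e / 4"
  have e': "e' > 0" using e by (simp add: e'_def)
  have "\<exists>C d. convex C \<and> C \<subseteq> XE \<and> 0 < d \<and> (\<forall>x\<in>XE. NX x < d \<longrightarrow> x \<in> C) \<and> (\<forall>x\<in>C. NX x < e' * (1/2)^k)" for k
    by (rule X.locally_convex) (use e' in simp)
  then obtain C dC where C: "\<And>k. convex (C k)" "\<And>k. C k \<subseteq> XE" "\<And>k. 0 < dC k"
    "\<And>k x. x \<in> XE \<Longrightarrow> NX x < dC k \<Longrightarrow> x \<in> C k" "\<And>k x. x \<in> C k \<Longrightarrow> NX x < e' * (1/2)^k"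
    by metis
  have C0: "0 \<in> C k" for k using C(4)[OF X.mem_0, of k] C(3)[of k] by simp
  \<comment> \<open>Images of shrinking convex neighbourhoods: convex and absorbing, hence dense
    near \<open>0\<close>, but not known to contain a neighbourhood. The recursion below closes this
    gap.\<close>
  define A where "A k = {z. \<exists>x\<in>C k. (x, z) \<in> \<Gamma>}" for k
  have "\<exists>d>0. \<forall>z\<in>ZE. NZ z < d \<longrightarrow> (\<forall>r>0. \<exists>a\<in>A k. NZ (z - a) < r)" for k
  proof (rule Z.absorbing_convex_closure)
    show "convex (A k)"
    proof (rule convexI)
      fix a b and u v :: real assume ab: "a \<in> A k" "b \<in> A k" and uv: "0 \<le> u" "0 \<le> v" "u + v = 1"
      obtain x y where xy: "x \<in> C k" "y \<in> C k" "(x, a) \<in> \<Gamma>" "(y, b) \<in> \<Gamma>" using ab by (auto simp: A_def)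
      have "u *\<^sub>R x + v *\<^sub>R y \<in> C k" using convexD[OF C(1)] xy uv by blast
      moreover have "u *\<^sub>R (x, a) + v *\<^sub>R (y, b) \<in> \<Gamma>" using convexD[OF conv] xy uv by blast
      ultimately show "u *\<^sub>R a + v *\<^sub>R b \<in> A k" by (auto simp: A_def)
    qed
    show "A k \<subseteq> ZE" using \<Gamma>E by (auto simp: A_def)
    show "0 \<in> A k" using C0 \<Gamma>0 by (auto simp: A_def)
    fix z assume z: "z \<in> ZE"
    obtain c x where c: "c > 0" "(x, c *\<^sub>R z) \<in> \<Gamma>" using absorbing z by blast
    have xE: "x \<in> XE" using c \<Gamma>E by blast
    obtain d where d: "d > 0" "\<And>t. \<bar>t\<bar> < d \<Longrightarrow> NX (t *\<^sub>R x) < dC k" using X.scale_zero[OF xE C(3)] by blast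
    define t where "t = min 1 (d / 2)"
    have t: "0 < t" "t \<le> 1" "\<bar>t\<bar> < d" using d by (auto simp: t_def)
    have "t *\<^sub>R x \<in> C k" using C(4) d t X.mem_scale xE by blast
    moreover have "t *\<^sub>R (x, c *\<^sub>R z) + (1 - t) *\<^sub>R (0, 0) \<in> \<Gamma>"
      using convexD[OF conv c(2) \<Gamma>0, of t "1 - t"] t by simp
    ultimately have "(t * c) *\<^sub>R z \<in> A k" by (auto simp: A_def)
    then show "\<exists>c>0. c *\<^sub>R z \<in> A k" using t c by (intro exI[of _ "t * c"]) simp
  qed
  then obtain D where D: "\<And>k. 0 < D k"
    "\<And>k z r. z \<in> ZE \<Longrightarrow> NZ z < D k \<Longrightarrow> r > 0 \<Longrightarrow> \<exists>a\<in>A k. NZ (z - a) < r" by metis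
  \<comment> \<open>\<open>r\<close> is a remainder rescaled by a power of 2. The last clause makes
    the unscaled remainder tend to 0; this does not follow from the bounds \<open>D k\<close> alone,
    as \<open>NZ\<close> is not homogeneous.\<close>
  have pick: "\<exists>x a. x \<in> C k \<and> (x, a) \<in> \<Gamma> \<and> NZ (2 *\<^sub>R (r - a)) < D (Suc k) \<and> NZ ((1/2)^(Suc (Suc k)) *\<^sub>R (2 *\<^sub>R (r - a))) < (1/2)^k"
    if r: "r \<in> ZE" "NZ r < D k" for k r
  proof -
    obtain d1 where d1: "d1 > 0" "\<And>y. y \<in> ZE \<Longrightarrow> NZ y < d1 \<Longrightarrow> NZ (2 *\<^sub>R y) < D (Suc k)" using Z.scale[OF D(1)] by blast
    obtain d2 where d2: "d2 > 0" "\<And>y. y \<in> ZE \<Longrightarrow> NZ y < d2 \<Longrightarrow> NZ (((1/2)^(Suc (Suc k)) * 2) *\<^sub>R y) < (1/2)^k"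
      using Z.scale[of "(1/2)^k" "(1/2)^(Suc (Suc k)) * 2"] by auto
    obtain a where a: "a \<in> A k" "NZ (r - a) < min d1 d2" using D(2)[OF r, of "min d1 d2"] d1 d2 by auto
    have aE: "a \<in> ZE" using a \<Gamma>E by (auto simp: A_def)
    then have "r - a \<in> ZE" using r Z.mem_diff by blast
    then show ?thesis using a d1(2)[of "r - a"] d2(2)[of "r - a"] by (auto simp: A_def)
  qed
  define good where "good k r xa \<longleftrightarrow> fst xa \<in> C k \<and> xa \<in> \<Gamma> \<and> NZ (2 *\<^sub>R (r - snd xa)) < D (Suc k) \<and>
     NZ ((1/2)^(Suc (Suc k)) *\<^sub>R (2 *\<^sub>R (r - snd xa))) < (1/2)^k" for k r and xa :: "'a \<times> 'b"
  define fx where "fx k r = fst (Eps (good k r))" for k r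
  define fa where "fa k r = snd (Eps (good k r))" for k r
  have P: "fx k r \<in> C k \<and> (fx k r, fa k r) \<in> \<Gamma> \<and>
     NZ (2 *\<^sub>R (r - fa k r)) < D (Suc k) \<and> NZ ((1/2)^(Suc (Suc k)) *\<^sub>R (2 *\<^sub>R (r - fa k r))) < (1/2)^k"
    if "r \<in> ZE" "NZ r < D k" for k r
  proof -
    have "\<exists>xa. good k r xa" using pick[OF that] unfolding good_def by (metis fst_conv snd_conv)
    then have "good k r (Eps (good k r))" by (rule someI_ex)
    then show ?thesis by (simp add: good_def fx_def fa_def)
  qed
  obtain d where d: "d > 0" "\<And>z. z \<in> ZE \<Longrightarrow> NZ z < d \<Longrightarrow> NZ (2 *\<^sub>R z) < D 0" using Z.scale[OF D(1)] by blast
  have "\<exists>x. NX x < e \<and> (x, z) \<in> \<Gamma>" if z: "z \<in> ZE" "NZ z < d" for z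
  proof -
    define R where "R = rec_nat (2 *\<^sub>R z) (\<lambda>k r. 2 *\<^sub>R (r - fa k r))"
    have R: "R 0 = 2 *\<^sub>R z" "\<And>k. R (Suc k) = 2 *\<^sub>R (R k - fa k (R k))" by (simp_all add: R_def)
    have Rin: "R k \<in> ZE \<and> NZ (R k) < D k" for k
    proof (induction k)
      case 0 then show ?case using d z Z.mem_scale by (simp add: R)
    next
      case (Suc k)
      then have "fa k (R k) \<in> ZE" using P[of "R k" k] \<Gamma>E by blast
      then show ?case using P[of "R k" k] Suc Z.mem_scale Z.mem_diff by (simp add: R)
    qed
    define x where "x k = fx k (R k)" for k
    define a where "a k = fa k (R k)" for k
    have xa: "x k \<in> C k" "(x k, a k) \<in> \<Gamma>" "NZ ((1/2)^(Suc (Suc k)) *\<^sub>R R (Suc k)) < (1/2)^k" for k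
      using P[of "R k" k] Rin[of k] by (auto simp: x_def a_def R)
    have aE: "a k \<in> ZE" and xE: "x k \<in> XE" for k using xa(2)[of k] \<Gamma>E by auto
    define sx where "sx n = (\<Sum>j<n. (1/2)^(Suc j) *\<^sub>R x j)" for n
    define sa where "sa n = (\<Sum>j<n. (1/2)^(Suc j) *\<^sub>R a j)" for n
    \<comment> \<open>The weights \<open>1/2, ..., (1/2)^n\<close> leave the mass
      \<open>(1/2)^n\<close>, which any point of \<open>\<Gamma>\<close> may carry; giving it to
      \<open>(0, 0)\<close> puts the partial sums themselves into \<open>\<Gamma>\<close>.\<close>
    have comb: "(sx n, sa n) + (1/2)^n *\<^sub>R (x', a') \<in> \<Gamma>" if "(x', a') \<in> \<Gamma>" for n x' a'
      using that
    proof (induction n arbitrary: x' a')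
      case 0 then show ?case by (simp add: sx_def sa_def zero_prod_def)
    next
      case (Suc n)
      have "(1/2) *\<^sub>R (x n, a n) + (1/2) *\<^sub>R (x', a') \<in> \<Gamma>"
        using convexD[OF conv xa(2) Suc.prems, of "1/2" "1/2" n] by simp
      then have "(sx n, sa n) + (1/2)^n *\<^sub>R ((1/2) *\<^sub>R x n + (1/2) *\<^sub>R x', (1/2) *\<^sub>R a n + (1/2) *\<^sub>R a') \<in> \<Gamma>"
        using Suc.IH by simp
      then show ?case by (simp add: sx_def sa_def scaleR_add_right add.assoc mult.commute)
    qed
    have sxE: "sx n \<in> XE" and saE: "sa n \<in> ZE" and in\<Gamma>: "(sx n, sa n) \<in> \<Gamma>" for n
      using comb[OF \<Gamma>0, of n] \<Gamma>E by auto
    have rem: "z - sa n = (1/2)^(Suc n) *\<^sub>R R n" for n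
    proof (induction n)
      case 0 then show ?case by (simp add: sa_def R)
    next
      case (Suc n)
      have "z - sa (Suc n) = (z - sa n) - (1/2)^(Suc n) *\<^sub>R a n" by (simp add: sa_def)
      also have "\<dots> = (1/2)^(Suc (Suc n)) *\<^sub>R R (Suc n)" unfolding Suc R a_def[symmetric]
        by (simp add: scaleR_diff_right)
      finally show ?case .
    qed
    have sa: "(\<lambda>n. NZ (sa n - z)) \<longlonglongrightarrow> 0"
    proof (rule LIMSEQ_imp_Suc, rule tendsto_sandwich[OF _ _ tendsto_const LIMSEQ_power_zero[of "1/2::real"]])
      show "\<forall>\<^sub>F n in sequentially. NZ (sa (Suc n) - z) \<le> (1/2)^n"
        using xa(3) rem Z.diff_commute[OF saE z(1)] by (auto intro!: always_eventually less_imp_le)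
    qed (use saE z Z.mem_diff Z.nonneg in auto)
    have "NX (sx (Suc n) - sx n) \<le> e' * (1/2)^n" for n
    proof -
      have "(1/2)^(Suc n) *\<^sub>R x n + (1 - (1/2)^(Suc n)) *\<^sub>R 0 \<in> C n"
        by (rule convexD[OF C(1) xa(1) C0]) (use power_le_one[of "1/2::real" "Suc n"] in auto)
      then show ?thesis using C(5)[of "(1/2)^(Suc n) *\<^sub>R x n" n] by (simp add: sx_def less_imp_le)
    qed
    then obtain x' where x': "x' \<in> XE" "(\<lambda>n. NX (sx n - x')) \<longlonglongrightarrow> 0" "NX (x' - sx 0) \<le> 2 * e' * (1/2) ^ 0"
      using X.complete_geometric[of sx e'] sxE e' by metis
    have "(x', z) \<in> \<Gamma>" by (rule closed[OF in\<Gamma> x'(1) z(1) x'(2) sa])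
    moreover have "NX x' < e" using x'(3) e by (simp add: sx_def e'_def)
    ultimately show ?thesis by blast
  qed
  then show ?thesis using d by blast
qed

section \<open>Hahn--Banach theorems for sublinear functionals and cones\<close>

lemma sublinear_chain_inf:
  fixes C :: "('a::real_vector \<Rightarrow> real) set"
  assumes C: "C \<noteq> {}" "\<And>p q. p \<in> C \<Longrightarrow> q \<in> C \<Longrightarrow> (\<forall>x. p x \<le> q x) \<or> (\<forall>x. q x \<le> p x)"
    and add: "\<And>p x y. p \<in> C \<Longrightarrow> p (x + y) \<le> p x + p y"
    and scale: "\<And>p c x. p \<in> C \<Longrightarrow> 0 < c \<Longrightarrow> p (c *\<^sub>R x) = c * p x"
    and bdd: "\<And>x. bdd_below ((\<lambda>p. p x) ` C)"
  shows "(INF p\<in>C. p (x + y)) \<le> (INF p\<in>C. p x) + (INF p\<in>C. p y)"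
    and "0 < c \<Longrightarrow> (INF p\<in>C. p (c *\<^sub>R x)) = c * (INF p\<in>C. p x)"
proof -
  have le: "(INF p\<in>C. p x) \<le> p x" if "p \<in> C" for p x using cINF_lower[OF bdd that] .
  \<comment> \<open>The smaller of the two chain members bounds the infimum at \<open>x + y\<close>
    by its own values at \<open>x\<close> and \<open>y\<close>, one of which lies below the value of
    the other member.\<close>
  have "(INF p\<in>C. p (x + y)) - p x \<le> q y" if "p \<in> C" "q \<in> C" for p q
    using C(2)[OF that]
  proof
    assume "\<forall>x. p x \<le> q x"
    then show ?thesis using le[OF that(1), of "x + y"] add[OF that(1), of x y] by (auto dest: spec[of _ y])
  next
    assume "\<forall>x. q x \<le> p x"
    then show ?thesis using le[OF that(2), of "x + y"] add[OF that(2), of x y] by (auto dest: spec[of _ x])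
  qed
  then have "(INF p\<in>C. p (x + y)) - p x \<le> (INF q\<in>C. q y)" if "p \<in> C" for p
    using that C(1) by (intro cINF_greatest) auto
  then have "(INF p\<in>C. p (x + y)) - (INF q\<in>C. q y) \<le> (INF p\<in>C. p x)"
    using C(1) by (intro cINF_greatest) (auto simp: algebra_simps)
  then show "(INF p\<in>C. p (x + y)) \<le> (INF p\<in>C. p x) + (INF p\<in>C. p y)" by simp
  assume c: "0 < c"
  show "(INF p\<in>C. p (c *\<^sub>R x)) = c * (INF p\<in>C. p x)"
  proof (rule antisym)
    have "(INF p\<in>C. p (c *\<^sub>R x)) / c \<le> p x" if "p \<in> C" for p
      using le[OF that, of "c *\<^sub>R x"] scale[OF that c, of x] c by (simp add: field_simps)
    then have "(INF p\<in>C. p (c *\<^sub>R x)) / c \<le> (INF p\<in>C. p x)" using C(1) by (intro cINF_greatest) auto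
    then show "(INF p\<in>C. p (c *\<^sub>R x)) \<le> c * (INF p\<in>C. p x)" using c by (simp add: field_simps)
    show "c * (INF p\<in>C. p x) \<le> (INF p\<in>C. p (c *\<^sub>R x))"
      using C(1) le c by (intro cINF_greatest) (auto simp: scale)
  qed
qed

text \<open>A minimal sublinear functional is linear.\<close>

theorem Hahn_Banach_sublinear:
  fixes \<rho> :: "'a::real_vector \<Rightarrow> real"
  assumes add: "\<And>x y. \<rho> (x + y) \<le> \<rho> x + \<rho> y" and scale: "\<And>c x. 0 < c \<Longrightarrow> \<rho> (c *\<^sub>R x) = c * \<rho> x"
  shows "\<exists>l. linear l \<and> (\<forall>x. l x \<le> \<rho> x)"
proof -
  define S where "S = {p :: 'a \<Rightarrow> real. (\<forall>x y. p (x + y) \<le> p x + p y) \<and>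
    (\<forall>c x. 0 < c \<longrightarrow> p (c *\<^sub>R x) = c * p x) \<and> (\<forall>x. p x \<le> \<rho> x)}"
  have S: "p (x + y) \<le> p x + p y" "0 < c \<Longrightarrow> p (c *\<^sub>R x) = c * p x" "p x \<le> \<rho> x" if "p \<in> S" for p x y c
    using that by (auto simp: S_def)
  have S0: "p 0 = 0" if "p \<in> S" for p using S(2)[OF that, of 2 0] by simp
  \<comment> \<open>A lower bound common to all of \<open>S\<close>, so that infima of chains stay
    finite.\<close>
  have lower: "- \<rho> (- x) \<le> p x" if "p \<in> S" for p x
    using S(1)[OF that, of x "- x"] S0[OF that] S(3)[OF that, of "- x"] by simp
  have \<rho>S: "\<rho> \<in> S" using add scale by (auto simp: S_def)
  \<comment> \<open>Zorn's lemma yields maximal elements; the reversed pointwise order makes them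
    minimal functionals.\<close>
  define P where "P = (\<lambda>p q :: 'a \<Rightarrow> real. \<forall>x. q x \<le> p x)"
  have "\<exists>m\<in>S. \<forall>a\<in>S. P m a \<longrightarrow> a = m"
  proof (rule predicate_Zorn)
    show "partial_order_on S (relation_of P S)"
    proof (rule partial_order_on_relation_ofI)
      show "P a c" if "P a b" "P b c" for a b c using that unfolding P_def by (meson order_trans)
      show "a = b" if "P a b" "P b a" for a b using that unfolding P_def by (intro ext antisym) auto
    qed (simp add: P_def)
    fix C assume C: "C \<in> Chains (relation_of P S)"
    have CS: "C \<subseteq> S" using C by (auto simp: Chains_def relation_of_def)
    have tot: "(\<forall>x. p x \<le> q x) \<or> (\<forall>x. q x \<le> p x)" if "p \<in> C" "q \<in> C" for p q
      using C that by (auto simp: Chains_def relation_of_def P_def)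
    have bdd: "bdd_below ((\<lambda>p. p x) ` C)" for x using lower CS by (intro bdd_belowI2) auto
    show "\<exists>u\<in>S. \<forall>a\<in>C. P a u"
    proof (cases "C = {}")
      case False
      have "(\<lambda>x. INF p\<in>C. p x) \<in> S"
      proof -
        obtain p where p: "p \<in> C" using False by blast
        have "(INF p\<in>C. p x) \<le> \<rho> x" for x
          using cINF_lower[OF bdd p, of x] S(3)[of p x] p CS by force
        moreover have "(INF p\<in>C. p (x + y)) \<le> (INF p\<in>C. p x) + (INF p\<in>C. p y)" for x y
          by (rule sublinear_chain_inf(1)[OF False tot _ _ bdd]) (use S CS in blast)+
        moreover have "(INF p\<in>C. p (c *\<^sub>R x)) = c * (INF p\<in>C. p x)" if "0 < c" for c x
          by (rule sublinear_chain_inf(2)[OF False tot _ _ bdd that]) (use S CS in blast)+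
        ultimately show ?thesis unfolding S_def by blast
      qed
      moreover have "P p (\<lambda>x. INF p\<in>C. p x)" if "p \<in> C" for p
        using cINF_lower[OF bdd that] by (simp add: P_def)
      ultimately show ?thesis by blast
    qed (use \<rho>S in auto)
  qed
  then obtain p where pS: "p \<in> S" and min: "\<And>q. q \<in> S \<Longrightarrow> (\<And>x. q x \<le> p x) \<Longrightarrow> q = p"
    by (auto simp: P_def)
  have sup: "p x + p h \<le> p (x + h)" for x h
  proof -
    \<comment> \<open>Sublinear and below \<open>p\<close>, hence equal to \<open>p\<close> by
      minimality; the term \<open>t = 1\<close> then gives superadditivity in the direction
      \<open>h\<close>.\<close>
    define q where "q x = (INF t\<in>{0..}. p (x + t *\<^sub>R h) - t * p h)" for x
    have tp: "p (t *\<^sub>R h) = t * p h" if "0 \<le> t" for t using S(2)[OF pS, of t h] S0[OF pS] that by (cases "t = 0") auto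
    have bound: "- p (- x) \<le> p (x + t *\<^sub>R h) - t * p h" if "0 \<le> t" for t x
      using S(1)[OF pS, of "x + t *\<^sub>R h" "- x"] tp[OF that] by simp
    have bdd: "bdd_below ((\<lambda>t. p (x + t *\<^sub>R h) - t * p h) ` {0..})" for x
      using bound by (intro bdd_belowI2) auto
    have low: "q x \<le> p (x + t *\<^sub>R h) - t * p h" if "0 \<le> t" for t x
      unfolding q_def using cINF_lower[OF bdd] that by simp
    have great: "m \<le> q x" if "\<And>t. 0 \<le> t \<Longrightarrow> m \<le> p (x + t *\<^sub>R h) - t * p h" for m x
      unfolding q_def using that by (intro cINF_greatest) auto
    have qp: "q x \<le> p x" for x using low[of 0 x] by simp
    have "q \<in> S"
    proof -
      have "q (x + y) \<le> q x + q y" for x y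
      proof -
        have *: "q (x + y) \<le> (p (x + s *\<^sub>R h) - s * p h) + (p (y + t *\<^sub>R h) - t * p h)" if "0 \<le> s" "0 \<le> t" for s t
          using low[of "s + t" "x + y"] S(1)[OF pS, of "x + s *\<^sub>R h" "y + t *\<^sub>R h"] that by (simp add: algebra_simps)
        have "q (x + y) - (p (x + s *\<^sub>R h) - s * p h) \<le> q y" if "0 \<le> s" for s
          by (rule great) (use *[OF that] in \<open>simp add: algebra_simps\<close>)
        then have "q (x + y) - q y \<le> q x" by (intro great) (simp add: algebra_simps)
        then show ?thesis by simp
      qed
      moreover have "q (c *\<^sub>R x) = c * q x" if c: "0 < c" for c x
      proof (rule antisym)
        have "q (c *\<^sub>R x) / c \<le> q x"
        proof (rule great)
          fix t :: real assume "0 \<le> t"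
          then show "q (c *\<^sub>R x) / c \<le> p (x + t *\<^sub>R h) - t * p h"
            using low[of "c * t" "c *\<^sub>R x"] S(2)[OF pS c, of "x + t *\<^sub>R h"] c
            by (simp add: field_simps scaleR_add_right)
        qed
        then show "q (c *\<^sub>R x) \<le> c * q x" using c by (simp add: field_simps)
        show "c * q x \<le> q (c *\<^sub>R x)"
        proof (rule great)
          fix t :: real assume "0 \<le> t"
          then show "c * q x \<le> p (c *\<^sub>R x + t *\<^sub>R h) - t * p h"
            using low[of "t / c" "x"] S(2)[OF pS c, of "x + (t / c) *\<^sub>R h"] c
            by (simp add: field_simps scaleR_add_right)
        qed
      qed
      moreover have "q x \<le> \<rho> x" for x using qp[of x] S(3)[OF pS, of x] by simp
      ultimately show ?thesis by (auto simp: S_def)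
    qed
    then have "q = p" using min qp by blast
    then show ?thesis using low[of 1 x] by simp
  qed
  have padd: "p (x + y) = p x + p y" for x y using sup[of x y] S(1)[OF pS, of x y] by simp
  have pneg: "p (- x) = - p x" for x using padd[of x "- x"] S0[OF pS] by simp
  have "p (c *\<^sub>R x) = c * p x" for c x
  proof (cases c "0::real" rule: linorder_cases)
    case less then show ?thesis using S(2)[OF pS, of "- c" x] pneg[of "c *\<^sub>R x"] by simp
  qed (use S(2)[OF pS] S0[OF pS] in auto)
  then have "linear p" using padd by (intro linearI) auto
  then show ?thesis using S(3)[OF pS] by blast
qed

text \<open>\<open>Q\<close> describes a convex cone of pairs \<open>(a, v)\<close>, like the
  epigraph of a sublinear functional. Its lower envelope is finite: from above because every
  \<open>v\<close> has some \<open>a\<close>, from below because a pair at \<open>v\<close> and one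
  at \<open>- v\<close> add up to a pair at \<open>0\<close>.\<close>

lemma Hahn_Banach_cone:
  fixes E :: "'a::real_vector set" and Q :: "real \<Rightarrow> 'a \<Rightarrow> bool"
  assumes E: "subspace E"
    and add: "\<And>a b v w. Q a v \<Longrightarrow> Q b w \<Longrightarrow> Q (a + b) (v + w)"
    and scale: "\<And>a v c. Q a v \<Longrightarrow> 0 < c \<Longrightarrow> Q (c * a) (c *\<^sub>R v)"
    and absorbing: "\<And>v. v \<in> E \<Longrightarrow> \<exists>a. Q a v" and nonneg: "\<And>a. Q a 0 \<Longrightarrow> 0 \<le> a"
  obtains l where "linear l" "\<And>a v. v \<in> E \<Longrightarrow> Q a v \<Longrightarrow> l v \<le> a"
proof -
  \<comment> \<open>A linear projection onto \<open>E\<close> extends the envelope to the whole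
    type, on which \<open>Hahn_Banach_sublinear\<close> is stated.\<close>
  obtain \<pi> :: "'a \<Rightarrow> 'a" where \<pi>: "range \<pi> \<subseteq> E" "linear \<pi>" "\<And>v. v \<in> E \<Longrightarrow> \<pi> v = v"
    using linear_exists_left_inverse_on[OF linear_id E] by (auto simp: inj_on_def)
  have \<pi>E: "\<pi> v \<in> E" for v using \<pi>(1) by blast
  define \<rho> where "\<rho> v = Inf {a. Q a (\<pi> v)}" for v
  have ne: "{a. Q a (\<pi> v)} \<noteq> {}" for v using absorbing[OF \<pi>E] by blast
  have bdd: "bdd_below {a. Q a (\<pi> v)}" for v
  proof -
    obtain b where b: "Q b (- \<pi> v)" using absorbing[of "- \<pi> v"] \<pi>E subspace_neg[OF E] by blast
    show ?thesis by (rule bdd_belowI[of _ "- b"]) (use nonneg add[OF _ b] in force)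
  qed
  have low: "\<rho> v \<le> a" if "Q a (\<pi> v)" for a v unfolding \<rho>_def using that bdd by (intro cInf_lower) auto
  have great: "m \<le> \<rho> v" if "\<And>a. Q a (\<pi> v) \<Longrightarrow> m \<le> a" for m v
    unfolding \<rho>_def using that ne by (intro cInf_greatest) auto
  have "\<exists>l. linear l \<and> (\<forall>x. l x \<le> \<rho> x)"
  proof (rule Hahn_Banach_sublinear)
    fix x y
    have "\<rho> (x + y) - a \<le> \<rho> y" if "Q a (\<pi> x)" for a
      by (rule great) (use low add[OF that] linear_add[OF \<pi>(2)] in \<open>force simp: algebra_simps\<close>)
    then have "\<rho> (x + y) - \<rho> y \<le> \<rho> x" by (intro great) (simp add: algebra_simps)
    then show "\<rho> (x + y) \<le> \<rho> x + \<rho> y" by simp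
  next
    fix c :: real and x assume c: "0 < c"
    show "\<rho> (c *\<^sub>R x) = c * \<rho> x"
    proof (rule antisym)
      have "\<rho> (c *\<^sub>R x) / c \<le> \<rho> x"
        by (rule great) (use low[of _ "c *\<^sub>R x"] scale[OF _ c] c linear_scale[OF \<pi>(2)] in \<open>force simp: field_simps\<close>)
      then show "\<rho> (c *\<^sub>R x) \<le> c * \<rho> x" using c by (simp add: field_simps)
      show "c * \<rho> x \<le> \<rho> (c *\<^sub>R x)"
      proof (rule great)
        fix a assume "Q a (\<pi> (c *\<^sub>R x))"
        then have "Q ((1/c) * a) (\<pi> x)" using scale[of a "\<pi> (c *\<^sub>R x)" "1/c"] c linear_scale[OF \<pi>(2)] by simp
        then show "c * \<rho> x \<le> a" using low c by (force simp: field_simps)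
      qed
    qed
  qed
  then obtain l where "linear l" "\<And>x. l x \<le> \<rho> x" by blast
  then show thesis using that low \<pi>(3) by (metis order_trans)
qed

section \<open>Spaces of random variables in duality\<close>

lemma scaleR_fun_apply [simp]: "(c *\<^sub>R g) a = c *\<^sub>R g a"
  by (simp add: scaleR_fun_def)

text \<open>Decomposability at \<open>A = {}\<close> yields the function cut off outside
  \<open>space M\<close>; solidity removes this cut-off, because it compares almost surely
  only.\<close>

lemma L_infinity_subset:
  fixes X :: "('w \<Rightarrow> real^'k::finite) set"
  assumes "random_variable_space M X" "decomposable M X" "solid M X"
  shows "L_infinity M \<subseteq> X"
proof
  fix x :: "'w \<Rightarrow> real^'k" assume x: "x \<in> L_infinity M"
  have m: "x \<in> borel_measurable M" using x by (simp add: L_infinity_def)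
  have "0 \<in> X" using assms(1) by (simp add: random_variable_space_def subspace_def)
  then have "(\<lambda>\<omega>. indicator {} \<omega> *\<^sub>R (0 :: 'w \<Rightarrow> real^'k) \<omega> + indicator (space M - {}) \<omega> *\<^sub>R x \<omega>) \<in> X"
    using assms(2)[unfolded decomposable_def, rule_format, of 0 x "{}"] x by simp
  then have "(\<lambda>\<omega>. indicator (space M) \<omega> *\<^sub>R x \<omega>) \<in> X" by simp
  moreover have "AE \<omega> in M. \<bar>x \<omega> $ i\<bar> \<le> \<bar>(indicator (space M) \<omega> *\<^sub>R x \<omega>) $ i\<bar>" for i
    by (rule AE_I2) simp
  ultimately show "x \<in> X" using assms(3)[unfolded solid_def, rule_format] m by blast
qed

text \<open>\<open>frechet_space\<close> only asserts that a metric exists; making it a parameter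
  allows its F-seminorm to be a constant of the context.\<close>

locale rv_duality = prob_space M for M :: "'w measure" +
  fixes X V :: "('w \<Rightarrow> real^'k::finite) set" and S :: "('w \<Rightarrow> real^'k) topology"
    and d :: "('w \<Rightarrow> real^'k) \<Rightarrow> ('w \<Rightarrow> real^'k) \<Rightarrow> real"
  assumes rv: "random_variable_space M X" "random_variable_space M V"
    and separating: "separating_duality M X V"
    and decomp: "decomposable M X" "decomposable M V"
    and solidX: "solid M X" and solidV: "solid M V"
    and topspace: "topspace S = X"
    and scale_cont: "continuous_map (prod_topology euclideanreal S) S (\<lambda>(c, x). c *\<^sub>R x)"
    and loc_convex: "\<And>G. openin S G \<Longrightarrow> 0 \<in> G \<Longrightarrow> \<exists>C. openin S C \<and> convex C \<and> 0 \<in> C \<and> C \<subseteq> G"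
    and metric: "ae_metric_on M X d"
    and invariant: "\<And>x y z. x \<in> X \<Longrightarrow> y \<in> X \<Longrightarrow> z \<in> X \<Longrightarrow> d (x + z) (y + z) = d x y"
    and openin: "\<And>G. openin S G \<longleftrightarrow> G \<subseteq> X \<and> (\<forall>x\<in>G. \<exists>\<epsilon>>0. \<forall>y\<in>X. d x y < \<epsilon> \<longrightarrow> y \<in> G)"
    and cauchy: "\<And>\<sigma>::nat \<Rightarrow> 'w \<Rightarrow> real^'k. range \<sigma> \<subseteq> X \<Longrightarrow>
      (\<forall>\<epsilon>>0. \<exists>K. \<forall>j\<ge>K. \<forall>k\<ge>K. d (\<sigma> j) (\<sigma> k) < \<epsilon>) \<Longrightarrow> \<exists>x\<in>X. (\<lambda>k. d (\<sigma> k) x) \<longlonglongrightarrow> 0"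
    and dual: "dual_decomposition M S V"

lemma rv_duality_exists:
  fixes M :: "'w measure" and X :: "('w \<Rightarrow> real^'k::finite) set"
  assumes "prob_space M" "random_variable_space M X" "random_variable_space M V"
    "separating_duality M X V" "decomposable M X" "decomposable M V" "solid M X" "solid M V"
    "strong_topology M X V S"
  shows "\<exists>d. rv_duality M X V S d"
proof -
  have F: "frechet_space M S" and top: "topspace S = X" and dd: "dual_decomposition M S V"
    using assms by (auto simp: strong_topology_def)
  have "\<exists>d. ae_metric_on M X d \<and>
        (\<forall>x\<in>X. \<forall>y\<in>X. \<forall>z\<in>X. d (x + z) (y + z) = d x y) \<and>
        (\<forall>G. openin S G \<longleftrightarrow> G \<subseteq> X \<and> (\<forall>x\<in>G. \<exists>\<epsilon>>0. \<forall>y\<in>X. d x y < \<epsilon> \<longrightarrow> y \<in> G)) \<and>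
        (\<forall>\<sigma>::nat \<Rightarrow> 'w \<Rightarrow> real^'k. range \<sigma> \<subseteq> X \<and>
           (\<forall>\<epsilon>>0. \<exists>K. \<forall>j\<ge>K. \<forall>k\<ge>K. d (\<sigma> j) (\<sigma> k) < \<epsilon>) \<longrightarrow>
           (\<exists>x\<in>X. (\<lambda>k. d (\<sigma> k) x) \<longlonglongrightarrow> 0))"
    using F unfolding frechet_space_def top by (elim conjE)
  then obtain d where d: "ae_metric_on M X d"
      "\<forall>x\<in>X. \<forall>y\<in>X. \<forall>z\<in>X. d (x + z) (y + z) = d x y"
      "\<forall>G. openin S G \<longleftrightarrow> G \<subseteq> X \<and> (\<forall>x\<in>G. \<exists>\<epsilon>>0. \<forall>y\<in>X. d x y < \<epsilon> \<longrightarrow> y \<in> G)"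
      "\<forall>\<sigma>::nat \<Rightarrow> 'w \<Rightarrow> real^'k. range \<sigma> \<subseteq> X \<and>
           (\<forall>\<epsilon>>0. \<exists>K. \<forall>j\<ge>K. \<forall>k\<ge>K. d (\<sigma> j) (\<sigma> k) < \<epsilon>) \<longrightarrow>
           (\<exists>x\<in>X. (\<lambda>k. d (\<sigma> k) x) \<longlonglongrightarrow> 0)" by (elim exE conjE)
  have sc: "continuous_map (prod_topology euclideanreal S) S (\<lambda>(c, x). c *\<^sub>R x)"
    using F unfolding frechet_space_def by (elim conjE)
  have lc: "\<forall>G. openin S G \<and> 0 \<in> G \<longrightarrow> (\<exists>C. openin S C \<and> convex C \<and> 0 \<in> C \<and> C \<subseteq> G)"
    using F unfolding frechet_space_def by (elim conjE)
  show ?thesis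
  proof (intro exI[of _ d] rv_duality.intro rv_duality_axioms.intro)
    show "\<And>G. openin S G \<Longrightarrow> 0 \<in> G \<Longrightarrow> \<exists>C. openin S C \<and> convex C \<and> 0 \<in> C \<and> C \<subseteq> G" using lc by simp
    show "\<And>x y z. x \<in> X \<Longrightarrow> y \<in> X \<Longrightarrow> z \<in> X \<Longrightarrow> d (x + z) (y + z) = d x y" using d(2) by simp
    show "\<And>G. openin S G \<longleftrightarrow> G \<subseteq> X \<and> (\<forall>x\<in>G. \<exists>\<epsilon>>0. \<forall>y\<in>X. d x y < \<epsilon> \<longrightarrow> y \<in> G)" using d(3) by (rule spec)
    show "\<And>\<sigma>::nat \<Rightarrow> 'w \<Rightarrow> real^'k. range \<sigma> \<subseteq> X \<Longrightarrow>
      (\<forall>\<epsilon>>0. \<exists>K. \<forall>j\<ge>K. \<forall>k\<ge>K. d (\<sigma> j) (\<sigma> k) < \<epsilon>) \<Longrightarrow> \<exists>x\<in>X. (\<lambda>k. d (\<sigma> k) x) \<longlonglongrightarrow> 0"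
      using d(4) by simp
  qed (fact assms top dd d(1) sc)+
qed

context rv_duality
begin

definition N :: "('w \<Rightarrow> real^'k) \<Rightarrow> real" where "N x = d x 0"

lemma subspace_X: "subspace X" and subspace_V: "subspace V"
  and meas_X: "x \<in> X \<Longrightarrow> x \<in> borel_measurable M" and meas_V: "v \<in> V \<Longrightarrow> v \<in> borel_measurable M"
  using rv by (auto simp: random_variable_space_def)

lemma X_0: "0 \<in> X" and X_add: "x \<in> X \<Longrightarrow> y \<in> X \<Longrightarrow> x + y \<in> X"
  and X_diff: "x \<in> X \<Longrightarrow> y \<in> X \<Longrightarrow> x - y \<in> X"
  and X_scale: "x \<in> X \<Longrightarrow> c *\<^sub>R x \<in> X" and X_minus: "x \<in> X \<Longrightarrow> - x \<in> X"
  using subspace_X by (auto simp: subspace_def intro: subspace_diff subspace_neg)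

lemma d_props: assumes "x \<in> X" "y \<in> X"
  shows d_nonneg: "0 \<le> d x y" and d_sym: "d x y = d y x" and d_zero: "d x y = 0 \<longleftrightarrow> ae_eq M x y"
  using metric assms by (auto simp: ae_metric_on_def)

lemma d_triangle: "x \<in> X \<Longrightarrow> y \<in> X \<Longrightarrow> z \<in> X \<Longrightarrow> d x z \<le> d x y + d y z"
  using metric by (auto simp: ae_metric_on_def)

lemma d_N: "x \<in> X \<Longrightarrow> y \<in> X \<Longrightarrow> d x y = N (x - y)"
  using invariant[of x y "- y"] X_minus by (simp add: N_def)

lemma open_ball: "openin S {x \<in> X. N x < e}"
  unfolding openin
proof (intro conjI ballI)
  fix x assume x: "x \<in> {x \<in> X. N x < e}"
  have "N y < e" if "y \<in> X" "d x y < e - N x" for y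
    using d_triangle[of y x 0] that x X_0 d_sym[of x y] by (simp add: N_def)
  then show "\<exists>\<epsilon>>0. \<forall>y\<in>X. d x y < \<epsilon> \<longrightarrow> y \<in> {x \<in> X. N x < e}"
    using x by (intro exI[of _ "e - N x"]) auto
qed auto

lemma ball_in_open:
  assumes "openin S G" "x \<in> G" shows "\<exists>e>0. \<forall>y\<in>X. N (y - x) < e \<longrightarrow> y \<in> G"
proof -
  obtain e where e: "e > 0" "\<And>y. y \<in> X \<Longrightarrow> d x y < e \<Longrightarrow> y \<in> G" and x: "x \<in> X"
    using assms unfolding openin by blast
  have "y \<in> G" if "y \<in> X" "N (y - x) < e" for y
    using e(2)[OF that(1)] that d_N[OF that(1) x] d_sym[OF x that(1)] by simp
  then show ?thesis using e(1) by blast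
qed

lemma scale_open:
  assumes "x \<in> X" "openin S G" "c *\<^sub>R x \<in> G"
  shows "\<exists>a>0. \<exists>e>0. \<forall>c' y. \<bar>c' - c\<bar> < a \<and> y \<in> X \<and> N (y - x) < e \<longrightarrow> c' *\<^sub>R y \<in> G"
proof -
  define P where "P = {cx \<in> topspace (prod_topology euclideanreal S). (\<lambda>(c, x). c *\<^sub>R x) cx \<in> G}"
  have "openin (prod_topology euclideanreal S) P"
    unfolding P_def by (rule openin_continuous_map_preimage[OF scale_cont assms(2)])
  moreover have "(c, x) \<in> P" using assms topspace by (simp add: P_def)
  ultimately have "\<exists>A B. openin euclideanreal A \<and> openin S B \<and> c \<in> A \<and> x \<in> B \<and> A \<times> B \<subseteq> P"
    by (rule openin_prod_topology_alt[THEN iffD1, rule_format])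
  then obtain A B where AB: "openin euclideanreal A" "openin S B" "c \<in> A" "x \<in> B" "A \<times> B \<subseteq> P" by (elim exE conjE)
  have "open A" using AB(1) by simp
  then have "\<exists>a>0. \<forall>c'. dist c' c < a \<longrightarrow> c' \<in> A" using AB(3) unfolding open_dist by blast
  then obtain a where a: "a > 0" "\<And>c'. dist c' c < a \<Longrightarrow> c' \<in> A" by blast
  obtain e where e: "e > 0" "\<And>y. y \<in> X \<Longrightarrow> N (y - x) < e \<Longrightarrow> y \<in> B" using ball_in_open[OF AB(2,4)] by blast
  have "c' *\<^sub>R y \<in> G" if "\<bar>c' - c\<bar> < a" "y \<in> X" "N (y - x) < e" for c' y
  proof -
    have "(c', y) \<in> A \<times> B" using a(2)[of c'] e(2)[of y] that by (simp add: dist_real_def)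
    then have "(c', y) \<in> P" using AB(5) by (rule set_rev_mp)
    then show ?thesis by (simp add: P_def)
  qed
  with a(1) e(1) show ?thesis by blast
qed

lemma frechet: "frechet_seminorm X N"
proof unfold_locales
  fix x y assume xy: "x \<in> X" "y \<in> X"
  show "0 \<le> N x" unfolding N_def using d_nonneg[OF xy(1) X_0] .
  show "N (- x) = N x" using d_N[OF X_0 xy(1)] d_sym[OF X_0 xy(1)] by (simp add: N_def)
  show "N (x + y) \<le> N x + N y"
    using d_triangle[of "x + y" y 0] invariant[of x 0 y] xy X_add X_0 by (simp add: N_def)
next
  fix e :: real and c :: real assume e: "0 < e"
  have "c *\<^sub>R 0 \<in> {x \<in> X. N x < e}" using e X_0 d_zero[OF X_0 X_0] by (simp add: N_def ae_eq_def)
  from scale_open[OF X_0 open_ball this] obtain a b where ab: "a > 0" "b > 0"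
    "\<And>c' y. \<bar>c' - c\<bar> < a \<Longrightarrow> y \<in> X \<Longrightarrow> N (y - 0) < b \<Longrightarrow> c' *\<^sub>R y \<in> {x \<in> X. N x < e}" by blast
  have "N (c *\<^sub>R y) < e" if "y \<in> X" "N y < b" for y using ab(3)[of c y] ab(1) that by simp
  then show "\<exists>d>0. \<forall>x\<in>X. N x < d \<longrightarrow> N (c *\<^sub>R x) < e" using ab(2) by blast
  fix x assume x: "x \<in> X"
  have "0 *\<^sub>R x \<in> {x \<in> X. N x < e}" using e X_0 d_zero[OF X_0 X_0] by (simp add: N_def ae_eq_def)
  from scale_open[OF x open_ball this] obtain a b where ab: "a > 0" "b > 0"
    "\<And>c' y. \<bar>c' - 0\<bar> < a \<Longrightarrow> y \<in> X \<Longrightarrow> N (y - x) < b \<Longrightarrow> c' *\<^sub>R y \<in> {x \<in> X. N x < e}" by blast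
  have "N 0 = 0" using d_zero[OF X_0 X_0] by (simp add: N_def ae_eq_def)
  then have "N (c *\<^sub>R x) < e" if "\<bar>c\<bar> < a" for c using ab(3)[of c x] ab(2) that x by simp
  then show "\<exists>d>0. \<forall>c. \<bar>c\<bar> < d \<longrightarrow> N (c *\<^sub>R x) < e" using ab(1) by blast
next
  fix s :: "nat \<Rightarrow> _" assume s: "\<And>n. s n \<in> X" and c: "\<And>e. 0 < e \<Longrightarrow> \<exists>K. \<forall>j\<ge>K. \<forall>k\<ge>K. N (s j - s k) < e"
  have "\<exists>x\<in>X. (\<lambda>k. d (s k) x) \<longlonglongrightarrow> 0"
    by (rule cauchy) (use s c d_N in auto)
  then show "\<exists>x\<in>X. (\<lambda>k. N (s k - x)) \<longlonglongrightarrow> 0" using d_N s by auto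
next
  fix e :: real assume e: "0 < e"
  have "0 \<in> {x \<in> X. N x < e}" using e X_0 d_zero[OF X_0 X_0] by (simp add: N_def ae_eq_def)
  then obtain C where C: "openin S C" "convex C" "0 \<in> C" "C \<subseteq> {x \<in> X. N x < e}"
    using loc_convex[OF open_ball] by blast
  obtain r where "r > 0" "\<And>y. y \<in> X \<Longrightarrow> N (y - 0) < r \<Longrightarrow> y \<in> C" using ball_in_open[OF C(1,3)] by blast
  then show "\<exists>C d. convex C \<and> C \<subseteq> X \<and> 0 < d \<and> (\<forall>x\<in>X. N x < d \<longrightarrow> x \<in> C) \<and> (\<forall>x\<in>C. N x < e)"
    using C by (intro exI[of _ C] exI[of _ r]) auto
qed (use subspace_X X_0 d_zero[OF X_0 X_0] in \<open>auto simp: N_def ae_eq_def\<close>)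

sublocale F: frechet_seminorm X N by (rule frechet)

text \<open>Linearity lets a bound on one ball be rescaled to any tolerance, and continuity of
  scaling turns this rescaling into a smaller ball. In this form functionals built by closed graph
  or separation arguments are recognized as continuous.\<close>

lemma top_dual_iff:
  "p \<in> top_dual S \<longleftrightarrow> (\<forall>x\<in>X. \<forall>y\<in>X. p (x + y) = p x + p y) \<and> (\<forall>c. \<forall>x\<in>X. p (c *\<^sub>R x) = c * p x) \<and>
     (\<exists>e>0. \<exists>b. \<forall>x\<in>X. N x < e \<longrightarrow> \<bar>p x\<bar> \<le> b)" (is "_ \<longleftrightarrow> ?add \<and> ?scale \<and> ?bdd")
proof
  assume p: "p \<in> top_dual S"
  then have as: ?add ?scale and cont: "continuous_map S euclideanreal p" by (auto simp: top_dual_def topspace)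
  have p0: "p 0 = 0" using as(2)[rule_format, OF X_0, of 0] by simp
  have "openin S {x \<in> topspace S. p x \<in> {-1<..<1}}"
    by (rule openin_continuous_map_preimage[OF cont]) simp
  moreover have "0 \<in> {x \<in> topspace S. p x \<in> {-1<..<1}}" using p0 X_0 topspace by simp
  ultimately have "\<exists>e>0. \<forall>y\<in>X. N (y - 0) < e \<longrightarrow> y \<in> {x \<in> topspace S. p x \<in> {-1<..<1}}" using ball_in_open by blast
  then obtain e where "e > 0" "\<And>y. y \<in> X \<Longrightarrow> N (y - 0) < e \<Longrightarrow> y \<in> {x \<in> topspace S. p x \<in> {-1<..<1}}" by blast
  then have "\<bar>p y\<bar> \<le> 1" if "y \<in> X" "N y < e" for y using that by fastforce
  then have ?bdd using \<open>e > 0\<close> by blast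
  with as show "?add \<and> ?scale \<and> ?bdd" by blast
next
  assume R: "?add \<and> ?scale \<and> ?bdd"
  then obtain e b where e: "e > 0" "\<And>x. x \<in> X \<Longrightarrow> N x < e \<Longrightarrow> \<bar>p x\<bar> \<le> b" by blast
  have diff: "p (y - x) = p y - p x" if "x \<in> X" "y \<in> X" for x y
  proof -
    have "p ((y - x) + x) = p (y - x) + p x" using R that X_diff by blast
    then show ?thesis by simp
  qed
  have "continuous_map S euclideanreal p"
    unfolding continuous_map
  proof (intro conjI allI impI)
    fix G :: "real set" assume G: "openin euclideanreal G"
    show "openin S {x \<in> topspace S. p x \<in> G}"
      unfolding openin topspace
    proof (intro conjI ballI)
      fix x assume x: "x \<in> {x \<in> X. p x \<in> G}"
      then obtain r where r: "r > 0" "\<And>t. dist t (p x) < r \<Longrightarrow> t \<in> G" using G by (auto simp: open_dist)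
      \<comment> \<open>The summand 1 keeps \<open>m\<close> positive when \<open>b\<close> is 0 and
        makes the final inequality strict.\<close>
      define m where "m = (\<bar>b\<bar> + 1) / r"
      have m: "m > 0" using r by (simp add: m_def)
      obtain e' where e': "e' > 0" "\<And>y. y \<in> X \<Longrightarrow> N y < e' \<Longrightarrow> N (m *\<^sub>R y) < e" using F.scale[OF e(1)] by blast
      have "p y \<in> G" if y: "y \<in> X" "d x y < e'" for y
      proof -
        have yx: "y - x \<in> X" using X_diff y x by blast
        have "N (m *\<^sub>R (y - x)) < e" using e'(2)[OF yx] y x d_N[of y x] d_sym[of x y] by simp
        then have "\<bar>m * p (y - x)\<bar> \<le> b" using e(2)[of "m *\<^sub>R (y - x)"] yx X_scale R by simp
        then have "m * \<bar>p y - p x\<bar> < \<bar>b\<bar> + 1" using diff[of x y] x y m by (simp add: abs_mult)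
        then have "(\<bar>b\<bar> + 1) * \<bar>p y - p x\<bar> < (\<bar>b\<bar> + 1) * r" using r(1) by (simp add: m_def field_simps)
        then have "\<bar>p y - p x\<bar> < r" by (rule mult_left_less_imp_less) simp
        then show ?thesis using r by (simp add: dist_real_def)
      qed
      then show "\<exists>\<epsilon>>0. \<forall>y\<in>X. d x y < \<epsilon> \<longrightarrow> y \<in> {x \<in> X. p x \<in> G}" using e' by blast
    qed auto
  qed auto
  then show "p \<in> top_dual S" using R by (auto simp: top_dual_def topspace)
qed

lemma dual_add: "p \<in> top_dual S \<Longrightarrow> x \<in> X \<Longrightarrow> y \<in> X \<Longrightarrow> p (x + y) = p x + p y"
  and dual_scale: "p \<in> top_dual S \<Longrightarrow> x \<in> X \<Longrightarrow> p (c *\<^sub>R x) = c * p x"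
  by (auto simp: top_dual_iff)

lemma dual_0: "p \<in> top_dual S \<Longrightarrow> p 0 = 0"
  using dual_scale[of p 0 0] X_0 by simp

lemma dual_minus: "p \<in> top_dual S \<Longrightarrow> x \<in> X \<Longrightarrow> p (- x) = - p x"
  using dual_scale[of p x "-1"] by simp

lemma dual_diff: "p \<in> top_dual S \<Longrightarrow> x \<in> X \<Longrightarrow> y \<in> X \<Longrightarrow> p (x - y) = p x - p y"
  using dual_add[of p x "- y"] dual_minus[of p y] X_minus by simp

lemma dual_small:
  assumes "p \<in> top_dual S" "0 < r" shows "\<exists>e>0. \<forall>x\<in>X. N x < e \<longrightarrow> \<bar>p x\<bar> < r"
proof -
  obtain e b where e: "e > 0" "\<And>x. x \<in> X \<Longrightarrow> N x < e \<Longrightarrow> \<bar>p x\<bar> \<le> b" using assms(1) unfolding top_dual_iff by blast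
  define m where "m = (\<bar>b\<bar> + 1) / r"
  have m: "m > 0" using assms by (simp add: m_def)
  obtain e' where e': "e' > 0" "\<And>y. y \<in> X \<Longrightarrow> N y < e' \<Longrightarrow> N (m *\<^sub>R y) < e" using F.scale[OF e(1)] by blast
  have "\<bar>p y\<bar> < r" if y: "y \<in> X" "N y < e'" for y
  proof -
    have "\<bar>m * p y\<bar> \<le> b" using e(2)[of "m *\<^sub>R y"] e'(2)[OF y] y X_scale dual_scale[OF assms(1) y(1), of m] by simp
    then have "m * \<bar>p y\<bar> < \<bar>b\<bar> + 1" using m by (simp add: abs_mult)
    then have "(\<bar>b\<bar> + 1) * \<bar>p y\<bar> < (\<bar>b\<bar> + 1) * r" using assms(2) by (simp add: m_def field_simps)
    then show ?thesis by (rule mult_left_less_imp_less) simp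
  qed
  then show ?thesis using e' by blast
qed

lemma dual_tendsto:
  assumes "p \<in> top_dual S" "\<And>n::nat. x n \<in> X" "x' \<in> X" "(\<lambda>n. N (x n - x')) \<longlonglongrightarrow> 0"
  shows "(\<lambda>n. p (x n)) \<longlonglongrightarrow> p x'"
proof (rule LIMSEQ_I)
  fix r :: real assume "0 < r"
  then obtain e where e: "e > 0" "\<And>x. x \<in> X \<Longrightarrow> N x < e \<Longrightarrow> \<bar>p x\<bar> < r" using dual_small assms(1) by blast
  have "\<forall>\<^sub>F n in sequentially. N (x n - x') < e" using order_tendstoD(2)[OF assms(4) e(1)] .
  then obtain n0 where "\<And>n. n \<ge> n0 \<Longrightarrow> N (x n - x') < e" by (auto simp: eventually_sequentially)
  then show "\<exists>no. \<forall>n\<ge>no. norm (p (x n) - p x') < r"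
    using e(2)[OF X_diff[OF assms(2,3)]] dual_diff[OF assms(1,2,3)] by (intro exI[of _ n0]) simp
qed

lemma X_solid: "x \<in> X \<Longrightarrow> x' \<in> borel_measurable M \<Longrightarrow> (\<And>i. AE \<omega> in M. \<bar>x' \<omega> $ i\<bar> \<le> \<bar>x \<omega> $ i\<bar>) \<Longrightarrow> x' \<in> X"
  using solidX[unfolded solid_def, rule_format] by blast

lemma X_ae: "x \<in> X \<Longrightarrow> x' \<in> borel_measurable M \<Longrightarrow> ae_eq M x' x \<Longrightarrow> x' \<in> X"
  by (rule X_solid) (auto simp: ae_eq_def elim: eventually_mono)

lemma N_ae: assumes "x \<in> X" "x' \<in> X" "ae_eq M x x'" shows "N x = N x'"
proof -
  have "N (x - x') = 0" "N (x' - x) = 0" using d_N[of x x'] d_N[of x' x] d_sym[of x x'] d_zero[of x x'] assms by auto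
  then show ?thesis using F.triangle[of "x - x'" x'] F.triangle[of "x' - x" x] assms X_diff by auto
qed

text \<open>The constant sequence \<open>x\<close> converges to every other representative of its
  class, so continuity forces equal values.\<close>

lemma dual_ae: assumes "p \<in> top_dual S" "x \<in> X" "x' \<in> X" "ae_eq M x x'" shows "p x = p x'"
proof -
  have "N (x - x') = 0" using d_N[of x x'] d_zero[of x x'] assms by auto
  then have "(\<lambda>n. p x) \<longlonglongrightarrow> p x'" by (intro dual_tendsto assms) auto
  then show ?thesis by (simp add: LIMSEQ_const_iff)
qed

lemma L_infinity_space: "x \<in> L_infinity M \<Longrightarrow> x \<in> X" "x \<in> L_infinity M \<Longrightarrow> x \<in> V"
  using L_infinity_subset rv decomp solidX solidV by blast+

end

section \<open>Coordinates, truncation of processes, and the pairing by components\<close>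

lemma measurable_vec_nth: "x \<in> borel_measurable M \<Longrightarrow> (\<lambda>\<omega>. x \<omega> $ i) \<in> borel_measurable M"
  for x :: "'w \<Rightarrow> real^'k"
  using borel_measurable_inner[of x M "\<lambda>_. axis i 1"] by (simp add: inner_axis)

lemma measurable_vec_lambda:
  fixes f :: "'k::finite \<Rightarrow> 'w \<Rightarrow> real"
  assumes "\<And>i. f i \<in> borel_measurable M" shows "(\<lambda>\<omega>. \<chi> i. f i \<omega>) \<in> borel_measurable M"
  unfolding borel_measurable_euclidean_space[where 'c="real^'k"]
  using assms by (auto simp: Basis_vec_def inner_axis)

text \<open>With \<open>I\<close> a set of stages this is a process cut off at some time and padded
  by zeros, which keeps all stages of the induction in the one space \<open>X\<close>.\<close>

definition proj :: "'k set \<Rightarrow> ('w \<Rightarrow> real^'k) \<Rightarrow> 'w \<Rightarrow> real^'k" where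
  "proj I x = (\<lambda>\<omega>. \<chi> i. if i \<in> I then x \<omega> $ i else 0)"

lemma proj_nth [simp]: "proj I x \<omega> $ i = (if i \<in> I then x \<omega> $ i else 0)"
  by (simp add: proj_def)

lemma pairing_sum:
  assumes "\<And>i. integrable M (\<lambda>\<omega>. x \<omega> $ i * v \<omega> $ i)"
  shows "pairing M v x = (\<Sum>i\<in>UNIV. \<integral>\<omega>. x \<omega> $ i * v \<omega> $ i \<partial>M)"
  unfolding pairing_def inner_vec_def using assms by (simp add: Bochner_Integration.integral_sum)

context rv_duality
begin

lemma pairing_integrable: "x \<in> X \<Longrightarrow> v \<in> V \<Longrightarrow> integrable M (\<lambda>\<omega>. x \<omega> \<bullet> v \<omega>)"
  using separating[unfolded separating_duality_def, THEN conjunct1, rule_format] by simp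

lemma component_integrable_X: assumes "x \<in> X" shows "integrable M (\<lambda>\<omega>. x \<omega> $ i)"
proof -
  have "(\<lambda>_. axis i 1) \<in> V" by (rule L_infinity_space(2)) (auto simp: L_infinity_def)
  then have "integrable M (\<lambda>\<omega>. x \<omega> \<bullet> axis i 1)" by (rule pairing_integrable[OF assms])
  then show ?thesis by (simp add: inner_axis)
qed

lemma component_integrable_V: assumes "v \<in> V" shows "integrable M (\<lambda>\<omega>. v \<omega> $ i)"
proof -
  have "(\<lambda>_. axis i 1) \<in> X" by (rule L_infinity_space(1)) (auto simp: L_infinity_def)
  then have "integrable M (\<lambda>\<omega>. axis i 1 \<bullet> v \<omega>)" by (rule pairing_integrable[OF _ assms])
  then show ?thesis by (simp add: inner_axis')
qed

lemma X_proj: assumes "x \<in> X" shows "proj I x \<in> X"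
proof (rule X_solid[OF assms])
  have "(\<lambda>\<omega>. if i \<in> I then x \<omega> $ i else 0) \<in> borel_measurable M" for i
    using measurable_vec_nth[OF meas_X[OF assms]] by (cases "i \<in> I") auto
  then show "proj I x \<in> borel_measurable M" unfolding proj_def by (rule measurable_vec_lambda)
qed (auto intro: AE_I2)

lemma X_mult:
  assumes "x \<in> X" and h: "h \<in> borel_measurable M" "\<And>\<omega>. \<omega> \<in> space M \<Longrightarrow> \<bar>h \<omega> :: real\<bar> \<le> b"
  shows "(\<lambda>\<omega>. h \<omega> *\<^sub>R x \<omega>) \<in> X"
proof (rule X_solid[OF X_scale[OF assms(1), of b]])
  show "(\<lambda>\<omega>. h \<omega> *\<^sub>R x \<omega>) \<in> borel_measurable M" using h meas_X[OF assms(1)] by measurable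
  show "AE \<omega> in M. \<bar>(h \<omega> *\<^sub>R x \<omega>) $ i\<bar> \<le> \<bar>(b *\<^sub>R x) \<omega> $ i\<bar>" for i
  proof (rule AE_I2)
    fix \<omega> assume "\<omega> \<in> space M"
    then have "\<bar>h \<omega>\<bar> \<le> \<bar>b\<bar>" using h(2) by force
    then show "\<bar>(h \<omega> *\<^sub>R x \<omega>) $ i\<bar> \<le> \<bar>(b *\<^sub>R x) \<omega> $ i\<bar>" by (simp add: abs_mult mult_right_mono)
  qed
qed

lemma X_indicator: "x \<in> X \<Longrightarrow> A \<in> sets M \<Longrightarrow> (\<lambda>\<omega>. indicator A \<omega> *\<^sub>R x \<omega>) \<in> X"
  by (rule X_mult[where b = 1]) (auto simp: indicator_def)

text \<open>The duality only makes the sum over all components integrable; solidity keeps the slice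
  \<open>proj {i} x\<close> in \<open>X\<close>, and its pairing involves the single
  product.\<close>

lemma product_integrable: assumes "x \<in> X" "v \<in> V" shows "integrable M (\<lambda>\<omega>. x \<omega> $ i * v \<omega> $ i)"
proof -
  have "integrable M (\<lambda>\<omega>. proj {i} x \<omega> \<bullet> v \<omega>)"
    by (rule pairing_integrable[OF X_proj[OF assms(1)] assms(2)])
  moreover have "proj {i} x \<omega> \<bullet> v \<omega> = x \<omega> $ i * v \<omega> $ i" for \<omega>
    by (simp add: inner_vec_def if_distrib[of "\<lambda>a. a * _"] cong: if_cong)
  ultimately show ?thesis by simp
qed

lemma pairing_components: "x \<in> X \<Longrightarrow> v \<in> V \<Longrightarrow> pairing M v x = (\<Sum>i\<in>UNIV. \<integral>\<omega>. x \<omega> $ i * v \<omega> $ i \<partial>M)"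
  by (rule pairing_sum) (rule product_integrable)

lemma pairing_dual: "v \<in> V \<Longrightarrow> pairing M v \<in> top_dual S"
  using dual by (simp add: dual_decomposition_def)

text \<open>The componentwise sign of \<open>x\<close> is bounded and recovers the \<open>L\<^sup>1\<close> norm.\<close>

lemma pairing_sgn:
  assumes "x \<in> X"
  obtains h where "h \<in> L_infinity M" "pairing M h x = (\<Sum>i\<in>UNIV. \<integral>\<omega>. \<bar>x \<omega> $ i\<bar> \<partial>M)"
    "\<And>y. y \<in> X \<Longrightarrow> pairing M h y \<le> (\<Sum>i\<in>UNIV. \<integral>\<omega>. \<bar>y \<omega> $ i\<bar> \<partial>M)"
proof
  define h where "h \<omega> = (\<chi> i. sgn (x \<omega> $ i))" for \<omega>
  have hm: "h \<in> borel_measurable M" unfolding h_def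
    by (rule measurable_vec_lambda) (use measurable_vec_nth[OF meas_X[OF assms]] in auto)
  have "norm (h \<omega>) \<le> real CARD('k)" for \<omega>
  proof -
    have "norm (h \<omega>) \<le> (\<Sum>i\<in>UNIV. \<bar>h \<omega> $ i\<bar>)" by (rule norm_le_l1_cart)
    also have "\<dots> \<le> (\<Sum>i\<in>(UNIV::'k set). 1)" by (rule sum_mono) (simp add: h_def sgn_real_def)
    finally show ?thesis by simp
  qed
  then show hL: "h \<in> L_infinity M" using hm by (auto simp: L_infinity_def)
  then have hV: "h \<in> V" by (rule L_infinity_space)
  have "x \<omega> $ i * h \<omega> $ i = \<bar>x \<omega> $ i\<bar>" for \<omega> i by (simp add: h_def abs_sgn)
  then show "pairing M h x = (\<Sum>i\<in>UNIV. \<integral>\<omega>. \<bar>x \<omega> $ i\<bar> \<partial>M)"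
    using pairing_components[OF assms hV] by simp
  fix y assume y: "y \<in> X"
  have "y \<omega> $ i * h \<omega> $ i \<le> \<bar>y \<omega> $ i\<bar>" for \<omega> i by (auto simp: h_def sgn_real_def abs_if)
  then show "pairing M h y \<le> (\<Sum>i\<in>UNIV. \<integral>\<omega>. \<bar>y \<omega> $ i\<bar> \<partial>M)"
    unfolding pairing_components[OF y hV]
    by (intro sum_mono integral_mono product_integrable y hV integrable_abs component_integrable_X)
qed

text \<open>Pairing the difference with its own componentwise sign gives its
  \<open>L\<^sup>1\<close> norm, so bounded test functions already separate points.\<close>

lemma ae_eq_pairing:
  assumes "x \<in> X" "y \<in> X" "\<And>h. h \<in> L_infinity M \<Longrightarrow> pairing M h x = pairing M h y"
  shows "ae_eq M x y"
proof -
  have xy: "x - y \<in> X" using X_diff assms by blast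
  obtain h where h: "h \<in> L_infinity M" "pairing M h (x - y) = (\<Sum>i\<in>UNIV. \<integral>\<omega>. \<bar>(x - y) \<omega> $ i\<bar> \<partial>M)"
    by (rule pairing_sgn[OF xy]) blast
  have hV: "h \<in> V" using h(1) by (rule L_infinity_space)
  have "pairing M h (x - y) = 0" using dual_diff[OF pairing_dual[OF hV]] assms h(1) by simp
  then have "(\<integral>\<omega>. \<bar>(x - y) \<omega> $ i\<bar> \<partial>M) = 0" for i
    using h(2) sum_nonneg_eq_0_iff[of UNIV "\<lambda>i. \<integral>\<omega>. \<bar>(x - y) \<omega> $ i\<bar> \<partial>M"] by simp
  then have "AE \<omega> in M. \<bar>(x - y) \<omega> $ i\<bar> = 0" for i
    by (subst (asm) integral_nonneg_eq_0_iff_AE) (use component_integrable_X[OF xy] integrable_abs in auto)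
  then have "AE \<omega> in M. \<forall>i. \<bar>(x - y) \<omega> $ i\<bar> = 0" by (simp add: AE_all_countable)
  then show ?thesis unfolding ae_eq_def by eventually_elim (simp add: vec_eq_iff)
qed

text \<open>Limits in \<open>X\<close> are identified by bounded test functions, so weak sequential
  continuity of \<open>T\<close> against \<open>L_infinity\<close> closes the graph. Linearity is
  asked only almost surely, as conditional expectations need not be linear on representatives;
  \<open>\<Gamma>\<close> therefore contains all representatives of \<open>T z\<close>.\<close>

lemma closed_graph:
  fixes T :: "'z::real_vector \<Rightarrow> 'w \<Rightarrow> real^'k"
  assumes Z: "complete_F_seminorm Z NZ" and T: "\<And>z. z \<in> Z \<Longrightarrow> T z \<in> X"
    and lin: "\<And>a b w z. w \<in> Z \<Longrightarrow> z \<in> Z \<Longrightarrow> ae_eq M (T (a *\<^sub>R w + b *\<^sub>R z)) (a *\<^sub>R T w + b *\<^sub>R T z)"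
    and weak: "\<And>z z' h. (\<And>n::nat. z n \<in> Z) \<Longrightarrow> z' \<in> Z \<Longrightarrow> (\<lambda>n. NZ (z n - z')) \<longlonglongrightarrow> 0 \<Longrightarrow>
      h \<in> L_infinity M \<Longrightarrow> (\<lambda>n. pairing M h (T (z n))) \<longlonglongrightarrow> pairing M h (T z')"
    and e: "0 < e"
  shows "\<exists>r>0. \<forall>z\<in>Z. NZ z < r \<longrightarrow> N (T z) < e"
proof -
  interpret Z: complete_F_seminorm Z NZ by fact
  define \<Gamma> where "\<Gamma> = {(x, z). x \<in> X \<and> z \<in> Z \<and> ae_eq M x (T z)}"
  have "ae_eq M (T 0) (0 :: 'w \<Rightarrow> real^'k)"
    using lin[OF Z.mem_0 Z.mem_0, of 0 0] by simp
  then have 0: "(0, 0) \<in> \<Gamma>" using X_0 Z.mem_0 by (auto simp: \<Gamma>_def ae_eq_def)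
  have "\<exists>r>0. \<forall>z\<in>Z. NZ z < r \<longrightarrow> (\<exists>x. N x < e \<and> (x, z) \<in> \<Gamma>)"
  proof (rule convex_relation_open[OF frechet Z _ _ 0 _ _ e])
    show "convex \<Gamma>"
    proof (rule convexI)
      fix p q and u v :: real assume "p \<in> \<Gamma>" "q \<in> \<Gamma>" "0 \<le> u" "0 \<le> v" "u + v = 1"
      then obtain x z y w where pq: "p = (x, z)" "q = (y, w)" "x \<in> X" "y \<in> X" "z \<in> Z" "w \<in> Z"
        "ae_eq M x (T z)" "ae_eq M y (T w)" unfolding \<Gamma>_def by blast
      have "ae_eq M (u *\<^sub>R x + v *\<^sub>R y) (T (u *\<^sub>R z + v *\<^sub>R w))"
        using pq(7,8) lin[OF pq(5,6), of u v] unfolding ae_eq_def by eventually_elim simp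
      then show "u *\<^sub>R p + v *\<^sub>R q \<in> \<Gamma>"
        using pq X_add X_scale Z.mem_add Z.mem_scale by (simp add: \<Gamma>_def)
    qed
    show "\<Gamma> \<subseteq> X \<times> Z" by (auto simp: \<Gamma>_def)
    show "\<exists>c>0. \<exists>x. (x, c *\<^sub>R z) \<in> \<Gamma>" if "z \<in> Z" for z
      using T[OF that] that by (intro exI[of _ "1::real"]) (auto simp: \<Gamma>_def ae_eq_def)
    fix x z x' z' assume xz: "\<And>n::nat. (x n, z n) \<in> \<Gamma>" and x': "x' \<in> X" and z': "z' \<in> Z"
      and lx: "(\<lambda>n. N (x n - x')) \<longlonglongrightarrow> 0" and lz: "(\<lambda>n. NZ (z n - z')) \<longlonglongrightarrow> 0"
    have xX: "x n \<in> X" and zZ: "z n \<in> Z" and eq: "ae_eq M (x n) (T (z n))" for n using xz[of n] by (auto simp: \<Gamma>_def)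
    have "ae_eq M x' (T z')"
    proof (rule ae_eq_pairing[OF x' T[OF z']])
      fix h :: "'w \<Rightarrow> real^'k" assume h: "h \<in> L_infinity M"
      have hd: "pairing M h \<in> top_dual S" using h L_infinity_space(2) pairing_dual by blast
      have "(\<lambda>n. pairing M h (x n)) \<longlonglongrightarrow> pairing M h x'" by (rule dual_tendsto[OF hd xX x' lx])
      moreover have "pairing M h (x n) = pairing M h (T (z n))" for n
        by (rule dual_ae[OF hd xX T[OF zZ] eq])
      ultimately show "pairing M h x' = pairing M h (T z')"
        using LIMSEQ_unique weak[OF zZ z' lz h] by simp
    qed
    then show "(x', z') \<in> \<Gamma>" using x' z' by (simp add: \<Gamma>_def)
  qed
  then obtain r where r: "r > 0" "\<forall>z\<in>Z. NZ z < r \<longrightarrow> (\<exists>x. N x < e \<and> (x, z) \<in> \<Gamma>)" by blast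
  have "N (T z) < e" if z: "z \<in> Z" "NZ z < r" for z
  proof -
    obtain x where "N x < e" "(x, z) \<in> \<Gamma>" using r(2) z by blast
    then show ?thesis using N_ae[of x "T z"] T[OF z(1)] by (simp add: \<Gamma>_def)
  qed
  then show ?thesis using r(1) by blast
qed

text \<open>Strong convergence implies convergence in \<open>L\<^sup>1\<close>, whence almost surely
  along a subsequence. The inclusion into \<open>L\<^sup>1\<close> is continuous by a barrel
  argument: the unit ball \<open>L y \<le> 1\<close> is convex and absorbing, hence dense in a
  neighbourhood of \<open>0\<close>.\<close>

lemma strong_convergence_AE_subseq:
  assumes x: "\<And>n::nat. x n \<in> X" "x' \<in> X" "(\<lambda>n. N (x n - x')) \<longlonglongrightarrow> 0"
  shows "\<exists>r::nat \<Rightarrow> nat. strict_mono r \<and> (AE \<omega> in M. (\<lambda>n. x (r n) \<omega>) \<longlonglongrightarrow> x' \<omega>)"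
proof -
  define L where "L y = (\<Sum>i\<in>UNIV. \<integral>\<omega>. \<bar>y \<omega> $ i\<bar> \<partial>M)" for y :: "'w \<Rightarrow> real^'k"
  have L_scale: "L (c *\<^sub>R y) = \<bar>c\<bar> * L y" for c y by (simp add: L_def abs_mult sum_distrib_left)
  have L_add: "L (y + z) \<le> L y + L z" if "y \<in> X" "z \<in> X" for y z
  proof -
    have "(\<integral>\<omega>. \<bar>(y + z) \<omega> $ i\<bar> \<partial>M) \<le> (\<integral>\<omega>. \<bar>y \<omega> $ i\<bar> \<partial>M) + (\<integral>\<omega>. \<bar>z \<omega> $ i\<bar> \<partial>M)" for i
    proof -
      have i: "integrable M (\<lambda>\<omega>. \<bar>y \<omega> $ i\<bar>)" "integrable M (\<lambda>\<omega>. \<bar>z \<omega> $ i\<bar>)" "integrable M (\<lambda>\<omega>. \<bar>(y + z) \<omega> $ i\<bar>)"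
        using component_integrable_X that X_add by (auto intro!: integrable_abs)
      show ?thesis unfolding Bochner_Integration.integral_add[OF i(1,2), symmetric]
        by (rule integral_mono) (use i in auto)
    qed
    then show ?thesis unfolding L_def sum.distrib[symmetric] by (intro sum_mono)
  qed
  have L_nonneg: "0 \<le> L y" for y unfolding L_def by (intro sum_nonneg) simp
  have "\<exists>e>0. \<forall>y\<in>X. N y < e \<longrightarrow> (\<forall>r>0. \<exists>a\<in>{y \<in> X. L y \<le> 1}. N (y - a) < r)"
  proof (rule F.absorbing_convex_closure)
    show "convex {y \<in> X. L y \<le> 1}"
    proof (rule convexI)
      fix y z and u v :: real
      assume *: "y \<in> {y \<in> X. L y \<le> 1}" "z \<in> {y \<in> X. L y \<le> 1}" "0 \<le> u" "0 \<le> v" "u + v = 1"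
      have "L (u *\<^sub>R y + v *\<^sub>R z) \<le> u * L y + v * L z"
        using L_add[of "u *\<^sub>R y" "v *\<^sub>R z"] * X_scale L_scale by simp
      also have "\<dots> \<le> u * 1 + v * 1" using * by (intro add_mono mult_left_mono) auto
      finally show "u *\<^sub>R y + v *\<^sub>R z \<in> {y \<in> X. L y \<le> 1}" using * X_add X_scale by simp
    qed
    show "0 \<in> {y \<in> X. L y \<le> 1}" using X_0 by (simp add: L_def)
    fix z assume "z \<in> X"
    then show "\<exists>c>0. c *\<^sub>R z \<in> {y \<in> X. L y \<le> 1}"
      using L_nonneg[of z] X_scale by (intro exI[of _ "1 / (1 + L z)"]) (auto simp: L_scale)
  qed auto
  then obtain e where e: "e > 0" "\<And>y r. y \<in> X \<Longrightarrow> N y < e \<Longrightarrow> 0 < r \<Longrightarrow> \<exists>a\<in>{y \<in> X. L y \<le> 1}. N (y - a) < r"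
    by blast
  \<comment> \<open>The ball \<open>L y \<le> 1\<close> is strongly closed, since the value
    \<open>L y\<close> is attained by a continuous functional \<open>pairing M h\<close> that stays
    below \<open>L\<close> everywhere.\<close>
  have L1: "L y \<le> 1" if y: "y \<in> X" "N y < e" for y
  proof -
    have "\<forall>n. \<exists>a. a \<in> X \<and> L a \<le> 1 \<and> N (y - a) < (1/2)^n" using e(2)[OF y] by force
    then obtain a where a: "\<And>n::nat. a n \<in> X" "\<And>n. L (a n) \<le> 1" "\<And>n. N (y - a n) < (1/2)^n" by metis
    have "(\<lambda>n. N (a n - y)) \<longlonglongrightarrow> 0"
    proof (rule tendsto_sandwich[OF _ _ tendsto_const LIMSEQ_power_zero[of "1/2::real"]])
      show "\<forall>\<^sub>F n in sequentially. N (a n - y) \<le> (1/2)^n"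
        using a(3) F.diff_commute[OF a(1) y(1)] by (auto intro!: always_eventually less_imp_le)
    qed (use a X_diff y F.nonneg in auto)
    moreover obtain h where h: "h \<in> L_infinity M" "pairing M h y = L y" "\<And>y. y \<in> X \<Longrightarrow> pairing M h y \<le> L y"
      unfolding L_def by (rule pairing_sgn[OF y(1)]) blast
    ultimately have "(\<lambda>n. pairing M h (a n)) \<longlonglongrightarrow> pairing M h y"
      by (intro dual_tendsto pairing_dual L_infinity_space a y)
    moreover have "pairing M h (a n) \<le> 1" for n using h(3)[OF a(1)] a(2) order_trans by blast
    ultimately show ?thesis using h(2) by (metis LIMSEQ_le_const2)
  qed
  have lim: "(\<lambda>n. L (x n - x')) \<longlonglongrightarrow> 0"
  proof (rule LIMSEQ_I)
    fix r :: real assume r: "0 < r"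
    obtain e' where e': "e' > 0" "\<And>y. y \<in> X \<Longrightarrow> N y < e' \<Longrightarrow> N ((2 / r) *\<^sub>R y) < e" using F.scale[OF e(1)] by blast
    have "\<forall>\<^sub>F n in sequentially. N (x n - x') < e'" using order_tendstoD(2)[OF x(3) e'(1)] .
    then have "\<forall>\<^sub>F n in sequentially. norm (L (x n - x') - 0) < r"
    proof eventually_elim
      case (elim n)
      then have "L ((2 / r) *\<^sub>R (x n - x')) \<le> 1" using e'(2) L1 x X_diff X_scale by blast
      then have "(2 / r) * L (x n - x') \<le> 1" using L_scale[of "2 / r" "x n - x'"] r by simp
      then show ?case using r L_nonneg[of "x n - x'"] by (simp add: field_simps)
    qed
    then show "\<exists>no. \<forall>n\<ge>no. norm (L (x n - x') - 0) < r" by (simp add: eventually_sequentially)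
  qed
  have int: "integrable M (x n - x')" for n
  proof (rule Bochner_Integration.integrable_bound)
    show "integrable M (\<lambda>\<omega>. \<Sum>i\<in>UNIV. \<bar>(x n - x') \<omega> $ i\<bar>)"
      using component_integrable_X[OF X_diff[OF x(1,2)]] by (intro Bochner_Integration.integrable_sum integrable_abs)
    show "x n - x' \<in> borel_measurable M" using meas_X X_diff x by blast
    show "AE \<omega> in M. norm ((x n - x') \<omega>) \<le> norm (\<Sum>i\<in>UNIV. \<bar>(x n - x') \<omega> $ i\<bar>)"
      using norm_le_l1_cart[of "(x n - x') _"] by (auto intro!: AE_I2 simp: abs_of_nonneg sum_nonneg)
  qed
  have bd: "(\<integral>\<omega>. norm ((x n - x') \<omega>) \<partial>M) \<le> L (x n - x')" for n
  proof -
    have i: "integrable M (\<lambda>\<omega>. \<bar>(x n - x') \<omega> $ i\<bar>)" for i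
      by (intro integrable_abs component_integrable_X X_diff x)
    have "(\<integral>\<omega>. norm ((x n - x') \<omega>) \<partial>M) \<le> (\<integral>\<omega>. (\<Sum>i\<in>UNIV. \<bar>(x n - x') \<omega> $ i\<bar>) \<partial>M)"
    proof (rule integral_mono)
      show "integrable M (\<lambda>\<omega>. norm ((x n - x') \<omega>))" by (rule integrable_norm[OF int])
      show "integrable M (\<lambda>\<omega>. \<Sum>i\<in>UNIV. \<bar>(x n - x') \<omega> $ i\<bar>)" by (rule Bochner_Integration.integrable_sum) (rule i)
    qed (rule norm_le_l1_cart)
    also have "\<dots> = L (x n - x')" unfolding L_def by (rule Bochner_Integration.integral_sum) (rule i)
    finally show ?thesis .
  qed
  have "(\<lambda>n. \<integral>\<omega>. norm ((x n - x') \<omega>) \<partial>M) \<longlonglongrightarrow> 0"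
    by (rule tendsto_sandwich[OF _ _ tendsto_const lim]) (use bd in \<open>auto intro!: always_eventually\<close>)
  then obtain r :: "nat \<Rightarrow> nat" where "strict_mono r" "AE \<omega> in M. (\<lambda>n. (x (r n) - x') \<omega>) \<longlonglongrightarrow> 0"
    using tendsto_L1_AE_subseq[of M "\<lambda>n. x n - x'", OF int] by blast
  moreover from this(2) have "AE \<omega> in M. (\<lambda>n. x (r n) \<omega>) \<longlonglongrightarrow> x' \<omega>"
    by eventually_elim (simp add: LIM_zero_iff)
  ultimately show ?thesis by blast
qed

end

section \<open>Singular functionals\<close>

text \<open>Pointwise rather than essential bounds keep the supremum an ordinary one. This Banach
  space is the domain of the multiplication operator in
  \<open>dual_bounded_on_indicators\<close>.\<close>

lemma bounded_functions_complete:
  fixes M :: "'w measure"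
  defines "Z \<equiv> {h \<in> borel_measurable M. \<exists>b. \<forall>\<omega>. \<bar>h \<omega> :: real\<bar> \<le> b}" and "NZ \<equiv> \<lambda>h. SUP \<omega>. \<bar>h \<omega> :: real\<bar>"
  shows "complete_F_seminorm Z NZ"
    and "h \<in> Z \<Longrightarrow> \<bar>h \<omega>\<bar> \<le> NZ h"
proof -
  have Zm: "h \<in> borel_measurable M" if "h \<in> Z" for h using that by (simp add: Z_def)
  have ZI: "h \<in> Z" if "h \<in> borel_measurable M" "\<And>\<omega>. \<bar>h \<omega>\<bar> \<le> b" for h b
    using that by (auto simp: Z_def)
  have le: "\<bar>h \<omega>\<bar> \<le> NZ h" if h: "h \<in> Z" for h \<omega>
  proof -
    obtain b where "\<And>\<omega>. \<bar>h \<omega>\<bar> \<le> b" using h by (auto simp: Z_def)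
    then show ?thesis unfolding NZ_def by (intro cSUP_upper bdd_aboveI2[of _ _ b]) auto
  qed
  then show "h \<in> Z \<Longrightarrow> \<bar>h \<omega>\<bar> \<le> NZ h" .
  have least: "NZ h \<le> b" if "\<And>\<omega>. \<bar>h \<omega>\<bar> \<le> b" for h b unfolding NZ_def using that by (intro cSUP_least) auto
  have add: "h + k \<in> Z" if "h \<in> Z" "k \<in> Z" for h k
  proof (rule ZI)
    show "h + k \<in> borel_measurable M" using Zm that borel_measurable_add[of h M k] by (simp add: plus_fun_def)
    show "\<bar>(h + k) \<omega>\<bar> \<le> NZ h + NZ k" for \<omega> using le that[THEN le, of \<omega>] by simp
  qed
  have scale: "c *\<^sub>R h \<in> Z" if "h \<in> Z" for h c
  proof (rule ZI)
    show "c *\<^sub>R h \<in> borel_measurable M" unfolding scaleR_fun_def using Zm[OF that] by measurable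
    show "\<bar>(c *\<^sub>R h) \<omega>\<bar> \<le> \<bar>c\<bar> * NZ h" for \<omega> using le[OF that, of \<omega>] by (simp add: abs_mult mult_left_mono)
  qed
  have zero: "0 \<in> Z" by (rule ZI[of _ 0]) (auto simp: zero_fun_def)
  have diff: "h - k \<in> Z" if "h \<in> Z" "k \<in> Z" for h k
    using add[OF that(1) scale[OF that(2), of "-1"]] by simp
  have nonneg: "0 \<le> NZ h" if "h \<in> Z" for h using le[OF that, of undefined] by linarith
  have scale_le: "NZ (c *\<^sub>R h) \<le> \<bar>c\<bar> * NZ h" if "h \<in> Z" for c h
    by (rule least) (use le[OF that] in \<open>simp add: abs_mult mult_left_mono\<close>)
  have limit: "\<exists>x\<in>Z. (\<lambda>k. NZ (s k - x)) \<longlonglongrightarrow> 0"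
    if s: "\<And>n::nat. s n \<in> Z" and c: "\<And>e. 0 < e \<Longrightarrow> \<exists>K. \<forall>j\<ge>K. \<forall>k\<ge>K. NZ (s j - s k) < e" for s
  proof -
    have pw: "\<bar>s j \<omega> - s k \<omega>\<bar> \<le> NZ (s j - s k)" for j k \<omega> using le[OF diff[OF s s], of j k \<omega>] by simp
    have "Cauchy (\<lambda>n. s n \<omega>)" for \<omega>
    proof (rule metric_CauchyI)
      fix e :: real assume "0 < e"
      then obtain K where K: "\<forall>j\<ge>K. \<forall>k\<ge>K. NZ (s j - s k) < e" using c by blast
      have "dist (s m \<omega>) (s n \<omega>) < e" if "m \<ge> K" "n \<ge> K" for m n
        using le_less_trans[OF pw K[rule_format, OF that]] by (simp add: dist_real_def)
      then show "\<exists>M. \<forall>m\<ge>M. \<forall>n\<ge>M. dist (s m \<omega>) (s n \<omega>) < e" by blast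
    qed
    then have lim: "(\<lambda>n. s n \<omega>) \<longlonglongrightarrow> lim (\<lambda>n. s n \<omega>)" for \<omega> using Cauchy_convergent_iff convergent_LIMSEQ_iff by blast
    define x where "x \<omega> = lim (\<lambda>n. s n \<omega>)" for \<omega>
    have tail: "\<bar>s j \<omega> - x \<omega>\<bar> \<le> e" if jK: "\<forall>j\<ge>K. \<forall>k\<ge>K. NZ (s j - s k) < e" "j \<ge> K" for j \<omega> e K
    proof (rule LIMSEQ_le_const2)
      show "(\<lambda>k. \<bar>s j \<omega> - s k \<omega>\<bar>) \<longlonglongrightarrow> \<bar>s j \<omega> - x \<omega>\<bar>" unfolding x_def by (intro tendsto_intros lim)
      have "\<bar>s j \<omega> - s k \<omega>\<bar> \<le> e" if "k \<ge> K" for k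
        using pw[of j \<omega> k] jK(1)[rule_format, OF jK(2) that] by linarith
      then show "\<exists>N. \<forall>n\<ge>N. \<bar>s j \<omega> - s n \<omega>\<bar> \<le> e" by blast
    qed
    obtain K where K: "\<forall>j\<ge>K. \<forall>k\<ge>K. NZ (s j - s k) < 1" using c[of 1] by auto
    have "x \<in> Z"
    proof (rule ZI)
      show "x \<in> borel_measurable M"
        by (rule borel_measurable_LIMSEQ_real[of M s]) (use lim Zm[OF s] in \<open>auto simp: x_def\<close>)
      show "\<bar>x \<omega>\<bar> \<le> NZ (s K) + 1" for \<omega> using tail[OF K order_refl, of \<omega>] le[OF s, of K \<omega>] by linarith
    qed
    moreover have "(\<lambda>k. NZ (s k - x)) \<longlonglongrightarrow> 0"
    proof (rule LIMSEQ_I)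
      fix r :: real assume "0 < r"
      then obtain K where K: "\<forall>j\<ge>K. \<forall>k\<ge>K. NZ (s j - s k) < r / 2" using c[of "r / 2"] by auto
      have "norm (NZ (s j - x) - 0) < r" if "j \<ge> K" for j
      proof -
        have "NZ (s j - x) \<le> r / 2" by (rule least) (use tail[OF K that] in simp)
        then show ?thesis using nonneg[OF diff[OF s \<open>x \<in> Z\<close>], of j] \<open>0 < r\<close> by simp
      qed
      then show "\<exists>no. \<forall>j\<ge>no. norm (NZ (s j - x) - 0) < r" by blast
    qed
    ultimately show ?thesis by blast
  qed
  show "complete_F_seminorm Z NZ"
  proof
    show "subspace Z" using zero add scale by (simp add: subspace_def)
    show "NZ 0 = 0" by (simp add: NZ_def)
    show "0 \<le> NZ x" if "x \<in> Z" for x using nonneg[OF that] .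
    show "NZ (- x) = NZ x" for x by (simp add: NZ_def)
    show "NZ (x + y) \<le> NZ x + NZ y" if "x \<in> Z" "y \<in> Z" for x y
    proof (rule least)
      show "\<bar>(x + y) \<omega>\<bar> \<le> NZ x + NZ y" for \<omega> using that[THEN le, of \<omega>] by simp
    qed
    show "\<exists>x\<in>Z. (\<lambda>k. NZ (s k - x)) \<longlonglongrightarrow> 0"
      if "\<And>n::nat. s n \<in> Z" "\<And>e. 0 < e \<Longrightarrow> \<exists>K. \<forall>j\<ge>K. \<forall>k\<ge>K. NZ (s j - s k) < e" for s
      using limit that by blast
    fix e :: real assume e: "0 < e"
    have "NZ (c *\<^sub>R x) < e" if "x \<in> Z" "NZ x < e / (1 + \<bar>c\<bar>)" for c x
    proof -
      have "(1 + \<bar>c\<bar>) * NZ x < e" using that(2) by (simp add: field_simps)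
      moreover have "\<bar>c\<bar> * NZ x \<le> (1 + \<bar>c\<bar>) * NZ x" using nonneg[OF that(1)] by (simp add: mult_right_mono)
      ultimately show ?thesis using scale_le[OF that(1), of c] by linarith
    qed
    then show "\<exists>d>0. \<forall>x\<in>Z. NZ x < d \<longrightarrow> NZ (c *\<^sub>R x) < e" for c
      using e by (intro exI[of _ "e / (1 + \<bar>c\<bar>)"]) auto
    fix x assume x: "x \<in> Z"
    have "NZ (c *\<^sub>R x) < e" if "\<bar>c\<bar> < e / (1 + NZ x)" for c
    proof -
      have "\<bar>c\<bar> * (1 + NZ x) < e" using that nonneg[OF x] by (simp add: field_simps)
      then have "\<bar>c\<bar> * NZ x < e" by (simp add: algebra_simps)
      then show ?thesis using scale_le[OF x, of c] by linarith
    qed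
    then show "\<exists>d>0. \<forall>c. \<bar>c\<bar> < d \<longrightarrow> NZ (c *\<^sub>R x) < e"
      using e nonneg[OF x] by (intro exI[of _ "e / (1 + NZ x)"]) auto
  qed
qed

text \<open>On a set that nearly maximizes \<open>\<mu>\<close>, and on its complement, \<open>\<mu>\<close> has nearly constant sign;
  removing a small set on which the remaining mass vanishes therefore makes all of it small.\<close>

lemma finitely_additive_small:
  fixes \<mu> :: "'w set \<Rightarrow> real"
  assumes add: "\<And>A B. A \<in> sets M \<Longrightarrow> B \<in> sets M \<Longrightarrow> A \<inter> B = {} \<Longrightarrow> \<mu> (A \<union> B) = \<mu> A + \<mu> B"
    and bounded: "\<And>A. A \<in> sets M \<Longrightarrow> \<bar>\<mu> A\<bar> \<le> b"
    and vanish: "\<And>E e. E \<in> sets M \<Longrightarrow> 0 < e \<Longrightarrow> \<exists>A\<in>sets M. measure M A < e \<and> \<mu> (E - A) = 0"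
    and M: "finite_measure M" and e: "0 < e" and r: "0 < r"
  shows "\<exists>C\<in>sets M. measure M C < e \<and> (\<forall>F\<in>sets M. F \<inter> C = {} \<longrightarrow> \<bar>\<mu> F\<bar> \<le> r)"
proof -
  define m where "m = (SUP A\<in>sets M. \<mu> A)"
  have bdd: "bdd_above (\<mu> ` sets M)" using bounded by (intro bdd_aboveI2[of _ _ b]) (auto simp: abs_le_iff)
  have up: "\<mu> A \<le> m" if "A \<in> sets M" for A unfolding m_def using bdd that by (rule cSUP_upper2[OF _ _ order_refl])
  have "\<exists>E\<in>sets M. m - r / 2 < \<mu> E"
    using less_cSUP_iff[OF _ bdd, of "m - r / 2"] r by (auto simp: m_def)
  then obtain E where E: "E \<in> sets M" "m - r / 2 < \<mu> E" by blast
  have inE: "- (r / 2) \<le> \<mu> F" if "F \<in> sets M" "F \<subseteq> E" for F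
  proof -
    have "\<mu> E = \<mu> F + \<mu> (E - F)" using add[of F "E - F"] that E by (simp add: Un_absorb1 sets.Diff)
    then show ?thesis using up[of "E - F"] E that by auto
  qed
  have outE: "\<mu> F \<le> r / 2" if "F \<in> sets M" "F \<inter> E = {}" for F
    using add[of E F] that E up[of "E \<union> F"] by (auto simp: Int_commute)
  obtain A where A: "A \<in> sets M" "measure M A < e / 2" "\<mu> (E - A) = 0" using vanish[OF E(1), of "e / 2"] e by auto
  obtain B where B: "B \<in> sets M" "measure M B < e / 2" "\<mu> (space M - E - B) = 0"
    using vanish[of "space M - E" "e / 2"] e E by auto
  \<comment> \<open>Both pieces of \<open>E - A\<close> have \<open>\<mu>\<close> at least
    \<open>- r / 2\<close> and their sum is 0, which bounds each of them from above as well.\<close>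
  have small1: "\<bar>\<mu> F\<bar> \<le> r / 2" if "F \<in> sets M" "F \<subseteq> E - A" for F
  proof -
    have "\<mu> (E - A) = \<mu> F + \<mu> (E - A - F)" using add[of F "E - A - F"] that E A by (simp add: Un_absorb1 sets.Diff)
    moreover have "F \<subseteq> E" "E - A - F \<subseteq> E" "E - A - F \<in> sets M" using that E A by auto
    ultimately show ?thesis using inE[of F] inE[of "E - A - F"] that(1) A(3) by linarith
  qed
  have small2: "\<bar>\<mu> F\<bar> \<le> r / 2" if "F \<in> sets M" "F \<subseteq> space M - E - B" for F
  proof -
    have "\<mu> (space M - E - B) = \<mu> F + \<mu> (space M - E - B - F)"
      using add[of F "space M - E - B - F"] that E B by (simp add: Un_absorb1 sets.Diff)
    moreover have "F \<inter> E = {}" "(space M - E - B - F) \<inter> E = {}" "space M - E - B - F \<in> sets M"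
      using that E B by auto
    ultimately show ?thesis using outE[of F] outE[of "space M - E - B - F"] that(1) B(3) by linarith
  qed
  have "\<bar>\<mu> F\<bar> \<le> r" if F: "F \<in> sets M" "F \<inter> (A \<union> B) = {}" for F
  proof -
    have "F = (F \<inter> E) \<union> (F - E)" by blast
    then have "\<mu> F = \<mu> (F \<inter> E) + \<mu> (F - E)" using add[of "F \<inter> E" "F - E"] F E by force
    moreover have "\<bar>\<mu> (F \<inter> E)\<bar> \<le> r / 2" by (rule small1) (use F E in auto)
    moreover have "\<bar>\<mu> (F - E)\<bar> \<le> r / 2" by (rule small2) (use F E sets.sets_into_space[OF F(1)] in auto)
    ultimately show ?thesis by linarith
  qed
  moreover have "measure M (A \<union> B) < e" using measure_Un_le[OF A(1) B(1)] A B by linarith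
  ultimately show ?thesis using A B by (intro bexI[of _ "A \<union> B"]) auto
qed

context rv_duality
begin

text \<open>Multiplication \<open>h \<mapsto> h x\<close> is continuous from bounded functions into
  \<open>X\<close> by the closed graph lemma, and indicators form a bounded set. Solidity alone
  would not give this, because the metric is not assumed to be monotone in
  \<open>\<bar>x\<bar>\<close>.\<close>

lemma dual_bounded_on_indicators:
  assumes p: "p \<in> top_dual S" and x: "x \<in> X"
  shows "\<exists>b. \<forall>A\<in>sets M. \<bar>p (\<lambda>\<omega>. indicator A \<omega> *\<^sub>R x \<omega>)\<bar> \<le> b"
proof -
  define Z where "Z = {h \<in> borel_measurable M. \<exists>b. \<forall>\<omega>. \<bar>h \<omega> :: real\<bar> \<le> b}"
  define NZ where "NZ = (\<lambda>h :: 'w \<Rightarrow> real. SUP \<omega>. \<bar>h \<omega>\<bar>)"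
  have Z: "complete_F_seminorm Z NZ" unfolding Z_def NZ_def by (rule bounded_functions_complete)
  interpret Z: complete_F_seminorm Z NZ by (rule Z)
  have le: "\<bar>h \<omega>\<bar> \<le> NZ h" if "h \<in> Z" for h \<omega>
    using that unfolding Z_def NZ_def by (rule bounded_functions_complete(2))
  define T where "T h = (\<lambda>\<omega>. h \<omega> *\<^sub>R x \<omega>)" for h :: "'w \<Rightarrow> real"
  have TX: "T h \<in> X" if "h \<in> Z" for h
    unfolding T_def
  proof (rule X_mult[OF x, of _ "NZ h"])
    show "h \<in> borel_measurable M" using that by (simp add: Z_def)
    show "\<bar>h \<omega>\<bar> \<le> NZ h" for \<omega> by (rule le[OF that])
  qed
  obtain e where e: "e > 0" "\<And>y. y \<in> X \<Longrightarrow> N y < e \<Longrightarrow> \<bar>p y\<bar> < 1" using dual_small[OF p, of 1] zero_less_one by blast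
  have "\<exists>r>0. \<forall>z\<in>Z. NZ z < r \<longrightarrow> N (T z) < e"
  proof (rule closed_graph[OF Z TX _ _ e(1)])
    show "ae_eq M (T (a *\<^sub>R w + b *\<^sub>R z)) (a *\<^sub>R T w + b *\<^sub>R T z)" for a b w z
      by (simp add: T_def ae_eq_def scaleR_add_left)
    fix z z' and h :: "'w \<Rightarrow> real^'k" assume z: "\<And>n::nat. z n \<in> Z" "z' \<in> Z" "(\<lambda>n. NZ (z n - z')) \<longlonglongrightarrow> 0" and h: "h \<in> L_infinity M"
    have hV: "h \<in> V" using h by (rule L_infinity_space)
    have i: "integrable M (\<lambda>\<omega>. \<bar>x \<omega> \<bullet> h \<omega>\<bar>)" using pairing_integrable[OF x hV] by (rule integrable_abs)
    have zZ: "z n - z' \<in> Z" for n using Z.mem_diff z by blast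
    have "\<bar>pairing M h (T (z n)) - pairing M h (T z')\<bar> \<le> NZ (z n - z') * (\<integral>\<omega>. \<bar>x \<omega> \<bullet> h \<omega>\<bar> \<partial>M)" for n
    proof -
      have "T (z n - z') = T (z n) - T z'" by (rule ext) (simp add: T_def scaleR_diff_left)
      then have "pairing M h (T (z n)) - pairing M h (T z') = pairing M h (T (z n - z'))"
        using dual_diff[OF pairing_dual[OF hV] TX[OF z(1)] TX[OF z(2)]] by simp
      moreover have "\<bar>pairing M h (T (z n - z'))\<bar> \<le> (\<integral>\<omega>. NZ (z n - z') * \<bar>x \<omega> \<bullet> h \<omega>\<bar> \<partial>M)"
        unfolding pairing_def
      proof (rule order_trans[OF integral_abs_bound integral_mono])
        show "integrable M (\<lambda>\<omega>. \<bar>T (z n - z') \<omega> \<bullet> h \<omega>\<bar>)" using pairing_integrable[OF TX[OF zZ] hV] by (rule integrable_abs)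
        show "\<bar>T (z n - z') \<omega> \<bullet> h \<omega>\<bar> \<le> NZ (z n - z') * \<bar>x \<omega> \<bullet> h \<omega>\<bar>" for \<omega>
          using le[OF zZ, of n \<omega>] by (simp add: T_def abs_mult mult_right_mono)
      qed (use i in auto)
      ultimately show ?thesis by simp
    qed
    then have bd: "\<forall>\<^sub>F n in sequentially. norm (pairing M h (T (z n)) - pairing M h (T z')) \<le>
        NZ (z n - z') * (\<integral>\<omega>. \<bar>x \<omega> \<bullet> h \<omega>\<bar> \<partial>M)"
      unfolding real_norm_def by (intro always_eventually allI)
    have "(\<lambda>n. pairing M h (T (z n)) - pairing M h (T z')) \<longlonglongrightarrow> 0"
      by (rule Lim_null_comparison[OF bd tendsto_mult_left_zero[OF z(3)]])
    then show "(\<lambda>n. pairing M h (T (z n))) \<longlonglongrightarrow> pairing M h (T z')" by (rule LIM_zero_cancel)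
  qed
  then obtain r where r: "r > 0" "\<And>z. z \<in> Z \<Longrightarrow> NZ z < r \<Longrightarrow> N (T z) < e" by blast
  have "\<bar>p (\<lambda>\<omega>. indicator A \<omega> *\<^sub>R x \<omega>)\<bar> \<le> 2 / r" if A: "A \<in> sets M" for A
  proof -
    define h where "h = (r / 2) *\<^sub>R (indicator A :: 'w \<Rightarrow> real)"
    have hb: "\<bar>h \<omega>\<bar> \<le> r / 2" for \<omega> using r(1) by (simp add: h_def indicator_def)
    have "h \<in> borel_measurable M" unfolding h_def scaleR_fun_def using A by measurable
    then have hZ: "h \<in> Z" unfolding Z_def using hb by blast
    have "NZ h \<le> r / 2" unfolding NZ_def using hb by (intro cSUP_least) auto
    then have "\<bar>p (T h)\<bar> < 1" using r hZ TX e(2) by simp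
    moreover have "T h = (r / 2) *\<^sub>R (\<lambda>\<omega>. indicator A \<omega> *\<^sub>R x \<omega>)" by (rule ext) (simp add: T_def h_def)
    ultimately have "(r / 2) * \<bar>p (\<lambda>\<omega>. indicator A \<omega> *\<^sub>R x \<omega>)\<bar> < 1"
      using dual_scale[OF p X_indicator[OF x A], of "r / 2"] r(1) by (simp add: abs_mult)
    then show ?thesis using r(1) by (simp add: field_simps)
  qed
  then show ?thesis by blast
qed

lemma singular_nullsets:
  assumes "s \<in> singular_dual M S" "x \<in> X"
  obtains A :: "nat \<Rightarrow> 'w set" where "\<And>\<nu>. A \<nu> \<in> sets M" "decseq A" "(\<lambda>\<nu>. measure M (A \<nu>)) \<longlonglongrightarrow> 0"
    "\<And>\<nu>. s (\<lambda>\<omega>. indicator (space M - A \<nu>) \<omega> *\<^sub>R x \<omega>) = 0"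
proof -
  have "\<exists>A::nat \<Rightarrow> 'w set. range A \<subseteq> sets M \<and> decseq A \<and> (\<lambda>\<nu>. measure M (A \<nu>)) \<longlonglongrightarrow> 0 \<and>
        (\<forall>\<nu>. s (\<lambda>\<omega>. indicator (space M - A \<nu>) \<omega> *\<^sub>R x \<omega>) = 0)"
    using assms(1)[unfolded singular_dual_def mem_Collect_eq topspace, THEN conjunct2, rule_format, OF assms(2)] .
  then obtain A where "range A \<subseteq> sets M" "decseq A" "(\<lambda>\<nu>. measure M (A \<nu>)) \<longlonglongrightarrow> 0"
        "\<forall>\<nu>. s (\<lambda>\<omega>. indicator (space M - A \<nu>) \<omega> *\<^sub>R x \<omega>) = 0" by (elim exE conjE)
  then show thesis by (intro that[of A]) auto
qed

text \<open>Singularity gives sets off which \<open>s\<close> vanishes on one element, but says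
  nothing about measurable parts of that element. The set function
  \<open>A \<mapsto> s (1_A x)\<close> is additive and bounded, and singularity at
  \<open>1_E x\<close> for every \<open>E\<close> is the vanishing hypothesis of
  \<open>finitely_additive_small\<close>.\<close>

lemma singular_small_set:
  assumes s: "s \<in> singular_dual M S" and x: "x \<in> X" and "0 < e" "0 < r"
  shows "\<exists>C\<in>sets M. measure M C < e \<and> (\<forall>F\<in>sets M. F \<inter> C = {} \<longrightarrow> \<bar>s (\<lambda>\<omega>. indicator F \<omega> *\<^sub>R x \<omega>)\<bar> \<le> r)"
proof -
  have sd: "s \<in> top_dual S" using s by (simp add: singular_dual_def)
  obtain b where b: "\<And>A. A \<in> sets M \<Longrightarrow> \<bar>s (\<lambda>\<omega>. indicator A \<omega> *\<^sub>R x \<omega>)\<bar> \<le> b"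
    using dual_bounded_on_indicators[OF sd x] by blast
  show ?thesis
  proof (rule finitely_additive_small[OF _ b])
    fix A B assume AB: "A \<in> sets M" "B \<in> sets M" "A \<inter> B = {}"
    have "(\<lambda>\<omega>. indicator (A \<union> B) \<omega> *\<^sub>R x \<omega>) = (\<lambda>\<omega>. indicator A \<omega> *\<^sub>R x \<omega>) + (\<lambda>\<omega>. indicator B \<omega> *\<^sub>R x \<omega>)"
      using AB(3) by (auto simp: fun_eq_iff indicator_def)
    then show "s (\<lambda>\<omega>. indicator (A \<union> B) \<omega> *\<^sub>R x \<omega>) =
        s (\<lambda>\<omega>. indicator A \<omega> *\<^sub>R x \<omega>) + s (\<lambda>\<omega>. indicator B \<omega> *\<^sub>R x \<omega>)"
      using dual_add[OF sd X_indicator[OF x AB(1)] X_indicator[OF x AB(2)]] by simp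
  next
    fix E and e :: real assume E: "E \<in> sets M" and e: "0 < e"
    obtain A :: "nat \<Rightarrow> 'w set" where A: "\<And>\<nu>. A \<nu> \<in> sets M" "(\<lambda>\<nu>. measure M (A \<nu>)) \<longlonglongrightarrow> 0"
      "\<And>\<nu>. s (\<lambda>\<omega>. indicator (space M - A \<nu>) \<omega> *\<^sub>R (indicator E \<omega> *\<^sub>R x \<omega>)) = 0"
      by (rule singular_nullsets[OF s X_indicator[OF x E]]) blast
    have "\<forall>\<^sub>F \<nu> in sequentially. measure M (A \<nu>) < e" using order_tendstoD(2)[OF A(2) e] .
    then obtain \<nu> where \<nu>: "measure M (A \<nu>) < e" using eventually_happens'[OF sequentially_bot] by blast
    have eq: "(\<lambda>\<omega>. indicator (space M - A \<nu>) \<omega> *\<^sub>R (indicator E \<omega> *\<^sub>R x \<omega>)) = (\<lambda>\<omega>. indicator (E - A \<nu>) \<omega> *\<^sub>R x \<omega>)"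
      using sets.sets_into_space[OF E] by (auto simp: fun_eq_iff indicator_def)
    then show "\<exists>A\<in>sets M. measure M A < e \<and> s (\<lambda>\<omega>. indicator (E - A) \<omega> *\<^sub>R x \<omega>) = 0"
      using A(1) A(3)[of \<nu>, unfolded eq] \<nu> by blast
  qed (use assms finite_measure_axioms in auto)
qed

end

section \<open>Conditional expectations\<close>

context sigma_finite_subalgebra
begin

text \<open>\<open>real_cond_exp\<close> is a difference of two extended expectations; for
  nonnegative \<open>f\<close> the second vanishes and the first is finite almost everywhere, so
  nothing is lost in the conversion to reals.\<close>

lemma real_cond_exp_nonneg_nn:
  assumes f: "integrable M f" "\<And>x. 0 \<le> f x"
  shows "AE x in M. ennreal (real_cond_exp M F f x) = nn_cond_exp M F (\<lambda>x. ennreal (f x)) x"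
proof -
  have [measurable]: "f \<in> borel_measurable M" using f by simp
  have "(\<integral>\<^sup>+x. nn_cond_exp M F (\<lambda>x. ennreal (f x)) x \<partial>M) = (\<integral>\<^sup>+x. ennreal (f x) \<partial>M)"
    using nn_cond_exp_intg[of "\<lambda>_. 1" "\<lambda>x. ennreal (f x)"] by simp
  also have "\<dots> \<noteq> \<infinity>" using f integrableD(2)[OF f(1)] by (simp add: abs_of_nonneg f(2))
  finally have "AE x in M. nn_cond_exp M F (\<lambda>x. ennreal (f x)) x \<noteq> \<infinity>"
    by (intro nn_integral_PInf_AE) auto
  moreover have "AE x in M. 0 = nn_cond_exp M F (\<lambda>x. 0) x" by (rule nn_cond_exp_F_meas) simp
  moreover have neg: "(\<lambda>x. ennreal (- f x)) = (\<lambda>x. 0)" using f(2) by (simp add: ennreal_neg)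
  ultimately have "AE x in M. nn_cond_exp M F (\<lambda>x. ennreal (f x)) x \<noteq> \<infinity> \<and> nn_cond_exp M F (\<lambda>x. ennreal (- f x)) x = 0"
    by auto
  then show ?thesis unfolding real_cond_exp_def by eventually_elim (simp add: less_top)
qed

text \<open>The point is integrability on the far side. Conditioning passes from
  \<open>E \<bar>x\<bar> * v\<close> to \<open>E \<bar>x\<bar> * E v\<close>, and then
  \<open>E \<bar>x\<bar> * \<bar>E v\<bar>\<close> and
  \<open>\<bar>x\<bar> * \<bar>E v\<bar>\<close> have equal nonnegative integrals. The absolute
  value stands inside the expectation in the hypothesis, since \<open>E x * v\<close> would not
  control \<open>x * E v\<close>.\<close>

lemma cond_exp_adjoint:
  assumes x: "integrable M x" and v: "integrable M v"
    and xv: "integrable M (\<lambda>\<omega>. real_cond_exp M F (\<lambda>\<omega>. \<bar>x \<omega>\<bar>) \<omega> * v \<omega>)"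
  shows "integrable M (\<lambda>\<omega>. x \<omega> * real_cond_exp M F v \<omega>)"
    and "(\<integral>\<omega>. real_cond_exp M F x \<omega> * v \<omega> \<partial>M) = (\<integral>\<omega>. x \<omega> * real_cond_exp M F v \<omega> \<partial>M)"
proof -
  have [measurable]: "x \<in> borel_measurable M" "v \<in> borel_measurable M" using x v by auto
  have ax: "integrable M (\<lambda>\<omega>. \<bar>x \<omega>\<bar>)" using x by (rule integrable_abs)
  have nonneg: "AE \<omega> in M. 0 \<le> real_cond_exp M F (\<lambda>\<omega>. \<bar>x \<omega>\<bar>) \<omega>" by (rule real_cond_exp_pos) auto
  have int: "integrable M (\<lambda>\<omega>. real_cond_exp M F (\<lambda>\<omega>. \<bar>x \<omega>\<bar>) \<omega> * real_cond_exp M F v \<omega>)"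
    by (rule real_cond_exp_intg(1)[OF xv]) auto
  have "(\<integral>\<^sup>+\<omega>. ennreal (norm (x \<omega> * real_cond_exp M F v \<omega>)) \<partial>M) =
      (\<integral>\<^sup>+\<omega>. ennreal \<bar>real_cond_exp M F v \<omega>\<bar> * ennreal \<bar>x \<omega>\<bar> \<partial>M)"
    by (simp add: abs_mult ennreal_mult'' mult.commute)
  also have "\<dots> = (\<integral>\<^sup>+\<omega>. ennreal \<bar>real_cond_exp M F v \<omega>\<bar> * nn_cond_exp M F (\<lambda>\<omega>. ennreal \<bar>x \<omega>\<bar>) \<omega> \<partial>M)"
    by (rule nn_cond_exp_intg[symmetric]) auto
  also have "\<dots> = (\<integral>\<^sup>+\<omega>. ennreal (norm (real_cond_exp M F (\<lambda>\<omega>. \<bar>x \<omega>\<bar>) \<omega> * real_cond_exp M F v \<omega>)) \<partial>M)"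
  proof (rule nn_integral_cong_AE)
    show "AE \<omega> in M. ennreal \<bar>real_cond_exp M F v \<omega>\<bar> * nn_cond_exp M F (\<lambda>\<omega>. ennreal \<bar>x \<omega>\<bar>) \<omega> =
        ennreal (norm (real_cond_exp M F (\<lambda>\<omega>. \<bar>x \<omega>\<bar>) \<omega> * real_cond_exp M F v \<omega>))"
      using nonneg real_cond_exp_nonneg_nn[OF ax abs_ge_zero]
    proof eventually_elim
      case (elim \<omega>)
      then show ?case unfolding elim(2)[symmetric] by (simp add: abs_mult ennreal_mult'' mult.commute)
    qed
  qed
  also have "\<dots> < \<infinity>" by (rule conjunct2[OF int[unfolded integrable_iff_bounded]])
  finally show i: "integrable M (\<lambda>\<omega>. x \<omega> * real_cond_exp M F v \<omega>)" by (intro integrableI_bounded) auto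
  have "integrable M (\<lambda>\<omega>. real_cond_exp M F x \<omega> * v \<omega>)"
  proof (rule Bochner_Integration.integrable_bound[OF xv])
    show "AE \<omega> in M. norm (real_cond_exp M F x \<omega> * v \<omega>) \<le> norm (real_cond_exp M F (\<lambda>\<omega>. \<bar>x \<omega>\<bar>) \<omega> * v \<omega>)"
      using real_cond_exp_abs[of x, OF borel_measurable_integrable[OF x]] real_cond_exp_nonneg_nn[OF ax abs_ge_zero] nonneg
    proof eventually_elim
      case (elim \<omega>)
      then have "\<bar>real_cond_exp M F x \<omega>\<bar> \<le> real_cond_exp M F (\<lambda>\<omega>. \<bar>x \<omega>\<bar>) \<omega>"
        unfolding elim(2)[symmetric] by simp
      then show ?case using elim(3) by (simp add: abs_mult mult_right_mono)
    qed
  qed auto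
  then have "(\<integral>\<omega>. real_cond_exp M F x \<omega> * v \<omega> \<partial>M) = (\<integral>\<omega>. real_cond_exp M F x \<omega> * real_cond_exp M F v \<omega> \<partial>M)"
    by (intro real_cond_exp_intg(2)[symmetric]) auto
  also have "\<dots> = (\<integral>\<omega>. real_cond_exp M F v \<omega> * real_cond_exp M F x \<omega> \<partial>M)" by (simp add: mult.commute)
  also have "\<dots> = (\<integral>\<omega>. real_cond_exp M F v \<omega> * x \<omega> \<partial>M)"
    by (rule real_cond_exp_intg(2)) (use i in \<open>auto simp: mult.commute\<close>)
  finally show "(\<integral>\<omega>. real_cond_exp M F x \<omega> * v \<omega> \<partial>M) = (\<integral>\<omega>. x \<omega> * real_cond_exp M F v \<omega> \<partial>M)"
    by (simp add: mult.commute)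
qed

end

lemma (in prob_space) subalgebra_sigma_finite: "subalgebra M G \<Longrightarrow> sigma_finite_subalgebra M G"
  by (intro finite_measure_subalgebra_is_sigma_finite finite_measure_subalgebra.intro
      finite_measure_subalgebra_axioms.intro finite_measure_axioms)

lemma cond_expect_nth [simp]: "cond_expect M G x \<omega> $ i = real_cond_exp M G (\<lambda>\<omega>. x \<omega> $ i) \<omega>"
  by (simp add: cond_expect_def)

section \<open>Functionals composed with truncations and conditional expectations\<close>

context rv_duality
begin

text \<open>The adjoint condition gives the weak continuity that the closed graph lemma asks for. It
  concerns bounded \<open>h\<close> only, because a conditional expectation is not known here to map
  \<open>V\<close> into \<open>V\<close>.\<close>

lemma dual_linear_compose:
  assumes p: "p \<in> top_dual S" and T: "\<And>x. x \<in> X \<Longrightarrow> T x \<in> X"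
    and lin: "\<And>a b x y. x \<in> X \<Longrightarrow> y \<in> X \<Longrightarrow> ae_eq M (T (a *\<^sub>R x + b *\<^sub>R y)) (a *\<^sub>R T x + b *\<^sub>R T y)"
    and adjoint: "\<And>h. h \<in> L_infinity M \<Longrightarrow> \<exists>h'\<in>V. \<forall>x\<in>X. pairing M h (T x) = pairing M h' x"
  shows "(\<lambda>x. p (T x)) \<in> top_dual S"
  unfolding top_dual_iff
proof (intro conjI ballI allI)
  have lin': "p (T (a *\<^sub>R x + b *\<^sub>R y)) = a * p (T x) + b * p (T y)" if "x \<in> X" "y \<in> X" for a b x y
  proof -
    have "p (T (a *\<^sub>R x + b *\<^sub>R y)) = p (a *\<^sub>R T x + b *\<^sub>R T y)"
      by (rule dual_ae[OF p _ _ lin]) (use that T X_add X_scale in auto)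
    then show ?thesis using dual_add[OF p X_scale[OF T[OF that(1)]] X_scale[OF T[OF that(2)]]]
       dual_scale[OF p T[OF that(1)]] dual_scale[OF p T[OF that(2)]] by simp
  qed
  show "p (T (x + y)) = p (T x) + p (T y)" if "x \<in> X" "y \<in> X" for x y using lin'[OF that, of 1 1] by simp
  show "p (T (c *\<^sub>R x)) = c * p (T x)" if "x \<in> X" for c x using lin'[OF that that, of c 0] by simp
  obtain e where e: "e > 0" "\<And>y. y \<in> X \<Longrightarrow> N y < e \<Longrightarrow> \<bar>p y\<bar> < 1"
    using dual_small[OF p, of 1] zero_less_one by blast
  have "\<exists>r>0. \<forall>x\<in>X. N x < r \<longrightarrow> N (T x) < e"
  proof (rule closed_graph[where T = T, OF F.complete_F_seminorm_axioms T lin _ e(1)])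
    fix z z' and h :: "'w \<Rightarrow> real^'k"
    assume z: "\<And>n::nat. z n \<in> X" "z' \<in> X" "(\<lambda>n. N (z n - z')) \<longlonglongrightarrow> 0" and h: "h \<in> L_infinity M"
    obtain h' where h': "h' \<in> V" "\<And>x. x \<in> X \<Longrightarrow> pairing M h (T x) = pairing M h' x" using adjoint[OF h] by blast
    show "(\<lambda>n. pairing M h (T (z n))) \<longlonglongrightarrow> pairing M h (T z')"
      using dual_tendsto[OF pairing_dual[OF h'(1)] z] h'(2) z by simp
  qed
  then obtain r where r: "r > 0" "\<And>x. x \<in> X \<Longrightarrow> N x < r \<Longrightarrow> N (T x) < e" by blast
  have "\<bar>p (T x)\<bar> \<le> 1" if "x \<in> X" "N x < r" for x using e(2)[OF T[OF that(1)] r(2)[OF that]] by simp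
  then show "\<exists>e>0. \<exists>b. \<forall>x\<in>X. N x < e \<longrightarrow> \<bar>p (T x)\<bar> \<le> b" using r(1) by blast
qed

lemma proj_L_infinity: assumes "h \<in> L_infinity M" shows "proj I h \<in> L_infinity M"
proof -
  obtain C where C: "AE \<omega> in M. norm (h \<omega>) \<le> C" and m: "h \<in> borel_measurable M"
    using assms by (auto simp: L_infinity_def)
  have "(\<lambda>\<omega>. if i \<in> I then h \<omega> $ i else 0) \<in> borel_measurable M" for i
    using measurable_vec_nth[OF m] by (cases "i \<in> I") auto
  then have "proj I h \<in> borel_measurable M" unfolding proj_def by (rule measurable_vec_lambda)
  moreover have "AE \<omega> in M. norm (proj I h \<omega>) \<le> C"
    using C
  proof eventually_elim
    case (elim \<omega>)
    have "norm (proj I h \<omega>) \<le> norm (h \<omega>)" by (rule norm_le_componentwise_cart) simp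
    then show ?case using elim by simp
  qed
  ultimately show ?thesis by (auto simp: L_infinity_def)
qed

lemma proj_pairing: "pairing M v (proj I x) = pairing M (proj I v) x"
  unfolding pairing_def inner_vec_def by (rule Bochner_Integration.integral_cong) (auto intro!: sum.cong)

lemma dual_proj: assumes p: "p \<in> top_dual S" shows "(\<lambda>x. p (proj I x)) \<in> top_dual S"
proof (rule dual_linear_compose[OF p X_proj])
  show "ae_eq M (proj I (a *\<^sub>R x + b *\<^sub>R y)) (a *\<^sub>R proj I x + b *\<^sub>R proj I y)" for a b and x y :: "'w \<Rightarrow> real^'k"
    unfolding ae_eq_def by (rule AE_I2) (simp add: vec_eq_iff)
  show "\<exists>h'\<in>V. \<forall>x\<in>X. pairing M h (proj I x) = pairing M h' x" if "h \<in> L_infinity M" for h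
    using L_infinity_space(2)[OF proj_L_infinity[OF that]] proj_pairing by blast
qed

lemma singular_proj: assumes s: "s \<in> singular_dual M S" shows "(\<lambda>x. s (proj I x)) \<in> singular_dual M S"
proof -
  have "s \<in> top_dual S" using s by (simp add: singular_dual_def)
  moreover have "\<exists>A::nat \<Rightarrow> 'w set. range A \<subseteq> sets M \<and> decseq A \<and> (\<lambda>\<nu>. measure M (A \<nu>)) \<longlonglongrightarrow> 0 \<and>
        (\<forall>\<nu>. s (proj I (\<lambda>\<omega>. indicator (space M - A \<nu>) \<omega> *\<^sub>R x \<omega>)) = 0)" if x: "x \<in> X" for x
  proof -
    obtain A :: "nat \<Rightarrow> 'w set" where A: "\<And>\<nu>. A \<nu> \<in> sets M" "decseq A" "(\<lambda>\<nu>. measure M (A \<nu>)) \<longlonglongrightarrow> 0"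
      "\<And>\<nu>. s (\<lambda>\<omega>. indicator (space M - A \<nu>) \<omega> *\<^sub>R proj I x \<omega>) = 0"
      by (rule singular_nullsets[OF s X_proj[OF x]]) blast
    have "proj I (\<lambda>\<omega>. indicator (space M - A \<nu>) \<omega> *\<^sub>R x \<omega>) = (\<lambda>\<omega>. indicator (space M - A \<nu>) \<omega> *\<^sub>R proj I x \<omega>)" for \<nu>
      by (rule ext) (simp add: vec_eq_iff)
    then show ?thesis using A by (intro exI[of _ A]) auto
  qed
  ultimately show ?thesis using dual_proj unfolding singular_dual_def topspace by simp
qed

text \<open>The functional vanishes on \<open>1\<^bsub>\<Omega>-A\<^sub>\<nu>\<^esub> x\<close> with \<open>P(A\<^sub>\<nu>) \<longlonglongrightarrow> 0\<close>, and an integral is continuous along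
  this sequence.\<close>

lemma singular_eq_integral:
  assumes r: "r \<in> singular_dual M S" and x: "x \<in> X" and g: "\<And>i. integrable M (\<lambda>\<omega>. x \<omega> $ i * g \<omega> $ i)"
    and eq: "\<And>y. y \<in> X \<Longrightarrow> (\<And>i. integrable M (\<lambda>\<omega>. y \<omega> $ i * g \<omega> $ i)) \<Longrightarrow> r y = pairing M g y"
  shows "r x = 0"
proof -
  obtain A :: "nat \<Rightarrow> 'w set" where A: "\<And>\<nu>. A \<nu> \<in> sets M" "decseq A" "(\<lambda>\<nu>. measure M (A \<nu>)) \<longlonglongrightarrow> 0"
    "\<And>\<nu>. r (\<lambda>\<omega>. indicator (space M - A \<nu>) \<omega> *\<^sub>R x \<omega>) = 0"
    by (rule singular_nullsets[OF r x]) blast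
  have "(\<lambda>\<nu>. measure M (A \<nu>)) \<longlonglongrightarrow> measure M (\<Inter>\<nu>. A \<nu>)"
    by (rule finite_Lim_measure_decseq) (use A in auto)
  then have "measure M (\<Inter>\<nu>. A \<nu>) = 0" using A(3) LIMSEQ_unique by blast
  moreover have "(\<Inter>\<nu>. A \<nu>) \<in> sets M" using A(1) by auto
  ultimately have null: "(\<Inter>\<nu>. A \<nu>) \<in> null_sets M" by (simp add: null_sets_def emeasure_eq_measure)
  let ?f = "\<lambda>\<nu> \<omega>. (indicator (space M - A \<nu>) \<omega> :: real)"
  have lim: "AE \<omega> in M. (\<lambda>\<nu>. ?f \<nu> \<omega>) \<longlonglongrightarrow> 1"
    using AE_not_in[OF null] AE_space
  proof eventually_elim
    case (elim \<omega>)
    then obtain \<nu> where "\<omega> \<notin> A \<nu>" by blast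
    then have "\<omega> \<notin> A k" if "k \<ge> \<nu>" for k using A(2) that by (auto dest: decseqD)
    then have "\<forall>\<^sub>F k in sequentially. ?f k \<omega> = 1" using elim(2)
      by (auto simp: eventually_sequentially intro!: exI[of _ \<nu>])
    then show ?case by (rule tendsto_eventually)
  qed
  have "(\<lambda>\<nu>. \<integral>\<omega>. ?f \<nu> \<omega> * (x \<omega> $ i * g \<omega> $ i) \<partial>M) \<longlonglongrightarrow> (\<integral>\<omega>. x \<omega> $ i * g \<omega> $ i \<partial>M)" for i
  proof (rule integral_dominated_convergence[where w="\<lambda>\<omega>. \<bar>x \<omega> $ i * g \<omega> $ i\<bar>"])
    show "AE \<omega> in M. (\<lambda>\<nu>. ?f \<nu> \<omega> * (x \<omega> $ i * g \<omega> $ i)) \<longlonglongrightarrow> x \<omega> $ i * g \<omega> $ i"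
      using lim by eventually_elim (auto intro: tendsto_eq_intros)
    have [measurable]: "(\<lambda>\<omega>. x \<omega> $ i * g \<omega> $ i) \<in> borel_measurable M" using g by simp
    show "(\<lambda>\<omega>. ?f \<nu> \<omega> * (x \<omega> $ i * g \<omega> $ i)) \<in> borel_measurable M" for \<nu> using A(1) by measurable
  qed (use g in \<open>auto simp: indicator_def\<close>)
  then have "(\<lambda>\<nu>. \<Sum>i\<in>UNIV. \<integral>\<omega>. ?f \<nu> \<omega> * (x \<omega> $ i * g \<omega> $ i) \<partial>M) \<longlonglongrightarrow> (\<Sum>i\<in>UNIV. \<integral>\<omega>. x \<omega> $ i * g \<omega> $ i \<partial>M)"
    by (intro tendsto_sum)
  moreover have "(\<Sum>i\<in>UNIV. \<integral>\<omega>. ?f \<nu> \<omega> * (x \<omega> $ i * g \<omega> $ i) \<partial>M) = 0" for \<nu>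
  proof -
    let ?y = "\<lambda>\<omega>. ?f \<nu> \<omega> *\<^sub>R x \<omega>"
    have yg: "?y \<omega> $ i * g \<omega> $ i = ?f \<nu> \<omega> * (x \<omega> $ i * g \<omega> $ i)" for \<omega> i by simp
    have "space M - A \<nu> \<in> sets M" using A(1) by auto
    then have i: "integrable M (\<lambda>\<omega>. ?y \<omega> $ i * g \<omega> $ i)" for i
      unfolding yg using integrable_mult_indicator[OF _ g[of i], of "space M - A \<nu>"] by simp
    have "?y \<in> X" using X_indicator[OF x, of "space M - A \<nu>"] A(1) by auto
    then have "pairing M g ?y = 0" using eq[of ?y] i A(4) by simp
    then show ?thesis using pairing_sum[of M ?y g] i by (simp add: mult.assoc)
  qed
  ultimately have "(\<Sum>i\<in>UNIV. \<integral>\<omega>. x \<omega> $ i * g \<omega> $ i \<partial>M) = 0" using LIMSEQ_unique[OF _ tendsto_const] by fastforce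
  then show ?thesis using eq[OF x g] pairing_sum[OF g] by simp
qed

lemma decompose:
  assumes "p \<in> top_dual S"
  obtains v s where "v \<in> V" "s \<in> singular_dual M S" "\<And>x. x \<in> X \<Longrightarrow> p x = pairing M v x + s x"
proof -
  have "\<exists>v\<in>V. \<exists>s\<in>singular_dual M S. \<forall>x\<in>topspace S. p x = pairing M v x + s x"
    using dual[unfolded dual_decomposition_def, THEN conjunct2, THEN conjunct1] assms by (rule bspec)
  then obtain v s where "v \<in> V" "s \<in> singular_dual M S" "\<forall>x\<in>topspace S. p x = pairing M v x + s x" by blast
  then show thesis by (intro that[of v s]) (auto simp: topspace)
qed

context
  fixes G assumes sub: "subalgebra M G" and closed: "\<And>x. x \<in> X \<Longrightarrow> cond_expect M G x \<in> X"
begin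

text \<open>Solidity puts the vector of absolute values \<open>\<bar>x \<omega> $ i\<bar>\<close>
  into \<open>X\<close>, and \<open>closed\<close> keeps its conditional expectation there; pairing
  with \<open>v\<close> provides the integrability hypothesis of
  \<open>cond_exp_adjoint\<close>.\<close>

lemma cond_expect_adjoint:
  assumes x: "x \<in> X" and v: "v \<in> V"
  shows "integrable M (\<lambda>\<omega>. x \<omega> $ i * cond_expect M G v \<omega> $ i)"
    and "(\<integral>\<omega>. cond_expect M G x \<omega> $ i * v \<omega> $ i \<partial>M) = (\<integral>\<omega>. x \<omega> $ i * cond_expect M G v \<omega> $ i \<partial>M)"
proof -
  interpret G: sigma_finite_subalgebra M G by (rule subalgebra_sigma_finite[OF sub])
  let ?a = "\<lambda>\<omega>. \<chi> i. \<bar>x \<omega> $ i\<bar>"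
  have "?a \<in> X"
  proof (rule X_solid[OF x])
    show "?a \<in> borel_measurable M"
      by (rule measurable_vec_lambda) (use measurable_vec_nth[OF meas_X[OF x]] in auto)
  qed simp
  then have "integrable M (\<lambda>\<omega>. cond_expect M G ?a \<omega> $ i * v \<omega> $ i)" by (intro product_integrable closed v)
  then have "integrable M (\<lambda>\<omega>. real_cond_exp M G (\<lambda>\<omega>. \<bar>x \<omega> $ i\<bar>) \<omega> * v \<omega> $ i)" by simp
  note * = G.cond_exp_adjoint[OF component_integrable_X[OF x] component_integrable_V[OF v] this]
  show "integrable M (\<lambda>\<omega>. x \<omega> $ i * cond_expect M G v \<omega> $ i)"
    and "(\<integral>\<omega>. cond_expect M G x \<omega> $ i * v \<omega> $ i \<partial>M) = (\<integral>\<omega>. x \<omega> $ i * cond_expect M G v \<omega> $ i \<partial>M)"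
    using * by simp_all
qed

text \<open>\<open>cond_expect M G v\<close> enters as a mere function with integrable products;
  whether it lies in \<open>V\<close> is left open. This is why \<open>singular_eq_integral\<close>
  is stated for densities of this kind.\<close>

lemma cond_expect_pairing:
  assumes x: "x \<in> X" and v: "v \<in> V"
  shows "pairing M v (cond_expect M G x) = pairing M (cond_expect M G v) x"
  using pairing_components[OF closed[OF x] v] pairing_sum[OF cond_expect_adjoint(1)[OF x v]]
    cond_expect_adjoint(2)[OF x v] by simp

lemma cond_expect_L_infinity:
  assumes "h \<in> L_infinity M" shows "cond_expect M G h \<in> V"
proof (rule L_infinity_space(2))
  interpret G: sigma_finite_subalgebra M G by (rule subalgebra_sigma_finite[OF sub])
  obtain C where C: "AE \<omega> in M. norm (h \<omega>) \<le> C" using assms by (auto simp: L_infinity_def)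
  have hi: "integrable M (\<lambda>\<omega>. h \<omega> $ i)" for i using component_integrable_X L_infinity_space(1) assms by blast
  have "AE \<omega> in M. \<bar>cond_expect M G h \<omega> $ i\<bar> \<le> C" for i
  proof -
    have b: "AE \<omega> in M. \<bar>h \<omega> $ i\<bar> \<le> C"
      using C by eventually_elim (metis component_le_norm_cart order_trans)
    have "AE \<omega> in M. real_cond_exp M G (\<lambda>\<omega>. h \<omega> $ i) \<omega> \<le> C"
      by (rule G.real_cond_exp_le_c[OF hi]) (use b in \<open>eventually_elim, auto\<close>)
    moreover have "AE \<omega> in M. real_cond_exp M G (\<lambda>\<omega>. h \<omega> $ i) \<omega> \<ge> - C"
      by (rule G.real_cond_exp_ge_c[OF hi]) (use b in \<open>eventually_elim, auto\<close>)
    ultimately show ?thesis by eventually_elim auto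
  qed
  then have "AE \<omega> in M. \<forall>i. \<bar>cond_expect M G h \<omega> $ i\<bar> \<le> C" by (simp add: AE_all_countable)
  then have "AE \<omega> in M. norm (cond_expect M G h \<omega>) \<le> (\<Sum>i\<in>(UNIV::'k set). C)"
  proof eventually_elim
    case (elim \<omega>)
    have "norm (cond_expect M G h \<omega>) \<le> (\<Sum>i\<in>UNIV. \<bar>cond_expect M G h \<omega> $ i\<bar>)" by (rule norm_le_l1_cart)
    also have "\<dots> \<le> (\<Sum>i\<in>(UNIV::'k set). C)" by (rule sum_mono) (use elim in blast)
    finally show ?case .
  qed
  moreover have "cond_expect M G h \<in> borel_measurable M"
    unfolding cond_expect_def by (rule measurable_vec_lambda) simp
  ultimately show "cond_expect M G h \<in> L_infinity M" by (auto simp: L_infinity_def)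
qed

lemma cond_expect_linear:
  assumes "x \<in> X" "y \<in> X"
  shows "ae_eq M (cond_expect M G (a *\<^sub>R x + b *\<^sub>R y)) (a *\<^sub>R cond_expect M G x + b *\<^sub>R cond_expect M G y)"
proof -
  interpret G: sigma_finite_subalgebra M G by (rule subalgebra_sigma_finite[OF sub])
  have "AE \<omega> in M. real_cond_exp M G (\<lambda>\<omega>. a * x \<omega> $ i + b * y \<omega> $ i) \<omega> =
      a * real_cond_exp M G (\<lambda>\<omega>. x \<omega> $ i) \<omega> + b * real_cond_exp M G (\<lambda>\<omega>. y \<omega> $ i) \<omega>" for i
  proof -
    have i: "integrable M (\<lambda>\<omega>. x \<omega> $ i)" "integrable M (\<lambda>\<omega>. y \<omega> $ i)"
      using assms by (auto intro: component_integrable_X)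
    show ?thesis
      using G.real_cond_exp_add[OF integrable_mult_right[OF i(1), of a] integrable_mult_right[OF i(2), of b]]
        G.real_cond_exp_cmult[OF i(1), of a] G.real_cond_exp_cmult[OF i(2), of b]
      by eventually_elim simp
  qed
  then have "AE \<omega> in M. \<forall>i. real_cond_exp M G (\<lambda>\<omega>. a * x \<omega> $ i + b * y \<omega> $ i) \<omega> =
      a * real_cond_exp M G (\<lambda>\<omega>. x \<omega> $ i) \<omega> + b * real_cond_exp M G (\<lambda>\<omega>. y \<omega> $ i) \<omega>"
    by (simp add: AE_all_countable)
  then show ?thesis unfolding ae_eq_def by eventually_elim (simp add: vec_eq_iff)
qed

lemma dual_cond_expect: "p \<in> top_dual S \<Longrightarrow> (\<lambda>x. p (cond_expect M G x)) \<in> top_dual S"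
  by (rule dual_linear_compose[OF _ closed cond_expect_linear])
    (use cond_expect_L_infinity cond_expect_pairing L_infinity_space(2) in blast)+

end

end

section \<open>Normal integrands\<close>

lemma extended_integral_mono:
  assumes "AE \<omega> in M. g \<omega> \<le> h \<omega>" shows "extended_integral M g \<le> extended_integral M h"
proof -
  have p: "(\<integral>\<^sup>+\<omega>. e2ennreal (g \<omega>) \<partial>M) \<le> (\<integral>\<^sup>+\<omega>. e2ennreal (h \<omega>) \<partial>M)"
    using assms by (intro nn_integral_mono_AE) (auto elim!: eventually_mono intro: e2ennreal_mono)
  have n: "(\<integral>\<^sup>+\<omega>. e2ennreal (- h \<omega>) \<partial>M) \<le> (\<integral>\<^sup>+\<omega>. e2ennreal (- g \<omega>) \<partial>M)"
    using assms by (intro nn_integral_mono_AE) (auto elim!: eventually_mono intro: e2ennreal_mono)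
  show ?thesis
  proof (cases "(\<integral>\<^sup>+\<omega>. e2ennreal (h \<omega>) \<partial>M) = \<infinity>")
    case False
    then have "(\<integral>\<^sup>+\<omega>. e2ennreal (g \<omega>) \<partial>M) \<noteq> \<infinity>" using p by (auto simp: top_unique)
    moreover have "enn2ereal (\<integral>\<^sup>+\<omega>. e2ennreal (g \<omega>) \<partial>M) - enn2ereal (\<integral>\<^sup>+\<omega>. e2ennreal (- g \<omega>) \<partial>M) \<le>
        enn2ereal (\<integral>\<^sup>+\<omega>. e2ennreal (h \<omega>) \<partial>M) - enn2ereal (\<integral>\<^sup>+\<omega>. e2ennreal (- h \<omega>) \<partial>M)"
      using p n by (intro ereal_minus_mono) (simp_all add: less_eq_ennreal.rep_eq)
    ultimately show ?thesis using False by (simp add: extended_integral_def)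
  qed (simp add: extended_integral_def)
qed

lemma extended_integral_real:
  assumes "integrable M h" shows "extended_integral M (\<lambda>\<omega>. ereal (h \<omega>)) = ereal (\<integral>\<omega>. h \<omega> \<partial>M)"
proof -
  have fin: "(\<integral>\<^sup>+\<omega>. ennreal (h \<omega>) \<partial>M) \<noteq> \<infinity>" "(\<integral>\<^sup>+\<omega>. ennreal (- h \<omega>) \<partial>M) \<noteq> \<infinity>"
    using assms by (auto simp: real_integrable_def)
  obtain a where a: "(\<integral>\<^sup>+\<omega>. ennreal (h \<omega>) \<partial>M) = ennreal a" "0 \<le> a"
    using fin(1) by (cases "\<integral>\<^sup>+\<omega>. ennreal (h \<omega>) \<partial>M") auto
  obtain b where b: "(\<integral>\<^sup>+\<omega>. ennreal (- h \<omega>) \<partial>M) = ennreal b" "0 \<le> b"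
    using fin(2) by (cases "\<integral>\<^sup>+\<omega>. ennreal (- h \<omega>) \<partial>M") auto
  have "e2ennreal (ereal t) = ennreal t" "e2ennreal (- ereal t) = ennreal (- t)" for t
    by (simp_all add: ennreal.abs_eq e2ennreal_ereal)
  then show ?thesis unfolding extended_integral_def Let_def real_lebesgue_integral_def[OF assms]
    using a b by simp
qed

lemma extended_integral_le:
  assumes "integrable M h" "AE \<omega> in M. g \<omega> \<le> ereal (h \<omega>)" shows "extended_integral M g \<le> ereal (\<integral>\<omega>. h \<omega> \<partial>M)"
  using extended_integral_mono[OF assms(2)] extended_integral_real[OF assms(1)] by simp

lemma extended_integral_finite:
  assumes g: "g \<in> borel_measurable M" and r: "extended_integral M g = ereal r"
  obtains h where "integrable M h" "AE \<omega> in M. g \<omega> = ereal (h \<omega>)" "(\<integral>\<omega>. h \<omega> \<partial>M) = r"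
proof -
  have [measurable]: "g \<in> borel_measurable M" by fact
  have pos: "(\<integral>\<^sup>+\<omega>. e2ennreal (g \<omega>) \<partial>M) \<noteq> \<infinity>" using r by (auto simp: extended_integral_def)
  then have "enn2ereal (\<integral>\<^sup>+\<omega>. e2ennreal (g \<omega>) \<partial>M) - enn2ereal (\<integral>\<^sup>+\<omega>. e2ennreal (- g \<omega>) \<partial>M) = ereal r"
    using r by (simp add: extended_integral_def)
  then have neg: "(\<integral>\<^sup>+\<omega>. e2ennreal (- g \<omega>) \<partial>M) \<noteq> \<infinity>"
    by (cases "enn2ereal (\<integral>\<^sup>+\<omega>. e2ennreal (g \<omega>) \<partial>M)") auto
  have "AE \<omega> in M. e2ennreal (g \<omega>) \<noteq> \<infinity>" by (rule nn_integral_PInf_AE[OF _ pos]) measurable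
  moreover have "AE \<omega> in M. e2ennreal (- g \<omega>) \<noteq> \<infinity>" by (rule nn_integral_PInf_AE[OF _ neg]) measurable
  ultimately have fin: "AE \<omega> in M. g \<omega> = ereal (real_of_ereal (g \<omega>))"
  proof eventually_elim
    case (elim \<omega>)
    have "e2ennreal \<infinity> = \<infinity>" by (simp add: infinity_ennreal_def)
    then have "g \<omega> \<noteq> \<infinity>" "- g \<omega> \<noteq> \<infinity>" using elim by metis+
    then show ?case by (cases "g \<omega>") auto
  qed
  have "(\<integral>\<^sup>+\<omega>. ennreal (real_of_ereal (g \<omega>)) \<partial>M) = (\<integral>\<^sup>+\<omega>. e2ennreal (g \<omega>) \<partial>M)"
  proof (rule nn_integral_cong_AE)
    show "AE \<omega> in M. ennreal (real_of_ereal (g \<omega>)) = e2ennreal (g \<omega>)"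
      using fin by eventually_elim (metis e2ennreal_ereal)
  qed
  moreover have "(\<integral>\<^sup>+\<omega>. ennreal (- real_of_ereal (g \<omega>)) \<partial>M) = (\<integral>\<^sup>+\<omega>. e2ennreal (- g \<omega>) \<partial>M)"
  proof (rule nn_integral_cong_AE)
    show "AE \<omega> in M. ennreal (- real_of_ereal (g \<omega>)) = e2ennreal (- g \<omega>)"
      using fin by eventually_elim (metis e2ennreal_ereal uminus_ereal.simps(1))
  qed
  ultimately have i: "integrable M (\<lambda>\<omega>. real_of_ereal (g \<omega>))" using pos neg by (simp add: real_integrable_def)
  have "extended_integral M (\<lambda>\<omega>. ereal (real_of_ereal (g \<omega>))) = extended_integral M g"
    using fin by (intro antisym extended_integral_mono) (auto elim: eventually_mono)
  then have "(\<integral>\<omega>. real_of_ereal (g \<omega>) \<partial>M) = r" using extended_integral_real[OF i] r by simp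
  then show thesis using that i fin by blast
qed

section \<open>Pointwise properties of the normal integrand\<close>

context
  fixes f :: "'a::euclidean_space \<Rightarrow> 'b::euclidean_space \<Rightarrow> 'w \<Rightarrow> ereal" and M :: "'w measure"
  assumes normal: "convex_normal_integrand M f"
begin

lemma integrand_convex:
  assumes "\<omega> \<in> space M" "f x u \<omega> \<le> ereal a" "f x' u' \<omega> \<le> ereal a'" "0 \<le> t" "t \<le> 1"
  shows "f ((1 - t) *\<^sub>R x + t *\<^sub>R x') ((1 - t) *\<^sub>R u + t *\<^sub>R u') \<omega> \<le> ereal ((1 - t) * a + t * a')"
proof -
  have "convex (epigraph (\<lambda>x u. f x u \<omega>))" using normal assms(1) by (simp add: convex_normal_integrand_def)
  then have "(1 - t) *\<^sub>R (x, u, a) + t *\<^sub>R (x', u', a') \<in> epigraph (\<lambda>x u. f x u \<omega>)"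
    by (rule convexD) (use assms in \<open>auto simp: epigraph_def\<close>)
  then show ?thesis by (simp add: epigraph_def)
qed

lemma integrand_closed:
  assumes "\<omega> \<in> space M" "\<And>n::nat. f (x n) (u n) \<omega> \<le> ereal (a n)" "x \<longlonglongrightarrow> x'" "u \<longlonglongrightarrow> u'" "a \<longlonglongrightarrow> a'"
  shows "f x' u' \<omega> \<le> ereal a'"
proof -
  have "closed (epigraph (\<lambda>x u. f x u \<omega>))" using normal assms(1) by (simp add: convex_normal_integrand_def)
  then have "(x', u', a') \<in> epigraph (\<lambda>x u. f x u \<omega>)"
    by (rule closed_sequentially[where f = "\<lambda>n. (x n, u n, a n)"])
      (use assms in \<open>auto simp: epigraph_def intro!: tendsto_Pair\<close>)
  then show ?thesis by (simp add: epigraph_def)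
qed

text \<open>Membership of \<open>z \<omega>\<close> in a closed set is a countable condition: for
  each \<open>n\<close> some point of a countable dense set is within \<open>e n\<close> of both
  \<open>z \<omega>\<close> and the set. Hitting an open ball is a measurable event by
  normality.\<close>

lemma integrand_sublevel_measurable:
  assumes [measurable]: "x \<in> borel_measurable M" "u \<in> borel_measurable M"
  shows "{\<omega> \<in> space M. f (x \<omega>) (u \<omega>) \<omega> \<le> ereal r} \<in> sets M"
proof -
  define S where "S \<omega> = epigraph (\<lambda>x u. f x u \<omega>)" for \<omega>
  have closed: "closed (S \<omega>)" if "\<omega> \<in> space M" for \<omega>
    using normal that by (simp add: convex_normal_integrand_def S_def)
  have hit: "{\<omega> \<in> space M. S \<omega> \<inter> G \<noteq> {}} \<in> sets M" if "open G" for G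
    using normal that unfolding convex_normal_integrand_def measurable_set_valued_def S_def by simp
  define z where "z \<omega> = (x \<omega>, u \<omega>, r)" for \<omega>
  have [measurable]: "z \<in> borel_measurable M" unfolding z_def by measurable
  obtain D :: "('a \<times> 'b \<times> real) set" where D: "countable D" "\<And>G. open G \<Longrightarrow> G \<noteq> {} \<Longrightarrow> \<exists>d\<in>D. d \<in> G"
    using countable_dense_exists by blast
  define e where "e n = 1 / real (Suc n)" for n
  have e: "e n > 0" for n by (simp add: e_def)
  have elim: "e \<longlonglongrightarrow> 0" unfolding e_def by (rule LIMSEQ_Suc[OF lim_1_over_n])
  have "z \<omega> \<in> S \<omega> \<longleftrightarrow> (\<forall>n. \<exists>q\<in>D. dist q (z \<omega>) < e n \<and> S \<omega> \<inter> ball q (e n) \<noteq> {})" if \<omega>: "\<omega> \<in> space M" for \<omega>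
  proof
    assume z: "z \<omega> \<in> S \<omega>"
    show "\<forall>n. \<exists>q\<in>D. dist q (z \<omega>) < e n \<and> S \<omega> \<inter> ball q (e n) \<noteq> {}"
    proof
      fix n
      have "ball (z \<omega>) (e n) \<noteq> {}" using e[of n] by simp
      then have "\<exists>q\<in>D. q \<in> ball (z \<omega>) (e n)" by (rule D(2)[OF open_ball])
      then obtain q where q: "q \<in> D" "dist q (z \<omega>) < e n" unfolding mem_ball dist_commute[of "z \<omega>"] by blast
      have "z \<omega> \<in> S \<omega> \<inter> ball q (e n)" using z q(2) by simp
      then have "S \<omega> \<inter> ball q (e n) \<noteq> {}" by blast
      then show "\<exists>q\<in>D. dist q (z \<omega>) < e n \<and> S \<omega> \<inter> ball q (e n) \<noteq> {}" using q by blast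
    qed
  next
    assume R: "\<forall>n. \<exists>q\<in>D. dist q (z \<omega>) < e n \<and> S \<omega> \<inter> ball q (e n) \<noteq> {}"
    have "\<exists>y. y \<in> S \<omega> \<and> dist y (z \<omega>) < 2 * e n" for n
    proof -
      obtain q where q: "dist q (z \<omega>) < e n" "S \<omega> \<inter> ball q (e n) \<noteq> {}" using R[rule_format, of n] by blast
      obtain y where y: "y \<in> S \<omega>" "dist q y < e n" using q(2) by auto
      have "dist y (z \<omega>) < 2 * e n"
        using dist_triangle[of y "z \<omega>" q] q(1) y(2) unfolding dist_commute[of y q] by linarith
      then show ?thesis using y(1) by blast
    qed
    then obtain y where y: "y n \<in> S \<omega>" "dist (y n) (z \<omega>) < 2 * e n" for n by metis
    have lim2: "(\<lambda>n. 2 * e n) \<longlonglongrightarrow> 0" using tendsto_mult_right_zero[OF elim] .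
    have "(\<lambda>n. dist (y n) (z \<omega>)) \<longlonglongrightarrow> 0"
    proof (rule tendsto_sandwich[OF _ _ tendsto_const lim2])
      show "\<forall>\<^sub>F n in sequentially. dist (y n) (z \<omega>) \<le> 2 * e n"
        by (rule always_eventually) (simp add: y(2) less_imp_le)
    qed simp
    then have "y \<longlonglongrightarrow> z \<omega>" by (rule iffD2[OF tendsto_dist_iff])
    then show "z \<omega> \<in> S \<omega>" by (rule closed_sequentially[OF closed[OF \<omega>] y(1)])
  qed
  then have "{\<omega> \<in> space M. f (x \<omega>) (u \<omega>) \<omega> \<le> ereal r} =
     {\<omega> \<in> space M. \<forall>n. \<exists>q\<in>D. dist q (z \<omega>) < e n \<and> S \<omega> \<inter> ball q (e n) \<noteq> {}}"
    unfolding z_def S_def epigraph_def by auto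
  also have "\<dots> = space M \<inter> (\<Inter>n. \<Union>q\<in>D. {\<omega> \<in> space M. dist q (z \<omega>) < e n} \<inter> {\<omega> \<in> space M. S \<omega> \<inter> ball q (e n) \<noteq> {}})"
    by auto
  also have "\<dots> \<in> sets M"
  proof -
    have "{\<omega> \<in> space M. dist q (z \<omega>) < e n} \<inter> {\<omega> \<in> space M. S \<omega> \<inter> ball q (e n) \<noteq> {}} \<in> sets M" for q n
    proof (rule sets.Int)
      show "{\<omega> \<in> space M. dist q (z \<omega>) < e n} \<in> sets M" by measurable
      show "{\<omega> \<in> space M. S \<omega> \<inter> ball q (e n) \<noteq> {}} \<in> sets M" by (rule hit) simp
    qed
    then have "(\<Union>q\<in>D. {\<omega> \<in> space M. dist q (z \<omega>) < e n} \<inter> {\<omega> \<in> space M. S \<omega> \<inter> ball q (e n) \<noteq> {}}) \<in> sets M" for n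
      by (intro sets.countable_UN'[OF D(1)]) blast
    then show ?thesis by (intro sets.Int sets.top sets.countable_INT UNIV_not_empty) blast
  qed
  finally show ?thesis .
qed

lemma integrand_measurable:
  assumes "x \<in> borel_measurable M" "u \<in> borel_measurable M"
  shows "(\<lambda>\<omega>. f (x \<omega>) (u \<omega>) \<omega>) \<in> borel_measurable M"
proof (rule borel_measurableI_le)
  fix a :: ereal
  show "{\<omega> \<in> space M. f (x \<omega>) (u \<omega>) \<omega> \<le> a} \<in> sets M"
  proof (cases a)
    case (real r) then show ?thesis using integrand_sublevel_measurable[OF assms] by simp
  next
    case MInf
    have "{\<omega> \<in> space M. f (x \<omega>) (u \<omega>) \<omega> \<le> a} = (\<Inter>n::nat. {\<omega> \<in> space M. f (x \<omega>) (u \<omega>) \<omega> \<le> ereal (- real n)})"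
    proof -
      have *: "t \<le> - \<infinity> \<longleftrightarrow> (\<forall>n::nat. t \<le> ereal (- real n))" for t :: ereal
      proof (cases t)
        case (real r)
        obtain n :: nat where "- r < real n" using reals_Archimedean2 by blast
        then show ?thesis using real by (auto intro!: exI[of _ n] simp: not_le)
      qed auto
      show ?thesis unfolding MInf * by auto
    qed
    then show ?thesis using integrand_sublevel_measurable[OF assms] by auto
  qed simp
qed

end

text \<open>By Borel--Cantelli and summability of \<open>(1/2)^n\<close>, almost every point lies in
  only finitely many \<open>C n\<close>, so dominated convergence applies.\<close>

lemma (in prob_space) integral_small_sets:
  fixes g :: "'a \<Rightarrow> real"
  assumes g: "integrable M g" and C: "\<And>n::nat. C n \<in> sets M" "\<And>n. measure M (C n) \<le> (1/2)^n"
  shows "(\<lambda>n. \<integral>\<omega>. indicator (C n) \<omega> * g \<omega> \<partial>M) \<longlonglongrightarrow> 0"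
proof -
  have [measurable]: "g \<in> borel_measurable M" using g by simp
  have "AE \<omega> in M. eventually (\<lambda>n. \<omega> \<in> space M - C n) sequentially"
  proof (rule borel_cantelli_AE1[OF C(1)])
    show "summable (\<lambda>n. measure M (C n))"
      by (rule summable_comparison_test'[of "\<lambda>n. (1/2::real)^n" 0]) (use C(2) in \<open>auto simp: summable_geometric\<close>)
  qed (simp add: emeasure_eq_measure)
  then have lim: "AE \<omega> in M. (\<lambda>n. indicator (C n) \<omega> * g \<omega>) \<longlonglongrightarrow> 0"
  proof eventually_elim
    case (elim \<omega>)
    then have "eventually (\<lambda>n. indicator (C n) \<omega> * g \<omega> = 0) sequentially" by eventually_elim auto
    then show ?case by (rule tendsto_eventually)
  qed
  have "(\<lambda>n. \<integral>\<omega>. indicator (C n) \<omega> * g \<omega> \<partial>M) \<longlonglongrightarrow> (\<integral>\<omega>. 0 \<partial>M)"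
  proof (rule integral_dominated_convergence[where w="\<lambda>\<omega>. \<bar>g \<omega>\<bar>"])
    show "(\<lambda>\<omega>. indicator (C n) \<omega> * g \<omega>) \<in> borel_measurable M" for n using C(1) by measurable
  qed (use g lim in \<open>auto simp: indicator_def\<close>)
  then show ?thesis by simp
qed

lemma (in rv_duality) X_if:
  assumes "x \<in> X" "y \<in> X" "A \<in> sets M" shows "(\<lambda>\<omega>. if \<omega> \<in> A then x \<omega> else y \<omega>) \<in> X"
proof (rule X_ae[OF X_add[OF X_indicator[OF assms(1,3)] X_indicator[OF assms(2), of "space M - A"]]])
  show "(\<lambda>\<omega>. if \<omega> \<in> A then x \<omega> else y \<omega>) \<in> borel_measurable M"
    using meas_X[OF assms(1)] meas_X[OF assms(2)] assms(3) by measurable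
  show "ae_eq M (\<lambda>\<omega>. if \<omega> \<in> A then x \<omega> else y \<omega>)
     ((\<lambda>\<omega>. indicator A \<omega> *\<^sub>R x \<omega>) + (\<lambda>\<omega>. indicator (space M - A) \<omega> *\<^sub>R y \<omega>))"
    unfolding ae_eq_def by (rule AE_I2) (auto simp: indicator_def)
qed (use assms in auto)

locale integrand_duality = X: rv_duality M X V SX dX + U: rv_duality M U Y SU dU
  for M :: "'w measure" and X V :: "('w \<Rightarrow> real^'n::finite) set" and SX dX
    and U Y :: "('w \<Rightarrow> real^'m::finite) set" and SU dU +
  fixes f :: "real^'n \<Rightarrow> real^'m \<Rightarrow> 'w \<Rightarrow> ereal"
  assumes normal: "convex_normal_integrand M f"
begin

abbreviation Ef where "Ef \<equiv> integral_functional M f"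

lemma Ef_finite:
  assumes "x \<in> X" "u \<in> U" "Ef x u = ereal r"
  obtains h where "integrable M h" "AE \<omega> in M. f (x \<omega>) (u \<omega>) \<omega> = ereal (h \<omega>)" "(\<integral>\<omega>. h \<omega> \<partial>M) = r"
  using extended_integral_finite[OF integrand_measurable[OF normal X.meas_X[OF assms(1)] U.meas_X[OF assms(2)]]]
    assms(3) unfolding integral_functional_def by blast

lemma Ef_convex:
  assumes xu: "x \<in> X" "u \<in> U" "x' \<in> X" "u' \<in> U" and r: "Ef x u = ereal r" "Ef x' u' = ereal r'"
    and t: "0 \<le> t" "t \<le> 1"
  shows "Ef ((1 - t) *\<^sub>R x + t *\<^sub>R x') ((1 - t) *\<^sub>R u + t *\<^sub>R u') \<le> ereal ((1 - t) * r + t * r')"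
proof -
  obtain h where h: "integrable M h" "AE \<omega> in M. f (x \<omega>) (u \<omega>) \<omega> = ereal (h \<omega>)" "(\<integral>\<omega>. h \<omega> \<partial>M) = r"
    by (rule Ef_finite[OF xu(1,2) r(1)])
  obtain h' where h': "integrable M h'" "AE \<omega> in M. f (x' \<omega>) (u' \<omega>) \<omega> = ereal (h' \<omega>)" "(\<integral>\<omega>. h' \<omega> \<partial>M) = r'"
    by (rule Ef_finite[OF xu(3,4) r(2)])
  have "extended_integral M (\<lambda>\<omega>. f (((1 - t) *\<^sub>R x + t *\<^sub>R x') \<omega>) (((1 - t) *\<^sub>R u + t *\<^sub>R u') \<omega>) \<omega>) \<le>
      ereal (\<integral>\<omega>. (1 - t) * h \<omega> + t * h' \<omega> \<partial>M)"
  proof (rule extended_integral_le)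
    show "AE \<omega> in M. f (((1 - t) *\<^sub>R x + t *\<^sub>R x') \<omega>) (((1 - t) *\<^sub>R u + t *\<^sub>R u') \<omega>) \<omega> \<le> ereal ((1 - t) * h \<omega> + t * h' \<omega>)"
      using h(2) h'(2) AE_space
    proof eventually_elim
      case (elim \<omega>)
      then show ?case
        using integrand_convex[OF normal elim(3), of "x \<omega>" "u \<omega>" "h \<omega>" "x' \<omega>" "u' \<omega>" "h' \<omega>" t] t by simp
    qed
  qed (use h h' in auto)
  then show ?thesis unfolding integral_functional_def using h h' by simp
qed

text \<open>Splicing \<open>(x\<^sub>2, u\<^sub>2)\<close> into \<open>(x\<^sub>1, u\<^sub>1)\<close> on sets of vanishing probability does not affect the
  absolutely continuous part and the integral, but carries over the singular part.\<close>

lemma singular_part_separates: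
  assumes v: "v \<in> V" and w: "w \<in> Y" and s: "s \<in> singular_dual M SX" and r: "r \<in> singular_dual M SU"
    and minor: "\<And>x u. x \<in> X \<Longrightarrow> u \<in> U \<Longrightarrow>
      ereal (pairing M v x + s x + (pairing M w u + r u) - c) \<le> Ef x u"
    and xu: "x\<^sub>1 \<in> X" "u\<^sub>1 \<in> U" "x\<^sub>2 \<in> X" "u\<^sub>2 \<in> U" and e: "Ef x\<^sub>1 u\<^sub>1 = ereal e\<^sub>1" "Ef x\<^sub>2 u\<^sub>2 = ereal e\<^sub>2"
  shows "pairing M v x\<^sub>1 + pairing M w u\<^sub>1 - e\<^sub>1 + (s x\<^sub>2 + r u\<^sub>2) \<le> c"
proof (rule field_le_epsilon)
  fix \<epsilon> :: real assume "0 < \<epsilon>"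
  then have \<delta>: "0 < \<epsilon> / 2" by simp
  have sd: "s \<in> top_dual SX" and rd: "r \<in> top_dual SU" using s r by (auto simp: singular_dual_def)
  have dx: "x\<^sub>1 - x\<^sub>2 \<in> X" and du: "u\<^sub>1 - u\<^sub>2 \<in> U" using xu X.X_diff U.X_diff by auto
  \<comment> \<open>The rate \<open>(1/2)^n\<close> serves \<open>integral_small_sets\<close>. One
    set must do for both functionals, so a set for \<open>s\<close> and one for \<open>r\<close> are
    united; this is permitted because \<open>singular_small_set\<close> controls every measurable
    set off \<open>C\<close>.\<close>
  define good where "good n C \<longleftrightarrow> C \<in> sets M \<and> measure M C \<le> (1/2)^n \<and>
      \<bar>s (\<lambda>\<omega>. indicator (space M - C) \<omega> *\<^sub>R (x\<^sub>1 - x\<^sub>2) \<omega>)\<bar> \<le> \<epsilon> / 2 \<and>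
      \<bar>r (\<lambda>\<omega>. indicator (space M - C) \<omega> *\<^sub>R (u\<^sub>1 - u\<^sub>2) \<omega>)\<bar> \<le> \<epsilon> / 2" for n C
  have "\<exists>C. good n C" for n
  proof -
    have p: "0 < (1/2::real)^n / 2" by simp
    from X.singular_small_set[OF s dx p \<delta>]
    obtain A where A: "A \<in> sets M" "measure M A < (1/2::real)^n / 2"
      "\<forall>F\<in>sets M. F \<inter> A = {} \<longrightarrow> \<bar>s (\<lambda>\<omega>. indicator F \<omega> *\<^sub>R (x\<^sub>1 - x\<^sub>2) \<omega>)\<bar> \<le> \<epsilon> / 2"
      by (elim bexE conjE)
    from U.singular_small_set[OF r du p \<delta>]
    obtain B where B: "B \<in> sets M" "measure M B < (1/2::real)^n / 2"
      "\<forall>F\<in>sets M. F \<inter> B = {} \<longrightarrow> \<bar>r (\<lambda>\<omega>. indicator F \<omega> *\<^sub>R (u\<^sub>1 - u\<^sub>2) \<omega>)\<bar> \<le> \<epsilon> / 2"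
      by (elim bexE conjE)
    have "measure M (A \<union> B) \<le> (1/2)^n" using measure_Un_le[OF A(1) B(1)] A(2) B(2) by linarith
    moreover have "A \<union> B \<in> sets M" "space M - (A \<union> B) \<in> sets M" using A B by auto
    moreover have "(space M - (A \<union> B)) \<inter> A = {}" "(space M - (A \<union> B)) \<inter> B = {}" by auto
    ultimately have "good n (A \<union> B)" unfolding good_def using A(3) B(3) by simp
    then show ?thesis ..
  qed
  then obtain C where "\<And>n. good n (C n)" by metis
  then have C: "\<And>n. C n \<in> sets M" "\<And>n. measure M (C n) \<le> (1/2)^n"
      "\<And>n. \<bar>s (\<lambda>\<omega>. indicator (space M - C n) \<omega> *\<^sub>R (x\<^sub>1 - x\<^sub>2) \<omega>)\<bar> \<le> \<epsilon> / 2"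
      "\<And>n. \<bar>r (\<lambda>\<omega>. indicator (space M - C n) \<omega> *\<^sub>R (u\<^sub>1 - u\<^sub>2) \<omega>)\<bar> \<le> \<epsilon> / 2" by (simp_all only: good_def)
  obtain h\<^sub>1 where h1: "integrable M h\<^sub>1" "AE \<omega> in M. f (x\<^sub>1 \<omega>) (u\<^sub>1 \<omega>) \<omega> = ereal (h\<^sub>1 \<omega>)" "(\<integral>\<omega>. h\<^sub>1 \<omega> \<partial>M) = e\<^sub>1"
    by (rule Ef_finite[OF xu(1,2) e(1)])
  obtain h\<^sub>2 where h2: "integrable M h\<^sub>2" "AE \<omega> in M. f (x\<^sub>2 \<omega>) (u\<^sub>2 \<omega>) \<omega> = ereal (h\<^sub>2 \<omega>)" "(\<integral>\<omega>. h\<^sub>2 \<omega> \<partial>M) = e\<^sub>2"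
    by (rule Ef_finite[OF xu(3,4) e(2)])
  \<comment> \<open>Collects the changes that the splice causes in the integral and in both
    pairings; only its integral over \<open>C n\<close> enters.\<close>
  define \<psi> where "\<psi> \<omega> = h\<^sub>2 \<omega> - h\<^sub>1 \<omega> + (x\<^sub>1 - x\<^sub>2) \<omega> \<bullet> v \<omega> + (u\<^sub>1 - u\<^sub>2) \<omega> \<bullet> w \<omega>" for \<omega>
  have xi: "integrable M (\<lambda>\<omega>. (x\<^sub>1 - x\<^sub>2) \<omega> \<bullet> v \<omega>)" "integrable M (\<lambda>\<omega>. (u\<^sub>1 - u\<^sub>2) \<omega> \<bullet> w \<omega>)"
    using X.pairing_integrable[OF dx v] U.pairing_integrable[OF du w] by auto
  have \<psi>i: "integrable M \<psi>" unfolding \<psi>_def using h1(1) h2(1) xi by (intro Bochner_Integration.integrable_add Bochner_Integration.integrable_diff)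
  have bound: "pairing M v x\<^sub>1 + pairing M w u\<^sub>1 - e\<^sub>1 + (s x\<^sub>2 + r u\<^sub>2) - (c + \<epsilon>) \<le> (\<integral>\<omega>. indicator (C n) \<omega> * \<psi> \<omega> \<partial>M)" for n
  proof -
    note Cn = C(1)[of n]
    \<comment> \<open>The second pair is used on the small set \<open>C n\<close> only, so integrals
      see \<open>(x\<^sub>1, u\<^sub>1)\<close> up to a vanishing error. Yet \<open>x\<close> is
      \<open>x\<^sub>2\<close> plus the part of \<open>x\<^sub>1 - x\<^sub>2\<close> off
      \<open>C n\<close>, which \<open>s\<close> nearly ignores, so \<open>s x\<close> is close to
      \<open>s x\<^sub>2\<close>.\<close>
    define x where "x \<omega> = (if \<omega> \<in> C n then x\<^sub>2 \<omega> else x\<^sub>1 \<omega>)" for \<omega>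
    define u where "u \<omega> = (if \<omega> \<in> C n then u\<^sub>2 \<omega> else u\<^sub>1 \<omega>)" for \<omega>
    have xX: "x \<in> X" and uU: "u \<in> U" unfolding x_def u_def using X.X_if U.X_if xu Cn by auto
    have ci: "integrable M (\<lambda>\<omega>. indicator (C n) \<omega> * g \<omega>)" if "integrable M g" for g :: "'w \<Rightarrow> real"
      using integrable_mult_indicator[OF Cn that] by simp
    have Efx: "Ef x u \<le> ereal (e\<^sub>1 + (\<integral>\<omega>. indicator (C n) \<omega> * (h\<^sub>2 \<omega> - h\<^sub>1 \<omega>) \<partial>M))"
    proof -
      have "extended_integral M (\<lambda>\<omega>. f (x \<omega>) (u \<omega>) \<omega>) \<le> ereal (\<integral>\<omega>. h\<^sub>1 \<omega> + indicator (C n) \<omega> * (h\<^sub>2 \<omega> - h\<^sub>1 \<omega>) \<partial>M)"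
      proof (rule extended_integral_le)
        show "AE \<omega> in M. f (x \<omega>) (u \<omega>) \<omega> \<le> ereal (h\<^sub>1 \<omega> + indicator (C n) \<omega> * (h\<^sub>2 \<omega> - h\<^sub>1 \<omega>))"
          using h1(2) h2(2) by eventually_elim (auto simp: x_def u_def)
      qed (intro Bochner_Integration.integrable_add ci Bochner_Integration.integrable_diff h1(1) h2(1))
      then show ?thesis unfolding integral_functional_def
        using h1(1,3) ci[OF Bochner_Integration.integrable_diff[OF h2(1) h1(1)]] by simp
    qed
    have px: "pairing M v x = pairing M v x\<^sub>1 - (\<integral>\<omega>. indicator (C n) \<omega> * ((x\<^sub>1 - x\<^sub>2) \<omega> \<bullet> v \<omega>) \<partial>M)"
    proof -
      have "x \<omega> \<bullet> v \<omega> = x\<^sub>1 \<omega> \<bullet> v \<omega> - indicator (C n) \<omega> * ((x\<^sub>1 - x\<^sub>2) \<omega> \<bullet> v \<omega>)" for \<omega>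
        by (simp add: x_def inner_diff_left)
      then show ?thesis unfolding pairing_def using X.pairing_integrable[OF xu(1) v] ci[OF xi(1)] by simp
    qed
    have pu: "pairing M w u = pairing M w u\<^sub>1 - (\<integral>\<omega>. indicator (C n) \<omega> * ((u\<^sub>1 - u\<^sub>2) \<omega> \<bullet> w \<omega>) \<partial>M)"
    proof -
      have "u \<omega> \<bullet> w \<omega> = u\<^sub>1 \<omega> \<bullet> w \<omega> - indicator (C n) \<omega> * ((u\<^sub>1 - u\<^sub>2) \<omega> \<bullet> w \<omega>)" for \<omega>
        by (simp add: u_def inner_diff_left)
      then show ?thesis unfolding pairing_def using U.pairing_integrable[OF xu(2) w] ci[OF xi(2)] by simp
    qed
    have co: "space M - C n \<in> sets M" using Cn by auto
    have "s x = s (x\<^sub>2 + (\<lambda>\<omega>. indicator (space M - C n) \<omega> *\<^sub>R (x\<^sub>1 - x\<^sub>2) \<omega>))"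
      by (rule X.dual_ae[OF sd xX X.X_add[OF xu(3) X.X_indicator[OF dx co]]])
        (simp add: ae_eq_def x_def indicator_def)
    then have sx: "s x \<ge> s x\<^sub>2 - \<epsilon> / 2"
      using X.dual_add[OF sd xu(3) X.X_indicator[OF dx co]] C(3)[of n] by simp
    have "r u = r (u\<^sub>2 + (\<lambda>\<omega>. indicator (space M - C n) \<omega> *\<^sub>R (u\<^sub>1 - u\<^sub>2) \<omega>))"
      by (rule U.dual_ae[OF rd uU U.X_add[OF xu(4) U.X_indicator[OF du co]]])
        (simp add: ae_eq_def u_def indicator_def)
    then have ru: "r u \<ge> r u\<^sub>2 - \<epsilon> / 2"
      using U.dual_add[OF rd xu(4) U.X_indicator[OF du co]] C(4)[of n] by simp
    have "(\<integral>\<omega>. indicator (C n) \<omega> * \<psi> \<omega> \<partial>M) = (\<integral>\<omega>. indicator (C n) \<omega> * (h\<^sub>2 \<omega> - h\<^sub>1 \<omega>) +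
        (indicator (C n) \<omega> * ((x\<^sub>1 - x\<^sub>2) \<omega> \<bullet> v \<omega>) + indicator (C n) \<omega> * ((u\<^sub>1 - u\<^sub>2) \<omega> \<bullet> w \<omega>)) \<partial>M)"
      by (rule Bochner_Integration.integral_cong) (simp_all add: \<psi>_def algebra_simps)
    also have "\<dots> = (\<integral>\<omega>. indicator (C n) \<omega> * (h\<^sub>2 \<omega> - h\<^sub>1 \<omega>) \<partial>M) +
        ((\<integral>\<omega>. indicator (C n) \<omega> * ((x\<^sub>1 - x\<^sub>2) \<omega> \<bullet> v \<omega>) \<partial>M) + (\<integral>\<omega>. indicator (C n) \<omega> * ((u\<^sub>1 - u\<^sub>2) \<omega> \<bullet> w \<omega>) \<partial>M))"
      unfolding Bochner_Integration.integral_add[OF ci[OF xi(1)] ci[OF xi(2)], symmetric]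
      by (rule Bochner_Integration.integral_add[OF ci[OF Bochner_Integration.integrable_diff[OF h2(1) h1(1)]]
            Bochner_Integration.integrable_add[OF ci[OF xi(1)] ci[OF xi(2)]]])
    finally have I: "(\<integral>\<omega>. indicator (C n) \<omega> * \<psi> \<omega> \<partial>M) = \<dots>" .
    have "ereal (pairing M v x + s x + (pairing M w u + r u) - c) \<le>
        ereal (e\<^sub>1 + (\<integral>\<omega>. indicator (C n) \<omega> * (h\<^sub>2 \<omega> - h\<^sub>1 \<omega>) \<partial>M))"
      using minor[OF xX uU] Efx by (rule order_trans)
    then have "pairing M v x + s x + (pairing M w u + r u) - c \<le> e\<^sub>1 + (\<integral>\<omega>. indicator (C n) \<omega> * (h\<^sub>2 \<omega> - h\<^sub>1 \<omega>) \<partial>M)"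
      by simp
    then show ?thesis using px pu sx ru I by linarith
  qed
  have "pairing M v x\<^sub>1 + pairing M w u\<^sub>1 - e\<^sub>1 + (s x\<^sub>2 + r u\<^sub>2) - (c + \<epsilon>) \<le> 0"
    by (rule LIMSEQ_le_const[OF X.integral_small_sets[OF \<psi>i C(1,2)]]) (use bound in simp)
  then show "pairing M v x\<^sub>1 + pairing M w u\<^sub>1 - e\<^sub>1 + (s x\<^sub>2 + r u\<^sub>2) \<le> c + \<epsilon>" by simp
qed

end

section \<open>Strong lower semicontinuity of the integral functional\<close>

lemma ennreal_enn2real_le: "ennreal (enn2real x) \<le> x"
  by (cases x) simp_all

lemma ennreal_enn2real_eq: "x \<noteq> \<infinity> \<Longrightarrow> x = ennreal (enn2real x)"
  by (cases x) simp_all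

context integrand_duality
begin

text \<open>\<open>g\<close> is the integrand along one pair \<open>(x, u)\<close> minus the affine
  term of \<open>(v, w)\<close>. Sequences of such functions stand in for minus the conjugate
  integrand at \<open>(v, w)\<close>, which bounds all of them from below.\<close>

definition selection_value :: "('w \<Rightarrow> real^'n) \<Rightarrow> ('w \<Rightarrow> real^'m) \<Rightarrow> ('w \<Rightarrow> real) \<Rightarrow> bool" where
  "selection_value v w g \<longleftrightarrow> integrable M g \<and>
     (\<exists>x\<in>X. \<exists>u\<in>U. AE \<omega> in M. f (x \<omega>) (u \<omega>) \<omega> = ereal (g \<omega> + x \<omega> \<bullet> v \<omega> + u \<omega> \<bullet> w \<omega>))"

text \<open>Splicing the two selections on the set where \<open>g \<le> g'\<close> realizes the
  pointwise minimum.\<close>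

lemma selection_value_min:
  assumes "selection_value v w g" "selection_value v w g'"
  shows "selection_value v w (\<lambda>\<omega>. min (g \<omega>) (g' \<omega>))"
proof -
  obtain x u where xu: "x \<in> X" "u \<in> U" "AE \<omega> in M. f (x \<omega>) (u \<omega>) \<omega> = ereal (g \<omega> + x \<omega> \<bullet> v \<omega> + u \<omega> \<bullet> w \<omega>)"
    using assms(1) unfolding selection_value_def by blast
  obtain x' u' where xu': "x' \<in> X" "u' \<in> U" "AE \<omega> in M. f (x' \<omega>) (u' \<omega>) \<omega> = ereal (g' \<omega> + x' \<omega> \<bullet> v \<omega> + u' \<omega> \<bullet> w \<omega>)"
    using assms(2) unfolding selection_value_def by blast
  have gi: "integrable M g" "integrable M g'" using assms by (auto simp: selection_value_def)
  then have [measurable]: "g \<in> borel_measurable M" "g' \<in> borel_measurable M" by auto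
  define A where "A = {\<omega> \<in> space M. g \<omega> \<le> g' \<omega>}"
  have A: "A \<in> sets M" unfolding A_def by measurable
  define y where "y \<omega> = (if \<omega> \<in> A then x \<omega> else x' \<omega>)" for \<omega>
  define z where "z \<omega> = (if \<omega> \<in> A then u \<omega> else u' \<omega>)" for \<omega>
  have "y \<in> X" "z \<in> U" unfolding y_def z_def using X.X_if U.X_if xu xu' A by auto
  moreover have "AE \<omega> in M. f (y \<omega>) (z \<omega>) \<omega> = ereal (min (g \<omega>) (g' \<omega>) + y \<omega> \<bullet> v \<omega> + z \<omega> \<bullet> w \<omega>)"
    using xu(3) xu'(3) AE_space by eventually_elim (simp add: y_def z_def A_def min_def)
  ultimately show ?thesis using integrable_min[OF gi] unfolding selection_value_def by blast
qed

lemma selection_value_lower: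
  assumes v: "v \<in> V" and w: "w \<in> Y" and g: "selection_value v w g"
    and minor: "\<And>x u. x \<in> X \<Longrightarrow> u \<in> U \<Longrightarrow> ereal (pairing M v x + pairing M w u - c) \<le> Ef x u"
  shows "- c \<le> (\<integral>\<omega>. g \<omega> \<partial>M)"
proof -
  obtain x u where xu: "x \<in> X" "u \<in> U" "AE \<omega> in M. f (x \<omega>) (u \<omega>) \<omega> = ereal (g \<omega> + x \<omega> \<bullet> v \<omega> + u \<omega> \<bullet> w \<omega>)"
    using g unfolding selection_value_def by blast
  have i: "integrable M g" "integrable M (\<lambda>\<omega>. x \<omega> \<bullet> v \<omega>)" "integrable M (\<lambda>\<omega>. u \<omega> \<bullet> w \<omega>)"
    using g X.pairing_integrable[OF xu(1) v] U.pairing_integrable[OF xu(2) w] by (auto simp: selection_value_def)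
  have "Ef x u \<le> ereal (\<integral>\<omega>. g \<omega> + x \<omega> \<bullet> v \<omega> + u \<omega> \<bullet> w \<omega> \<partial>M)"
    unfolding integral_functional_def
    by (rule extended_integral_le) (use i xu(3) in \<open>auto elim: eventually_mono\<close>)
  also have "(\<integral>\<omega>. g \<omega> + x \<omega> \<bullet> v \<omega> + u \<omega> \<bullet> w \<omega> \<partial>M) = (\<integral>\<omega>. g \<omega> \<partial>M) + pairing M v x + pairing M w u"
    using i by (simp add: pairing_def)
  finally have "ereal (pairing M v x + pairing M w u - c) \<le> ereal ((\<integral>\<omega>. g \<omega> \<partial>M) + pairing M v x + pairing M w u)"
    using minor[OF xu(1,2)] by (rule order_trans[rotated])
  then show ?thesis by simp
qed

text \<open>By decomposability the integrals of the minima of finitely many selections are bounded below,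
  so the infimum of a sequence of selections has an integrable minorant, as needed for Fatou.\<close>

lemma selection_values_minorant:
  assumes v: "v \<in> V" and w: "w \<in> Y" and g: "\<And>k::nat. selection_value v w (g k)"
    and minor: "\<And>x u. x \<in> X \<Longrightarrow> u \<in> U \<Longrightarrow> ereal (pairing M v x + pairing M w u - c) \<le> Ef x u"
  obtains m where "integrable M m" "AE \<omega> in M. \<forall>k. m \<omega> \<le> g k \<omega>"
proof -
  define mn where "mn = rec_nat (g 0) (\<lambda>k m \<omega>. min (m \<omega>) (g (Suc k) \<omega>))"
  have mn: "mn 0 = g 0" "mn (Suc k) = (\<lambda>\<omega>. min (mn k \<omega>) (g (Suc k) \<omega>))" for k by (simp_all add: mn_def)
  have sel: "selection_value v w (mn k)" for k
    by (induction k) (simp_all add: mn g selection_value_min)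
  then have mi: "integrable M (mn k)" for k by (simp add: selection_value_def)
  then have [measurable]: "mn k \<in> borel_measurable M" for k by auto
  have le: "mn k \<omega> \<le> g k \<omega>" for k \<omega> by (cases k) (simp_all add: mn)
  have dec: "mn (Suc k) \<omega> \<le> mn k \<omega>" for k \<omega> by (simp add: mn)
  have le0: "mn k \<omega> \<le> mn 0 \<omega>" for k \<omega> by (induction k) (use dec order_trans in blast)+
  \<comment> \<open>Decreasing minima are turned into increasing nonnegative functions, to which
    monotone convergence applies; the common bound \<open>- c\<close> on their integrals keeps the
    limit finite.\<close>
  define D where "D k \<omega> = ennreal (mn 0 \<omega> - mn k \<omega>)" for k \<omega>
  have inc: "incseq D" unfolding incseq_Suc_iff le_fun_def D_def using dec by (auto intro!: ennreal_leI diff_left_mono)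
  have "(\<integral>\<^sup>+\<omega>. (SUP k. D k \<omega>) \<partial>M) = (SUP k. \<integral>\<^sup>+\<omega>. D k \<omega> \<partial>M)"
    by (rule nn_integral_monotone_convergence_SUP[OF inc]) (simp add: D_def[abs_def])
  also have "\<dots> \<le> ennreal ((\<integral>\<omega>. mn 0 \<omega> \<partial>M) + c)"
  proof (rule SUP_least)
    fix k
    have "(\<integral>\<^sup>+\<omega>. D k \<omega> \<partial>M) = ennreal (\<integral>\<omega>. mn 0 \<omega> - mn k \<omega> \<partial>M)"
      unfolding D_def by (rule nn_integral_eq_integral) (use mi le0 in auto)
    also have "\<dots> \<le> ennreal ((\<integral>\<omega>. mn 0 \<omega> \<partial>M) + c)"
      using selection_value_lower[OF v w sel minor, of k] mi by (intro ennreal_leI) simp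
    finally show "(\<integral>\<^sup>+\<omega>. D k \<omega> \<partial>M) \<le> ennreal ((\<integral>\<omega>. mn 0 \<omega> \<partial>M) + c)" .
  qed
  also have "\<dots> < \<infinity>" by simp
  finally have fin: "(\<integral>\<^sup>+\<omega>. (SUP k. D k \<omega>) \<partial>M) < \<infinity>" .
  have meas: "(\<lambda>\<omega>. SUP k. D k \<omega>) \<in> borel_measurable M" unfolding D_def by measurable
  have ae: "AE \<omega> in M. (SUP k. D k \<omega>) \<noteq> \<infinity>" by (rule nn_integral_PInf_AE[OF meas]) (use fin in simp)
  define \<alpha> where "\<alpha> \<omega> = enn2real (SUP k. D k \<omega>)" for \<omega>
  have "integrable M \<alpha>"
  proof (rule integrableI_nonneg)
    show "\<alpha> \<in> borel_measurable M" unfolding \<alpha>_def using meas by measurable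
    have "(\<integral>\<^sup>+\<omega>. ennreal (\<alpha> \<omega>) \<partial>M) \<le> (\<integral>\<^sup>+\<omega>. (SUP k. D k \<omega>) \<partial>M)"
      unfolding \<alpha>_def by (intro nn_integral_mono ennreal_enn2real_le)
    then show "(\<integral>\<^sup>+\<omega>. ennreal (\<alpha> \<omega>) \<partial>M) < \<infinity>" using fin by (rule le_less_trans)
  qed (simp add: \<alpha>_def)
  then have "integrable M (\<lambda>\<omega>. mn 0 \<omega> - \<alpha> \<omega>)" using mi by simp
  moreover have "AE \<omega> in M. \<forall>k. mn 0 \<omega> - \<alpha> \<omega> \<le> g k \<omega>"
    using ae
  proof eventually_elim
    case (elim \<omega>)
    show ?case
    proof
      fix k
      have "D k \<omega> \<le> (SUP k. D k \<omega>)" by (rule SUP_upper) simp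
      also have "\<dots> = ennreal (\<alpha> \<omega>)" unfolding \<alpha>_def by (rule ennreal_enn2real_eq[OF elim])
      finally have "mn 0 \<omega> - mn k \<omega> \<le> \<alpha> \<omega>" by (simp add: D_def \<alpha>_def ennreal_le_iff)
      then show "mn 0 \<omega> - \<alpha> \<omega> \<le> g k \<omega>" using le[of k \<omega>] by linarith
    qed
  qed
  ultimately show thesis by (rule that)
qed

text \<open>Fatou's lemma for \<open>f\<close> minus the affine term of \<open>(v, w)\<close>: the
  functions \<open>g k\<close> share the integrable minorant \<open>m\<close>, the integrals of the
  affine terms converge by \<open>pv\<close> and \<open>pw\<close>, and the closed epigraph passes
  the pointwise bound to the limit.\<close>

lemma Ef_lsc_AE:
  assumes v: "v \<in> V" and w: "w \<in> Y"
    and minor: "\<And>x u. x \<in> X \<Longrightarrow> u \<in> U \<Longrightarrow> ereal (pairing M v x + pairing M w u - c) \<le> Ef x u"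
    and xu: "\<And>k::nat. x k \<in> X" "\<And>k. u k \<in> U" "x' \<in> X" "u' \<in> U"
    and le: "\<And>k. Ef (x k) (u k) \<le> ereal r"
    and lx: "AE \<omega> in M. (\<lambda>k. x k \<omega>) \<longlonglongrightarrow> x' \<omega>" and lu: "AE \<omega> in M. (\<lambda>k. u k \<omega>) \<longlonglongrightarrow> u' \<omega>"
    and pv: "(\<lambda>k. pairing M v (x k)) \<longlonglongrightarrow> pairing M v x'" and pw: "(\<lambda>k. pairing M w (u k)) \<longlonglongrightarrow> pairing M w u'"
  shows "Ef x' u' \<le> ereal r"
proof -
  define l where "l y z \<omega> = y \<omega> \<bullet> v \<omega> + z \<omega> \<bullet> w \<omega>" for y :: "'w \<Rightarrow> real^'n" and z :: "'w \<Rightarrow> real^'m" and \<omega>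
  have li: "integrable M (l y z)" "(\<integral>\<omega>. l y z \<omega> \<partial>M) = pairing M v y + pairing M w z" if "y \<in> X" "z \<in> U" for y z
    using X.pairing_integrable[OF that(1) v] U.pairing_integrable[OF that(2) w]
    unfolding l_def pairing_def by simp_all
  have "\<exists>h. integrable M h \<and> (AE \<omega> in M. f (x k \<omega>) (u k \<omega>) \<omega> = ereal (h \<omega>)) \<and> (\<integral>\<omega>. h \<omega> \<partial>M) \<le> r" for k
  proof -
    have "Ef (x k) (u k) \<noteq> \<infinity>" "Ef (x k) (u k) \<noteq> - \<infinity>" using le[of k] minor[OF xu(1,2), of k k] by auto
    then obtain e where e: "Ef (x k) (u k) = ereal e" by (cases "Ef (x k) (u k)") auto
    obtain h where "integrable M h" "AE \<omega> in M. f (x k \<omega>) (u k \<omega>) \<omega> = ereal (h \<omega>)" "(\<integral>\<omega>. h \<omega> \<partial>M) = e"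
      by (rule Ef_finite[OF xu(1,2) e])
    moreover have "e \<le> r" using le[of k] e by simp
    ultimately show ?thesis by blast
  qed
  then obtain h where h: "\<And>k. integrable M (h k)" "\<And>k. AE \<omega> in M. f (x k \<omega>) (u k \<omega>) \<omega> = ereal (h k \<omega>)"
    "\<And>k. (\<integral>\<omega>. h k \<omega> \<partial>M) \<le> r" by metis
  define g where "g k \<omega> = h k \<omega> - l (x k) (u k) \<omega>" for k \<omega>
  have gi: "integrable M (g k)" and gint: "(\<integral>\<omega>. g k \<omega> \<partial>M) \<le> r - pairing M v (x k) - pairing M w (u k)" for k
    unfolding g_def using h(1,3)[of k] li[OF xu(1,2), of k k] by simp_all
  have "selection_value v w (g k)" for k
    unfolding selection_value_def
  proof (intro conjI gi bexI)
    show "AE \<omega> in M. f (x k \<omega>) (u k \<omega>) \<omega> = ereal (g k \<omega> + x k \<omega> \<bullet> v \<omega> + u k \<omega> \<bullet> w \<omega>)"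
      using h(2)[of k] by eventually_elim (simp add: g_def l_def)
  qed (fact xu)+
  then obtain m where m: "integrable M m" "AE \<omega> in M. \<forall>k. m \<omega> \<le> g k \<omega>"
    by (rule selection_values_minorant[OF v w _ minor])
  have [measurable]: "g k \<in> borel_measurable M" "m \<in> borel_measurable M" for k using gi m(1) by auto
  define \<rho> where "\<rho> = r - pairing M v x' - pairing M w u' - (\<integral>\<omega>. m \<omega> \<partial>M)"
  define J where "J \<omega> = liminf (\<lambda>k. ennreal (g k \<omega> - m \<omega>))" for \<omega>
  have [measurable]: "J \<in> borel_measurable M" unfolding J_def by measurable
  have \<rho>lim: "(\<lambda>k. r - pairing M v (x k) - pairing M w (u k) - (\<integral>\<omega>. m \<omega> \<partial>M)) \<longlonglongrightarrow> \<rho>"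
    unfolding \<rho>_def by (intro tendsto_intros pv pw)
  have gm: "(\<integral>\<omega>. g k \<omega> - m \<omega> \<partial>M) \<le> r - pairing M v (x k) - pairing M w (u k) - (\<integral>\<omega>. m \<omega> \<partial>M)" for k
    using gint[of k] gi m(1) by simp
  have gm0: "0 \<le> (\<integral>\<omega>. g k \<omega> - m \<omega> \<partial>M)" for k
    by (rule integral_nonneg_AE) (use m(2) in \<open>auto elim: eventually_mono\<close>)
  have \<rho>0: "0 \<le> \<rho>" by (rule LIMSEQ_le_const[OF \<rho>lim]) (use gm gm0 order_trans in blast)
  have "(\<integral>\<^sup>+\<omega>. J \<omega> \<partial>M) \<le> liminf (\<lambda>k. \<integral>\<^sup>+\<omega>. ennreal (g k \<omega> - m \<omega>) \<partial>M)"
    unfolding J_def by (rule nn_integral_liminf) measurable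
  also have "\<dots> \<le> liminf (\<lambda>k. ennreal (r - pairing M v (x k) - pairing M w (u k) - (\<integral>\<omega>. m \<omega> \<partial>M)))"
  proof (rule Liminf_mono, rule always_eventually, rule allI)
    fix k
    have "(\<integral>\<^sup>+\<omega>. ennreal (g k \<omega> - m \<omega>) \<partial>M) = ennreal (\<integral>\<omega>. g k \<omega> - m \<omega> \<partial>M)"
      by (rule nn_integral_eq_integral) (use gi m in \<open>auto elim: eventually_mono\<close>)
    then show "(\<integral>\<^sup>+\<omega>. ennreal (g k \<omega> - m \<omega>) \<partial>M) \<le> ennreal (r - pairing M v (x k) - pairing M w (u k) - (\<integral>\<omega>. m \<omega> \<partial>M))"
      using gm[of k] by (simp add: ennreal_leI)
  qed
  also have "\<dots> = ennreal \<rho>"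
    by (rule lim_imp_Liminf) (use \<rho>lim in \<open>auto intro: tendsto_ennrealI\<close>)
  finally have Jint: "(\<integral>\<^sup>+\<omega>. J \<omega> \<partial>M) \<le> ennreal \<rho>" .
  have Jfin: "AE \<omega> in M. J \<omega> \<noteq> \<infinity>"
    by (rule nn_integral_PInf_AE) (use Jint in \<open>auto simp: top_unique\<close>)
  define j where "j \<omega> = enn2real (J \<omega>)" for \<omega>
  have jm: "j \<in> borel_measurable M" unfolding j_def[abs_def] by measurable
  have j0: "0 \<le> j \<omega>" for \<omega> by (simp add: j_def)
  have jnn: "(\<integral>\<^sup>+\<omega>. ennreal (j \<omega>) \<partial>M) \<le> ennreal \<rho>"
    by (rule order_trans[OF nn_integral_mono Jint]) (simp add: j_def ennreal_enn2real_le)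
  have ji: "integrable M j"
    by (rule integrableI_nonneg[OF jm]) (use le_less_trans[OF jnn] in \<open>simp_all add: j_def\<close>)
  have jint: "(\<integral>\<omega>. j \<omega> \<partial>M) \<le> \<rho>"
  proof -
    have "(\<integral>\<^sup>+\<omega>. ennreal (j \<omega>) \<partial>M) = ennreal (\<integral>\<omega>. j \<omega> \<partial>M)"
      by (rule nn_integral_eq_integral[OF ji]) (simp add: j0)
    then have "ennreal (\<integral>\<omega>. j \<omega> \<partial>M) \<le> ennreal \<rho>" using jnn by simp
    then show ?thesis using \<rho>0 by (simp add: ennreal_le_iff)
  qed
  have "AE \<omega> in M. \<forall>k. f (x k \<omega>) (u k \<omega>) \<omega> = ereal (h k \<omega>)" using h(2) by (simp add: AE_all_countable)
  then have "AE \<omega> in M. f (x' \<omega>) (u' \<omega>) \<omega> \<le> ereal (j \<omega> + m \<omega> + l x' u' \<omega>)"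
    using Jfin lx lu AE_space
  proof eventually_elim
    case (elim \<omega>)
    \<comment> \<open>A lower limit need not be reached, so a level \<open>b\<close> above it is met
      along a subsequence and lowered to \<open>j \<omega>\<close> at the end.\<close>
    have "f (x' \<omega>) (u' \<omega>) \<omega> \<le> ereal (b + m \<omega> + l x' u' \<omega>)" if b: "j \<omega> < b" for b
    proof -
      have "J \<omega> < ennreal b" using b elim(2) by (cases "J \<omega>") (auto simp: j_def ennreal_less_iff)
      then have ne: "\<not> eventually (\<lambda>k. ennreal b \<le> ennreal (g k \<omega> - m \<omega>)) sequentially"
        unfolding J_def using Liminf_bounded[of "ennreal b" "\<lambda>k. ennreal (g k \<omega> - m \<omega>)" sequentially]
        by (auto simp only: not_less[symmetric])
      from not_eventually_sequentiallyD[OF ne] obtain \<sigma> :: "nat \<Rightarrow> nat"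
        where \<sigma>: "strict_mono \<sigma>" "\<And>n. \<not> ennreal b \<le> ennreal (g (\<sigma> n) \<omega> - m \<omega>)" by (elim exE conjE) simp
      have less: "g (\<sigma> n) \<omega> \<le> b + m \<omega>" for n
        using \<sigma>(2)[of n] ennreal_leI[of b "g (\<sigma> n) \<omega> - m \<omega>"] by (cases "b \<le> g (\<sigma> n) \<omega> - m \<omega>") auto
      show ?thesis
      proof (rule integrand_closed[OF normal elim(5)])
        show "f (x (\<sigma> n) \<omega>) (u (\<sigma> n) \<omega>) \<omega> \<le> ereal (b + m \<omega> + l (x (\<sigma> n)) (u (\<sigma> n)) \<omega>)" for n
          using elim(1) less[of n] by (simp add: g_def)
        show xs: "(\<lambda>n. x (\<sigma> n) \<omega>) \<longlonglongrightarrow> x' \<omega>" using LIMSEQ_subseq_LIMSEQ[OF elim(3) \<sigma>(1)] by (simp add: o_def)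
        show us: "(\<lambda>n. u (\<sigma> n) \<omega>) \<longlonglongrightarrow> u' \<omega>" using LIMSEQ_subseq_LIMSEQ[OF elim(4) \<sigma>(1)] by (simp add: o_def)
        show "(\<lambda>n. b + m \<omega> + l (x (\<sigma> n)) (u (\<sigma> n)) \<omega>) \<longlonglongrightarrow> b + m \<omega> + l x' u' \<omega>"
          unfolding l_def by (intro tendsto_intros xs us)
      qed
    qed
    from this[of "j \<omega> + _"]
    have "f (x' \<omega>) (u' \<omega>) \<omega> \<le> ereal (j \<omega> + m \<omega> + l x' u' \<omega>) + ereal e" if "0 < e" for e
      using that by (simp add: add.commute add.left_commute)
    then show ?case by (rule ereal_le_epsilon2)
  qed
  then have "Ef x' u' \<le> ereal (\<integral>\<omega>. j \<omega> + m \<omega> + l x' u' \<omega> \<partial>M)"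
    unfolding integral_functional_def by (rule extended_integral_le[OF Bochner_Integration.integrable_add[OF
        Bochner_Integration.integrable_add[OF ji m(1)] li(1)[OF xu(3,4)]]])
  also have "(\<integral>\<omega>. j \<omega> + m \<omega> + l x' u' \<omega> \<partial>M) = (\<integral>\<omega>. j \<omega> \<partial>M) + (\<integral>\<omega>. m \<omega> \<partial>M) + (pairing M v x' + pairing M w u')"
    using ji m(1) li[OF xu(3,4)] by simp
  also have "\<dots> \<le> r" using jint by (simp add: \<rho>_def)
  finally show ?thesis by simp
qed

lemma Ef_lsc:
  assumes v: "v \<in> V" and w: "w \<in> Y"
    and minor: "\<And>x u. x \<in> X \<Longrightarrow> u \<in> U \<Longrightarrow> ereal (pairing M v x + pairing M w u - c) \<le> Ef x u"
    and xu: "\<And>k::nat. x k \<in> X" "\<And>k. u k \<in> U" "x' \<in> X" "u' \<in> U"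
    and le: "\<And>k. Ef (x k) (u k) \<le> ereal r"
    and lx: "(\<lambda>k. X.N (x k - x')) \<longlonglongrightarrow> 0" and lu: "(\<lambda>k. U.N (u k - u')) \<longlonglongrightarrow> 0"
  shows "Ef x' u' \<le> ereal r"
proof -
  obtain \<sigma> :: "nat \<Rightarrow> nat" where \<sigma>: "strict_mono \<sigma>" "AE \<omega> in M. (\<lambda>n. x (\<sigma> n) \<omega>) \<longlonglongrightarrow> x' \<omega>"
    using X.strong_convergence_AE_subseq[OF xu(1,3) lx] by blast
  have lu': "(\<lambda>k. U.N (u (\<sigma> k) - u')) \<longlonglongrightarrow> 0" using LIMSEQ_subseq_LIMSEQ[OF lu \<sigma>(1)] by (simp add: o_def)
  obtain \<tau> :: "nat \<Rightarrow> nat" where \<tau>: "strict_mono \<tau>" "AE \<omega> in M. (\<lambda>n. u (\<sigma> (\<tau> n)) \<omega>) \<longlonglongrightarrow> u' \<omega>"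
    using U.strong_convergence_AE_subseq[of "\<lambda>k. u (\<sigma> k)", OF xu(2,4) lu'] by blast
  show ?thesis
  proof (rule Ef_lsc_AE[where x = "\<lambda>k. x (\<sigma> (\<tau> k))" and u = "\<lambda>k. u (\<sigma> (\<tau> k))"])
    show "AE \<omega> in M. (\<lambda>k. x (\<sigma> (\<tau> k)) \<omega>) \<longlonglongrightarrow> x' \<omega>"
      using \<sigma>(2)
    proof eventually_elim
      case (elim \<omega>) then show ?case using LIMSEQ_subseq_LIMSEQ[OF elim \<tau>(1)] by (simp add: o_def)
    qed
    show "(\<lambda>k. pairing M v (x (\<sigma> (\<tau> k)))) \<longlonglongrightarrow> pairing M v x'"
      using LIMSEQ_subseq_LIMSEQ[OF LIMSEQ_subseq_LIMSEQ[OF X.dual_tendsto[OF X.pairing_dual[OF v] xu(1,3) lx] \<sigma>(1)] \<tau>(1)]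
      by (simp add: o_def)
    show "(\<lambda>k. pairing M w (u (\<sigma> (\<tau> k)))) \<longlonglongrightarrow> pairing M w u'"
      using LIMSEQ_subseq_LIMSEQ[OF LIMSEQ_subseq_LIMSEQ[OF U.dual_tendsto[OF U.pairing_dual[OF w] xu(2,4) lu] \<sigma>(1)] \<tau>(1)]
      by (simp add: o_def)
  qed (fact v w minor xu le \<tau>(2))+
qed

end

section \<open>Multipliers for the constraint on the parameter\<close>

context rv_duality
begin

lemma V_add: "v \<in> V \<Longrightarrow> v' \<in> V \<Longrightarrow> v + v' \<in> V"
  using subspace_V by (auto simp: subspace_def)

lemma V_proj: assumes "v \<in> V" shows "proj I v \<in> V"
proof -
  have "(\<lambda>\<omega>. if i \<in> I then v \<omega> $ i else 0) \<in> borel_measurable M" for i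
    using measurable_vec_nth[OF meas_V[OF assms]] by (cases "i \<in> I") auto
  then have "proj I v \<in> borel_measurable M" unfolding proj_def by (rule measurable_vec_lambda)
  moreover have "\<forall>i. AE \<omega> in M. \<bar>proj I v \<omega> $ i\<bar> \<le> \<bar>v \<omega> $ i\<bar>" by simp
  ultimately show ?thesis using solidV[unfolded solid_def, rule_format, OF assms] by blast
qed

lemma closedin_sequentially:
  assumes L: "closedin S L" and a: "\<And>n::nat. a n \<in> L" and x: "x \<in> X" and lim: "(\<lambda>n. N (a n - x)) \<longlonglongrightarrow> 0"
  shows "x \<in> L"
proof (rule ccontr)
  assume "x \<notin> L"
  then have "x \<in> X - L" using x by blast
  moreover have "openin S (X - L)" using L topspace by (auto simp: closedin_def)
  ultimately have "\<exists>e>0. \<forall>y\<in>X. N (y - x) < e \<longrightarrow> y \<in> X - L" by (intro ball_in_open)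
  then obtain e where e: "e > 0" "\<And>y. y \<in> X \<Longrightarrow> N (y - x) < e \<Longrightarrow> y \<in> X - L" by blast
  have "\<forall>\<^sub>F n in sequentially. N (a n - x) < e" using order_tendstoD(2)[OF lim e(1)] .
  then obtain n where "N (a n - x) < e" using eventually_happens'[OF sequentially_bot] by blast
  moreover have "a n \<in> X" using a closedin_subset[OF L] topspace by blast
  ultimately show False using e(2) a by blast
qed

lemma closed_subspace_complete:
  assumes L: "closedin S L" "subspace L"
  shows "complete_F_seminorm L N"
proof -
  have LX: "L \<subseteq> X" using closedin_subset[OF L(1)] topspace by simp
  show ?thesis
  proof
    show "\<exists>d>0. \<forall>x\<in>L. N x < d \<longrightarrow> N (c *\<^sub>R x) < e" if "0 < e" for e c
      using F.scale[OF that, of c] LX by blast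
    show "\<exists>x\<in>L. (\<lambda>k. N (s k - x)) \<longlonglongrightarrow> 0"
      if s: "\<And>n::nat. s n \<in> L" "\<And>e. 0 < e \<Longrightarrow> \<exists>K. \<forall>j\<ge>K. \<forall>k\<ge>K. N (s j - s k) < e" for s
    proof -
      have "\<exists>x\<in>X. (\<lambda>k. N (s k - x)) \<longlonglongrightarrow> 0" using s LX by (intro F.complete) blast+
      then obtain x where x: "x \<in> X" "(\<lambda>k. N (s k - x)) \<longlonglongrightarrow> 0" by blast
      have "x \<in> L" by (rule closedin_sequentially[OF L(1) s(1) x])
      then show ?thesis using x(2) by blast
    qed
    show "N (x + y) \<le> N x + N y" if "x \<in> L" "y \<in> L" for x y using F.triangle that LX by blast
  qed (use LX F.nonneg F.minus F.scale_zero L(2) in auto)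
qed

end

context integrand_duality
begin

abbreviation dom where "dom \<equiv> dom_Ef M f X U"

lemma dom_iff: "(x, u) \<in> dom \<longleftrightarrow> x \<in> X \<and> u \<in> U \<and> Ef x u < \<infinity>"
  by (auto simp: dom_Ef_def)

text \<open>Lagrange duality for maximizing \<open>q\<close> over \<open>dom\<close> subject to
  \<open>u = ub\<close>. The minorant makes \<open>Ef\<close> strongly lower semicontinuous;
  Robinson--Ursescu on the complete space \<open>L\<close> then bounds the perturbed optimal value
  from below near \<open>0\<close>. One separation in \<open>U\<close> yields the multiplier
  together with its continuity.\<close>

lemma constraint_multiplier:
  assumes v: "v \<in> V" and w: "w \<in> Y"
    and minor: "\<And>x u. x \<in> X \<Longrightarrow> u \<in> U \<Longrightarrow> ereal (pairing M v x + pairing M w u - c) \<le> Ef x u"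
    and ub: "ub \<in> U" and q: "q \<in> top_dual SX"
    and linear: "subspace (pos_hull ((\<lambda>u. u - ub) ` snd ` dom))"
    and closed: "closedin SU (pos_hull ((\<lambda>u. u - ub) ` snd ` dom))"
    and bound: "\<And>x. (x, ub) \<in> dom \<Longrightarrow> q x \<le> b"
  obtains y where "y \<in> top_dual SU" "\<And>x u. (x, u) \<in> dom \<Longrightarrow> q x + y (u - ub) \<le> b"
proof -
  define L where "L = pos_hull ((\<lambda>u. u - ub) ` snd ` dom)"
  have L: "subspace L" "closedin SU L" using linear closed by (simp_all add: L_def)
  have LU: "L \<subseteq> U" using closedin_subset[OF L(2)] U.topspace by simp
  have L_iff: "z \<in> L \<longleftrightarrow> (\<exists>a>0. \<exists>x u. (x, u) \<in> dom \<and> z = a *\<^sub>R (u - ub))" for z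
    unfolding L_def pos_hull_def by force
  have dom_real: "\<exists>e. Ef x u = ereal e" if "(x, u) \<in> dom" for x u
    using that minor[of x u] unfolding dom_iff by (cases "Ef x u") auto
  have le_real: "\<exists>e\<le>a. Ef x u = ereal e" if "x \<in> X" "u \<in> U" "Ef x u \<le> ereal a" for x u a
    using that minor[of x u] by (cases "Ef x u") auto
  have convex_le: "Ef ((1 - t) *\<^sub>R x + t *\<^sub>R x') ((1 - t) *\<^sub>R u + t *\<^sub>R u') \<le> ereal ((1 - t) * a + t * a')"
    if xu: "x \<in> X" "u \<in> U" "x' \<in> X" "u' \<in> U" and a: "Ef x u \<le> ereal a" "Ef x' u' \<le> ereal a'" and t: "0 \<le> t" "t \<le> 1"
    for x u x' u' a a' t
  proof -
    obtain e e' where e: "e \<le> a" "Ef x u = ereal e" "e' \<le> a'" "Ef x' u' = ereal e'"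
      using le_real[OF xu(1,2) a(1)] le_real[OF xu(3,4) a(2)] by blast
    have "ereal ((1 - t) * e + t * e') \<le> ereal ((1 - t) * a + t * a')"
      using e t by (simp add: add_mono mult_left_mono)
    then show ?thesis using Ef_convex[OF xu e(2,4) t] by (rule order_trans[rotated])
  qed
  have dom_convex: "((1 - t) *\<^sub>R x + t *\<^sub>R x', (1 - t) *\<^sub>R u + t *\<^sub>R u') \<in> dom"
    if d: "(x, u) \<in> dom" "(x', u') \<in> dom" and t: "0 \<le> t" "t \<le> 1" for x u x' u' t
  proof -
    have xu: "x \<in> X" "u \<in> U" "x' \<in> X" "u' \<in> U" using d by (auto simp: dom_iff)
    obtain e e' where e: "Ef x u = ereal e" "Ef x' u' = ereal e'" using dom_real d by blast
    have "Ef ((1 - t) *\<^sub>R x + t *\<^sub>R x') ((1 - t) *\<^sub>R u + t *\<^sub>R u') < \<infinity>"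
      by (rule le_less_trans[OF Ef_convex[OF xu e t]]) simp
    then show ?thesis using xu X.X_add X.X_scale U.X_add U.X_scale by (simp add: dom_iff)
  qed
  obtain x\<^sub>0 where x0: "(x\<^sub>0, ub) \<in> dom"
  proof -
    have "0 \<in> L" using L(1) by (simp add: subspace_def)
    then obtain a x u where "a > 0" "(x, u) \<in> dom" "0 = a *\<^sub>R (u - ub)" unfolding L_iff by blast
    then have "(x, ub) \<in> dom" by simp
    then show thesis by (rule that)
  qed
  then have x0X: "x\<^sub>0 \<in> X" by (simp add: dom_iff)
  obtain r where r: "Ef x\<^sub>0 ub = ereal r" using dom_real[OF x0] by blast
  \<comment> \<open>A level set instead of \<open>dom\<close> itself: \<open>dom\<close> need not be
    closed, the level set is, and the slack 1 above the value at \<open>x\<^sub>0\<close> keeps it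
    absorbing.\<close>
  define \<Gamma> where "\<Gamma> = {(x, z). x \<in> X \<and> z \<in> L \<and> Ef (x\<^sub>0 + x) (ub + z) \<le> ereal (r + 1)}"
  obtain e where e: "e > 0" "\<And>x. x \<in> X \<Longrightarrow> X.N x < e \<Longrightarrow> \<bar>q x\<bar> < 1"
    using X.dual_small[OF q, of 1] zero_less_one by blast
  have "\<exists>d>0. \<forall>z\<in>L. U.N z < d \<longrightarrow> (\<exists>x. X.N x < e \<and> (x, z) \<in> \<Gamma>)"
  proof (rule convex_relation_open[OF X.frechet U.closed_subspace_complete[OF L(2,1)] _ _ _ _ _ e(1)])
    show "convex \<Gamma>"
    proof (rule convexI)
      fix p p' and a t :: real assume p: "p \<in> \<Gamma>" "p' \<in> \<Gamma>" and at: "0 \<le> a" "0 \<le> t" "a + t = 1"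
      obtain x z x' z' where pp: "p = (x, z)" "p' = (x', z')" by (metis surj_pair)
      have xz: "x \<in> X" "z \<in> L" "Ef (x\<^sub>0 + x) (ub + z) \<le> ereal (r + 1)"
        "x' \<in> X" "z' \<in> L" "Ef (x\<^sub>0 + x') (ub + z') \<le> ereal (r + 1)"
        using p by (auto simp: pp \<Gamma>_def)
      have a: "a = 1 - t" using at by simp
      have "Ef ((1 - t) *\<^sub>R (x\<^sub>0 + x) + t *\<^sub>R (x\<^sub>0 + x')) ((1 - t) *\<^sub>R (ub + z) + t *\<^sub>R (ub + z')) \<le>
          ereal ((1 - t) * (r + 1) + t * (r + 1))"
        by (rule convex_le) (use xz at LU x0X ub X.X_add U.X_add in auto)
      moreover have "(1 - t) *\<^sub>R (x\<^sub>0 + x) + t *\<^sub>R (x\<^sub>0 + x') = x\<^sub>0 + ((1 - t) *\<^sub>R x + t *\<^sub>R x')"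
        "(1 - t) *\<^sub>R (ub + z) + t *\<^sub>R (ub + z') = ub + ((1 - t) *\<^sub>R z + t *\<^sub>R z')"
        by (simp_all add: fun_eq_iff algebra_simps)
      moreover have "(1 - t) * (r + 1) + t * (r + 1) = r + 1" by (simp add: algebra_simps)
      moreover have "(1 - t) *\<^sub>R z + t *\<^sub>R z' \<in> L" using xz L(1) by (simp add: subspace_add subspace_scale)
      ultimately show "a *\<^sub>R p + t *\<^sub>R p' \<in> \<Gamma>" using xz X.X_add X.X_scale by (simp add: pp a \<Gamma>_def)
    qed
    show "\<Gamma> \<subseteq> X \<times> L" by (auto simp: \<Gamma>_def)
    show "(0, 0) \<in> \<Gamma>" using X.X_0 L(1) r by (simp add: \<Gamma>_def subspace_0)
    show "\<exists>a>0. \<exists>x. (x, a *\<^sub>R z) \<in> \<Gamma>" if z: "z \<in> L" for z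
    proof -
      obtain a x u where a: "a > 0" "(x, u) \<in> dom" "z = a *\<^sub>R (u - ub)" using z unfolding L_iff by blast
      obtain r' where r': "Ef x u = ereal r'" using dom_real[OF a(2)] by blast
      have xu: "x \<in> X" "u \<in> U" using a(2) by (auto simp: dom_iff)
      \<comment> \<open>Makes the value of the convex combination exceed the value \<open>r\<close>
        of the base point by at most 1.\<close>
      define t where "t = 1 / (1 + \<bar>r' - r\<bar>)"
      have t: "0 < t" "t \<le> 1" "t * \<bar>r' - r\<bar> \<le> 1" by (auto simp: t_def field_simps)
      have "t * (r' - r) \<le> t * \<bar>r' - r\<bar>" using t(1) by (intro mult_left_mono) auto
      then have tr: "(1 - t) * r + t * r' \<le> r + 1" using t(3) by (simp add: algebra_simps)
      have "Ef ((1 - t) *\<^sub>R x\<^sub>0 + t *\<^sub>R x) ((1 - t) *\<^sub>R ub + t *\<^sub>R u) \<le> ereal ((1 - t) * r + t * r')"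
        by (rule Ef_convex) (use x0X ub xu r r' t in auto)
      also have "\<dots> \<le> ereal (r + 1)" using tr by simp
      finally have "Ef ((1 - t) *\<^sub>R x\<^sub>0 + t *\<^sub>R x) ((1 - t) *\<^sub>R ub + t *\<^sub>R u) \<le> ereal (r + 1)" .
      moreover have "(1 - t) *\<^sub>R x\<^sub>0 + t *\<^sub>R x = x\<^sub>0 + t *\<^sub>R (x - x\<^sub>0)"
        "(1 - t) *\<^sub>R ub + t *\<^sub>R u = ub + (t / a) *\<^sub>R z"
        using a(1) by (simp_all add: fun_eq_iff a(3) algebra_simps)
      moreover have "(t / a) *\<^sub>R z \<in> L" using z L(1) by (simp add: subspace_scale)
      ultimately have "(t *\<^sub>R (x - x\<^sub>0), (t / a) *\<^sub>R z) \<in> \<Gamma>"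
        using X.X_scale[OF X.X_diff[OF xu(1) x0X]] by (simp add: \<Gamma>_def)
      then show ?thesis using t(1) a(1) by (intro exI[of _ "t / a"]) auto
    qed
    fix x z x' z' assume xz: "\<And>n::nat. (x n, z n) \<in> \<Gamma>" and x': "x' \<in> X" and z': "z' \<in> L"
      and lx: "(\<lambda>n. X.N (x n - x')) \<longlonglongrightarrow> 0" and lz: "(\<lambda>n. U.N (z n - z')) \<longlonglongrightarrow> 0"
    have xzn: "x n \<in> X" "z n \<in> L" "Ef (x\<^sub>0 + x n) (ub + z n) \<le> ereal (r + 1)" for n using xz[of n] by (auto simp: \<Gamma>_def)
    have "Ef (x\<^sub>0 + x') (ub + z') \<le> ereal (r + 1)"
    proof (rule Ef_lsc[where x = "\<lambda>n. x\<^sub>0 + x n" and u = "\<lambda>n. ub + z n" and v = v and w = w and c = c])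
      show "(\<lambda>n. X.N (x\<^sub>0 + x n - (x\<^sub>0 + x'))) \<longlonglongrightarrow> 0" using lx by simp
      show "(\<lambda>n. U.N (ub + z n - (ub + z'))) \<longlonglongrightarrow> 0" using lz by simp
      show "x\<^sub>0 + x n \<in> X" "ub + z n \<in> U" for n using xzn[of n] LU x0X ub X.X_add U.X_add by auto
      show "x\<^sub>0 + x' \<in> X" "ub + z' \<in> U" using x' z' LU x0X ub X.X_add U.X_add by auto
    qed (fact v w minor xzn(3))+
    then show "(x', z') \<in> \<Gamma>" using x' z' by (simp add: \<Gamma>_def)
  qed
  then obtain d where d: "d > 0" "\<And>z. z \<in> L \<Longrightarrow> U.N z < d \<Longrightarrow> \<exists>x. X.N x < e \<and> (x, z) \<in> \<Gamma>" by blast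
  have near: "\<exists>x. (x, ub + z) \<in> dom \<and> q x\<^sub>0 - 1 \<le> q x" if z: "z \<in> L" "U.N z < d" for z
  proof -
    obtain x where x: "X.N x < e" "(x, z) \<in> \<Gamma>" using d(2)[OF z] by blast
    then have xX: "x \<in> X" and le: "Ef (x\<^sub>0 + x) (ub + z) \<le> ereal (r + 1)" by (auto simp: \<Gamma>_def)
    have "Ef (x\<^sub>0 + x) (ub + z) < \<infinity>" by (rule le_less_trans[OF le]) simp
    then have "(x\<^sub>0 + x, ub + z) \<in> dom" using xX x0X X.X_add ub z LU U.X_add by (auto simp: dom_iff)
    moreover have "q x\<^sub>0 - 1 \<le> q (x\<^sub>0 + x)" using e(2)[OF xX x(1)] X.dual_add[OF q x0X xX] by simp
    ultimately show ?thesis by blast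
  qed
  from U.F.locally_convex[OF d(1)] obtain C \<delta> where C: "convex C" "C \<subseteq> U" "0 < \<delta>"
    "\<And>z. z \<in> U \<Longrightarrow> U.N z < \<delta> \<Longrightarrow> z \<in> C" "\<And>z. z \<in> C \<Longrightarrow> U.N z < d" by blast
  have C0: "0 \<in> C" using C(3,4) U.X_0 U.F.zero by simp
  \<comment> \<open>\<open>K\<close> bounds \<open>b - q x\<close> for the points \<open>x\<close>
    supplied by \<open>near\<close>, and will control the multiplier on \<open>C\<close>.\<close>
  define K where "K = b - q x\<^sub>0 + 1"
  have K: "K > 0" using bound[OF x0] by (simp add: K_def)
  \<comment> \<open>Sums of positive multiples of the pairs \<open>(b - q x, u - ub)\<close> over
    \<open>dom\<close> and of the pairs \<open>(K, k)\<close> over \<open>C\<close>. A linear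
    functional below this cone is a multiplier because of the first kind and continuous because of
    the second.\<close>
  define Q where "Q a z \<longleftrightarrow> (\<exists>\<alpha>>0. \<exists>\<mu>>0. \<exists>x u. \<exists>k\<in>C. (x, u) \<in> dom \<and>
      a = \<alpha> * (b - q x) + K * \<mu> \<and> z = \<alpha> *\<^sub>R (u - ub) + \<mu> *\<^sub>R k)" for a z
  have QI: "Q (\<alpha> * (b - q x) + K * \<mu>) (\<alpha> *\<^sub>R (u - ub) + \<mu> *\<^sub>R k)"
    if "\<alpha> > 0" "\<mu> > 0" "(x, u) \<in> dom" "k \<in> C" for \<alpha> \<mu> x u k
    using that unfolding Q_def by blast
  have "\<exists>l. linear l \<and> (\<forall>a z. z \<in> U \<longrightarrow> Q a z \<longrightarrow> l z \<le> a)"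
  proof (rule Hahn_Banach_cone[OF U.subspace_X, of Q])
    fix a a' z z' assume "Q a z" "Q a' z'"
    then obtain \<alpha> \<mu> x u k \<alpha>' \<mu>' x' u' k' where 1: "\<alpha> > 0" "\<mu> > 0" "k \<in> C" "(x, u) \<in> dom" "a = \<alpha> * (b - q x) + K * \<mu>"
        "z = \<alpha> *\<^sub>R (u - ub) + \<mu> *\<^sub>R k"
      and 2: "\<alpha>' > 0" "\<mu>' > 0" "k' \<in> C" "(x', u') \<in> dom" "a' = \<alpha>' * (b - q x') + K * \<mu>'"
        "z' = \<alpha>' *\<^sub>R (u' - ub) + \<mu>' *\<^sub>R k'" unfolding Q_def by blast
    define t where "t = \<alpha>' / (\<alpha> + \<alpha>')"
    define \<tau> where "\<tau> = \<mu>' / (\<mu> + \<mu>')"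
    have t: "0 \<le> t" "t \<le> 1" "(\<alpha> + \<alpha>') * t = \<alpha>'" "(\<alpha> + \<alpha>') * (1 - t) = \<alpha>" using 1 2 by (auto simp: t_def field_simps)
    have \<tau>: "0 \<le> \<tau>" "\<tau> \<le> 1" "(\<mu> + \<mu>') * \<tau> = \<mu>'" "(\<mu> + \<mu>') * (1 - \<tau>) = \<mu>" using 1 2 by (auto simp: \<tau>_def field_simps)
    have xX: "x \<in> X" "x' \<in> X" using 1 2 by (auto simp: dom_iff)
    have "Q ((\<alpha> + \<alpha>') * (b - q ((1 - t) *\<^sub>R x + t *\<^sub>R x')) + K * (\<mu> + \<mu>'))
      ((\<alpha> + \<alpha>') *\<^sub>R (((1 - t) *\<^sub>R u + t *\<^sub>R u') - ub) + (\<mu> + \<mu>') *\<^sub>R ((1 - \<tau>) *\<^sub>R k + \<tau> *\<^sub>R k'))"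
      by (rule QI) (use 1 2 t \<tau> dom_convex convexD[OF C(1)] in auto)
    moreover have "(\<alpha> + \<alpha>') * (b - q ((1 - t) *\<^sub>R x + t *\<^sub>R x')) + K * (\<mu> + \<mu>') = a + a'"
    proof -
      have qe: "q ((1 - t) *\<^sub>R x + t *\<^sub>R x') = (1 - t) * q x + t * q x'"
        using X.dual_add[OF q X.X_scale[OF xX(1)] X.X_scale[OF xX(2)]] X.dual_scale[OF q xX(1)] X.dual_scale[OF q xX(2)] by simp
      have "(\<alpha> + \<alpha>') * (b - q ((1 - t) *\<^sub>R x + t *\<^sub>R x')) =
          (\<alpha> + \<alpha>') * b - ((\<alpha> + \<alpha>') * (1 - t)) * q x - ((\<alpha> + \<alpha>') * t) * q x'" unfolding qe by (simp add: algebra_simps)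
      then show ?thesis unfolding t(3,4) 1(5) 2(5) by (simp add: algebra_simps)
    qed
    moreover have "(\<alpha> + \<alpha>') *\<^sub>R (((1 - t) *\<^sub>R u + t *\<^sub>R u') - ub) + (\<mu> + \<mu>') *\<^sub>R ((1 - \<tau>) *\<^sub>R k + \<tau> *\<^sub>R k') = z + z'"
    proof -
      have "(\<alpha> + \<alpha>') *\<^sub>R (((1 - t) *\<^sub>R u + t *\<^sub>R u') - ub) + (\<mu> + \<mu>') *\<^sub>R ((1 - \<tau>) *\<^sub>R k + \<tau> *\<^sub>R k') =
        ((\<alpha> + \<alpha>') * (1 - t)) *\<^sub>R u + ((\<alpha> + \<alpha>') * t) *\<^sub>R u' - (\<alpha> + \<alpha>') *\<^sub>R ub +
        (((\<mu> + \<mu>') * (1 - \<tau>)) *\<^sub>R k + ((\<mu> + \<mu>') * \<tau>) *\<^sub>R k')"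
        by (simp only: scaleR_diff_right scaleR_add_right scaleR_scaleR)
      then show ?thesis unfolding t(3,4) \<tau>(3,4) 1(6) 2(6)
        by (simp add: scaleR_diff_right scaleR_add_left)
    qed
    ultimately show "Q (a + a') (z + z')" by simp
  next
    fix a z and s :: real assume "Q a z" and s: "0 < s"
    then obtain \<alpha> \<mu> x u k where 1: "\<alpha> > 0" "\<mu> > 0" "k \<in> C" "(x, u) \<in> dom" "a = \<alpha> * (b - q x) + K * \<mu>"
        "z = \<alpha> *\<^sub>R (u - ub) + \<mu> *\<^sub>R k" unfolding Q_def by blast
    have "Q ((s * \<alpha>) * (b - q x) + K * (s * \<mu>)) ((s * \<alpha>) *\<^sub>R (u - ub) + (s * \<mu>) *\<^sub>R k)"
      by (rule QI) (use 1 s in auto)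
    then show "Q (s * a) (s *\<^sub>R z)" unfolding 1(5,6) by (simp add: algebra_simps)
  next
    fix z assume z: "z \<in> U"
    obtain s where s: "s > 0" "\<And>t. \<bar>t\<bar> < s \<Longrightarrow> U.N (t *\<^sub>R z) < \<delta>" using U.F.scale_zero[OF z C(3)] by blast
    have "(s / 2) *\<^sub>R z \<in> C" using C(4)[OF U.X_scale[OF z]] s(1) s(2)[of "s / 2"] by simp
    then have "Q (1 * (b - q x\<^sub>0) + K * (2 / s)) (1 *\<^sub>R (ub - ub) + (2 / s) *\<^sub>R ((s / 2) *\<^sub>R z))"
      by (intro QI x0) (use s in auto)
    then show "\<exists>a. Q a z" using s(1) by auto
  next
    \<comment> \<open>If the two contributions cancel, \<open>k\<close> is a negative multiple of
      \<open>u - ub\<close> and lies in \<open>L\<close> because \<open>L\<close> is linear. Then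
      \<open>near\<close> supplies a point of \<open>dom\<close> at \<open>ub + k\<close>, and
      mixing it with \<open>(x, u)\<close> returns to the parameter \<open>ub\<close>, where
      \<open>bound\<close> applies.\<close>
    fix a assume "Q a 0"
    then obtain \<alpha> \<mu> x u k where 1: "\<alpha> > 0" "\<mu> > 0" "k \<in> C" "(x, u) \<in> dom" "a = \<alpha> * (b - q x) + K * \<mu>"
        "0 = \<alpha> *\<^sub>R (u - ub) + \<mu> *\<^sub>R k" unfolding Q_def by blast
    have k: "k = (- (\<alpha> / \<mu>)) *\<^sub>R (u - ub)"
    proof -
      have "\<mu> *\<^sub>R k = (- \<alpha>) *\<^sub>R (u - ub)" using 1(6) by (metis add_eq_0_iff scaleR_minus_left)
      then have "(1 / \<mu>) *\<^sub>R (\<mu> *\<^sub>R k) = (1 / \<mu>) *\<^sub>R ((- \<alpha>) *\<^sub>R (u - ub))" by (rule arg_cong)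
      then show ?thesis using 1(2) by simp
    qed
    have "1 *\<^sub>R (u - ub) \<in> L" unfolding L_iff using 1(4) zero_less_one by blast
    then have "k \<in> L" unfolding k by (intro subspace_scale[OF L(1)]) simp
    then obtain x' where x': "(x', ub + k) \<in> dom" "q x\<^sub>0 - 1 \<le> q x'" using near C(5)[OF 1(3)] by blast
    define t where "t = \<mu> / (\<alpha> + \<mu>)"
    have t: "0 \<le> t" "t \<le> 1" "(\<alpha> + \<mu>) * t = \<mu>" "(\<alpha> + \<mu>) * (1 - t) = \<alpha>" using 1 by (auto simp: t_def field_simps)
    have xX: "x \<in> X" "x' \<in> X" using 1 x' by (auto simp: dom_iff)
    have "(1 - t) *\<^sub>R u + t *\<^sub>R (ub + k) = ub"
    proof -
      have "(1 - t) = t * (\<alpha> / \<mu>)" using 1 by (simp add: t_def field_simps)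
      then have "t *\<^sub>R k = (- (1 - t)) *\<^sub>R (u - ub)" unfolding k by simp
      then have "(1 - t) *\<^sub>R u + t *\<^sub>R (ub + k) = (1 - t) *\<^sub>R u + (t *\<^sub>R ub + (- (1 - t)) *\<^sub>R (u - ub))"
        by (simp only: scaleR_add_right)
      also have "\<dots> = ub" by (simp add: fun_eq_iff algebra_simps)
      finally show ?thesis .
    qed
    then have "((1 - t) *\<^sub>R x + t *\<^sub>R x', ub) \<in> dom" using dom_convex[OF 1(4) x'(1) t(1,2)] by simp
    then have "q ((1 - t) *\<^sub>R x + t *\<^sub>R x') \<le> b" by (rule bound)
    then have "(1 - t) * q x + t * q x' \<le> b"
      using X.dual_add[OF q X.X_scale[OF xX(1)] X.X_scale[OF xX(2)]] X.dual_scale[OF q xX(1)] X.dual_scale[OF q xX(2)] by simp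
    then have "(\<alpha> + \<mu>) * ((1 - t) * q x + t * q x') \<le> (\<alpha> + \<mu>) * b" using 1 by (intro mult_left_mono) auto
    then have "((\<alpha> + \<mu>) * (1 - t)) * q x + ((\<alpha> + \<mu>) * t) * q x' \<le> (\<alpha> + \<mu>) * b" by (simp add: algebra_simps)
    then have 3: "\<alpha> * q x + \<mu> * q x' \<le> (\<alpha> + \<mu>) * b" unfolding t(3,4) .
    have "\<mu> * (q x\<^sub>0 - 1) \<le> \<mu> * q x'" using x'(2) 1(2) by (intro mult_left_mono) auto
    then show "0 \<le> a" using 3 unfolding 1(5) K_def by (simp add: algebra_simps)
  qed blast
  then obtain l where l: "linear l" "\<And>a z. z \<in> U \<Longrightarrow> Q a z \<Longrightarrow> l z \<le> a" by blast
  have small: "l z \<le> (b - q x\<^sub>0) + K" if z: "z \<in> U" "U.N z < \<delta>" for z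
  proof -
    have "Q (1 * (b - q x\<^sub>0) + K * 1) (1 *\<^sub>R (ub - ub) + 1 *\<^sub>R z)"
      by (intro QI x0 C(4) z) auto
    then show ?thesis using l(2)[OF z(1)] by simp
  qed
  have "l \<in> top_dual SU" unfolding U.top_dual_iff
  proof (intro conjI ballI allI exI)
    show "0 < \<delta>" by fact
    show "U.N z < \<delta> \<longrightarrow> \<bar>l z\<bar> \<le> (b - q x\<^sub>0) + K" if z: "z \<in> U" for z
    proof
      assume "U.N z < \<delta>"
      then have "l z \<le> (b - q x\<^sub>0) + K" "l (- z) \<le> (b - q x\<^sub>0) + K"
        using small[OF z] small[OF U.X_minus[OF z]] U.F.minus[OF z] by auto
      then show "\<bar>l z\<bar> \<le> (b - q x\<^sub>0) + K" using linear_neg[OF l(1), of z] by simp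
    qed
  qed (use l(1) in \<open>simp_all add: linear_add linear_scale\<close>)
  moreover have "q x + l (u - ub) \<le> b" if xu: "(x, u) \<in> dom" for x u
  proof -
    have "l (u - ub) \<le> (b - q x)"
    proof (rule field_le_epsilon)
      fix \<epsilon> :: real assume "0 < \<epsilon>"
      \<comment> \<open>The cone demands a positive multiple of some point of \<open>C\<close>;
        taking the point \<open>0\<close> meets this at the cost \<open>\<epsilon>\<close>.\<close>
      then have "Q (1 * (b - q x) + K * (\<epsilon> / K)) (1 *\<^sub>R (u - ub) + (\<epsilon> / K) *\<^sub>R 0)"
        using K by (intro QI xu C0) auto
      then have "Q (b - q x + \<epsilon>) (u - ub)" using K by simp
      moreover have "u - ub \<in> U" using xu ub U.X_diff by (simp add: dom_iff)
      ultimately show "l (u - ub) \<le> b - q x + \<epsilon>" using l(2) by blast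
    qed
    then show ?thesis by simp
  qed
  ultimately show thesis by (rule that)
qed

end

section \<open>Nonanticipativity\<close>

locale adapted_program = integrand_duality M X V SX dX U Y SU dU f
  for M :: "'w measure" and X V :: "('w \<Rightarrow> real^'n::finite) set" and SX dX
    and U Y :: "('w \<Rightarrow> real^'m::finite) set" and SU dU f +
  fixes F :: "nat \<Rightarrow> 'w measure" and T :: nat and stage :: "'n \<Rightarrow> nat" and ubar :: "'w \<Rightarrow> real^'m"
  assumes filtration: "filtration_upto M F T" and stage: "\<And>i. stage i \<le> T"
    and cond_expect_X: "\<And>t x. t \<le> T \<Longrightarrow> x \<in> X \<Longrightarrow> cond_expect M (F t) x \<in> X"
    and ubar: "ubar \<in> U"
    and pos_linear: "subspace (pos_hull ((\<lambda>u. u - ubar) ` snd ` dom))"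
    and pos_closed: "closedin SU (pos_hull ((\<lambda>u. u - ubar) ` snd ` dom))"
    and adapted_feasible: "\<And>t z. t \<le> T \<Longrightarrow> z \<in> X \<Longrightarrow> (z, ubar) \<in> dom \<Longrightarrow>
      \<exists>zbar\<in>X. (zbar, ubar) \<in> dom \<and>
         (\<forall>i. stage i \<le> t \<longrightarrow> (AE \<omega> in M. zbar \<omega> $ i = cond_expect M (F t) z \<omega> $ i))"
begin

abbreviation Xa where "Xa \<equiv> X \<inter> adapted M F stage"

lemma subalgebra: "t \<le> T \<Longrightarrow> subalgebra M (F t)"
  and subalgebra_mono: "s \<le> t \<Longrightarrow> t \<le> T \<Longrightarrow> subalgebra (F t) (F s)"
  using filtration by (auto simp: filtration_upto_def)

text \<open>Linearity in hypothesis (1) puts \<open>0\<close> into the cone, which already means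
  that \<open>ubar\<close> is feasible.\<close>

lemma feasible_point: obtains x where "(x, ubar) \<in> dom"
proof -
  have "0 \<in> pos_hull ((\<lambda>u. u - ubar) ` snd ` dom)" using pos_linear by (simp add: subspace_def)
  then obtain a x u where "a > 0" "(x, u) \<in> dom" "0 = a *\<^sub>R (u - ubar)" unfolding pos_hull_def by force
  then have "(x, ubar) \<in> dom" by simp
  then show thesis by (rule that)
qed

text \<open>Says that the conjugate of \<open>Ef\<close> at \<open>(p, y)\<close> is at most
  \<open>c\<close>, with a real constant and without extended subtraction.\<close>

definition minorizes :: "(('w \<Rightarrow> real^'n) \<Rightarrow> real) \<Rightarrow> (('w \<Rightarrow> real^'m) \<Rightarrow> real) \<Rightarrow> real \<Rightarrow> bool" where
  "minorizes p y c \<longleftrightarrow> (\<forall>x\<in>X. \<forall>u\<in>U. ereal (p x + y u - c) \<le> Ef x u)"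

lemma minorizes_iff_dom: "minorizes p y c \<longleftrightarrow> (\<forall>(x, u)\<in>dom. ereal (p x + y u - c) \<le> Ef x u)"
  unfolding minorizes_def dom_Ef_def by (auto simp: not_less top_unique) (metis ereal_less_eq(1) less_ereal.simps(4) neq_iff not_le)

lemma minorizes_real: "minorizes p y c \<Longrightarrow> (x, u) \<in> dom \<Longrightarrow> \<exists>e. Ef x u = ereal e \<and> p x + y u - c \<le> e"
  unfolding minorizes_def dom_iff by (cases "Ef x u") force+

text \<open>\<open>singular_part_separates\<close> takes its two pairs from \<open>dom\<close>
  independently. With one pair fixed, the supremum over the other is finite; it serves as
  \<open>c\<^sub>1\<close>, the value of the conjugate at the absolutely continuous part, and
  \<open>c - c\<^sub>1\<close> is left for the singular one.\<close>

lemma singular_part_support: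
  assumes v: "v \<in> V" and w: "w \<in> Y" and s: "s \<in> singular_dual M SX" and r: "r \<in> singular_dual M SU"
    and minor: "minorizes (\<lambda>x. pairing M v x + s x) (\<lambda>u. pairing M w u + r u) c"
  obtains c\<^sub>1 where "minorizes (pairing M v) (pairing M w) c\<^sub>1"
    "\<And>x u. (x, u) \<in> dom \<Longrightarrow> s x + r u \<le> c - c\<^sub>1"
proof -
  define B where "B = {pairing M v x + pairing M w u - e | x u e. (x, u) \<in> dom \<and> Ef x u = ereal e}"
  have sep: "b + (s x + r u) \<le> c" if b: "b \<in> B" and xu: "(x, u) \<in> dom" for b x u
  proof -
    obtain x' u' e' where b': "b = pairing M v x' + pairing M w u' - e'" "(x', u') \<in> dom" "Ef x' u' = ereal e'"
      using b unfolding B_def by blast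
    obtain e where e: "Ef x u = ereal e" using minorizes_real[OF minor xu] by blast
    show ?thesis unfolding b'(1)
      by (rule singular_part_separates[OF v w s r _ _ _ _ _ b'(3) e])
        (use minor b'(2) xu in \<open>auto simp: minorizes_def dom_iff\<close>)
  qed
  obtain x\<^sub>0 where x0: "(x\<^sub>0, ubar) \<in> dom" by (rule feasible_point)
  obtain e\<^sub>0 where "Ef x\<^sub>0 ubar = ereal e\<^sub>0" using minorizes_real[OF minor x0] by blast
  then have ne: "B \<noteq> {}" using x0 unfolding B_def by blast
  have bdd: "bdd_above B" using sep[OF _ x0] by (intro bdd_aboveI[of _ "c - (s x\<^sub>0 + r ubar)"]) force
  show thesis
  proof (rule that)
    show "minorizes (pairing M v) (pairing M w) (Sup B)"
      unfolding minorizes_iff_dom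
    proof (intro ballI, clarify)
      fix x u assume xu: "(x, u) \<in> dom"
      obtain e where e: "Ef x u = ereal e" using minorizes_real[OF minor xu] by blast
      then have "pairing M v x + pairing M w u - e \<in> B" using xu unfolding B_def by blast
      then have "pairing M v x + pairing M w u - e \<le> Sup B" by (rule cSup_upper[OF _ bdd])
      then show "ereal (pairing M v x + pairing M w u - Sup B) \<le> Ef x u" using e by simp
    qed
    show "s x + r u \<le> c - Sup B" if "(x, u) \<in> dom" for x u
    proof -
      have "Sup B \<le> c - (s x + r u)" by (rule cSup_least[OF ne]) (use sep[OF _ that] in force)
      then show ?thesis by simp
    qed
  qed
qed

text \<open>The restriction to stage \<open>t\<close> matters: at an earlier stage \<open>s\<close>
  the conditional expectation is measurable for \<open>F t\<close>, but in general not for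
  \<open>F s\<close>.\<close>

lemma proj_cond_expect_adapted:
  assumes "t \<le> T" "x \<in> X" shows "proj {i. stage i = t} (cond_expect M (F t) x) \<in> Xa"
proof -
  have X: "proj {i. stage i = t} (cond_expect M (F t) x) \<in> X" using X.X_proj cond_expect_X assms by blast
  moreover have "\<exists>g\<in>borel_measurable (F (stage i)).
      ae_eq M (\<lambda>\<omega>. proj {i. stage i = t} (cond_expect M (F t) x) \<omega> $ i) g" for i
  proof (intro bexI)
    show "ae_eq M (\<lambda>\<omega>. proj {i. stage i = t} (cond_expect M (F t) x) \<omega> $ i)
        (\<lambda>\<omega>. proj {i. stage i = t} (cond_expect M (F t) x) \<omega> $ i)" by (simp add: ae_eq_def)
    show "(\<lambda>\<omega>. proj {i. stage i = t} (cond_expect M (F t) x) \<omega> $ i) \<in> borel_measurable (F (stage i))"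
      by (cases "stage i = t") simp_all
  qed
  ultimately show ?thesis using X.meas_X[OF X] by (simp add: adapted_def)
qed

lemma cond_expect_adapted_nth:
  assumes "x \<in> Xa" "t \<le> T" "stage i \<le> t"
  shows "AE \<omega> in M. cond_expect M (F t) x \<omega> $ i = x \<omega> $ i"
proof -
  interpret G: sigma_finite_subalgebra M "F t" by (rule X.subalgebra_sigma_finite[OF subalgebra[OF assms(2)]])
  obtain g where g: "g \<in> borel_measurable (F (stage i))" "AE \<omega> in M. x \<omega> $ i = g \<omega>"
    using assms(1) by (auto simp: adapted_def ae_eq_def)
  have xi: "integrable M (\<lambda>\<omega>. x \<omega> $ i)" using assms(1) X.component_integrable_X by blast
  have gt: "g \<in> borel_measurable (F t)" by (rule measurable_from_subalg[OF subalgebra_mono[OF assms(3,2)] g(1)])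
  then have gm: "g \<in> borel_measurable M" by (rule measurable_from_subalg[OF subalgebra[OF assms(2)]])
  have xm: "(\<lambda>\<omega>. x \<omega> $ i) \<in> borel_measurable M" using xi by simp
  have gi: "integrable M g" using xi integrable_cong_AE[OF xm gm g(2)] by simp
  have "AE \<omega> in M. real_cond_exp M (F t) (\<lambda>\<omega>. x \<omega> $ i) \<omega> = real_cond_exp M (F t) g \<omega>"
    by (rule G.real_cond_exp_cong[OF g(2) xm gm])
  moreover have "AE \<omega> in M. real_cond_exp M (F t) g \<omega> = g \<omega>" by (rule G.real_cond_exp_F_meas[OF gi gt])
  ultimately show ?thesis using g(2) by eventually_elim simp
qed

lemma ae_eq_proj:
  assumes "\<And>i. i \<in> I \<Longrightarrow> AE \<omega> in M. x \<omega> $ i = y \<omega> $ i" shows "ae_eq M (proj I x) (proj I y)"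
proof -
  have "AE \<omega> in M. \<forall>i. i \<in> I \<longrightarrow> x \<omega> $ i = y \<omega> $ i"
    unfolding AE_all_countable using assms by (auto intro: AE_I2 elim: eventually_mono)
  then show ?thesis unfolding ae_eq_def by eventually_elim (simp add: vec_eq_iff)
qed

text \<open>The state of the multiplier after the stages \<open>t, \<dots>, T\<close> have been processed.\<close>

definition singular_before :: "real \<Rightarrow> nat \<Rightarrow> bool" where
  "singular_before R t \<longleftrightarrow> (\<exists>v\<in>V. \<exists>s\<in>singular_dual M SX. \<exists>y\<in>top_dual SU. \<exists>c.
     (\<forall>x\<in>Xa. pairing M v x + s x = 0) \<and> (\<forall>x\<in>X. s x = s (proj {i. stage i < t} x)) \<and>
     minorizes (\<lambda>x. pairing M v x + s x) y c \<and> c - y ubar \<le> R)"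

text \<open>Composing the singular part with \<open>E\<^sub>t\<close> does not increase its support function over the feasible
  set, by the feasibility of conditional expectations, and makes its component of stage \<open>t\<close>
  absolutely continuous, because \<open>v + s\<close> vanishes on adapted processes.\<close>

lemma cond_expect_singular_part:
  assumes t: "t \<le> T" and v: "v \<in> V" and s: "s \<in> singular_dual M SX"
    and van: "\<And>x. x \<in> Xa \<Longrightarrow> pairing M v x + s x = 0"
    and supp: "\<And>x. x \<in> X \<Longrightarrow> s x = s (proj {i. stage i < Suc t} x)"
  defines "q \<equiv> \<lambda>x. s (proj {i. stage i < Suc t} (cond_expect M (F t) x))"
  shows "q \<in> top_dual SX"
    and "\<And>x. x \<in> Xa \<Longrightarrow> q x = s x"
    and "\<exists>a\<in>V. \<exists>s'\<in>singular_dual M SX. (\<forall>x\<in>X. q x = pairing M a x + s' x) \<and>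
      (\<forall>x\<in>X. s' x = s' (proj {i. stage i < t} x))"
proof -
  let ?E = "cond_expect M (F t)"
  let ?I = "{i. stage i < Suc t}" and ?J = "{i. stage i < t}" and ?K = "{i. stage i = t}"
  have EX: "?E x \<in> X" if "x \<in> X" for x using cond_expect_X[OF t that] .
  note sub = subalgebra[OF t]
  have sd: "s \<in> top_dual SX" using s by (simp add: singular_dual_def)
  show qd: "q \<in> top_dual SX" unfolding q_def
    by (rule X.dual_cond_expect[OF sub EX X.dual_proj[OF sd]])
  show "q x = s x" if x: "x \<in> Xa" for x
  proof -
    have "ae_eq M (proj ?I (?E x)) (proj ?I x)"
      by (rule ae_eq_proj) (use cond_expect_adapted_nth[OF x t] in simp)
    then have "s (proj ?I (?E x)) = s (proj ?I x)"
      using x EX X.X_proj by (intro X.dual_ae[OF sd]) auto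
    then show ?thesis using supp[of x] x by (simp add: q_def)
  qed
  have q_split: "q x = q (proj ?J x) + q (proj ?K x)" if x: "x \<in> X" for x
  proof -
    have "proj ?I (?E x) = proj ?I (?E (proj ?I x))" by (rule ext) (simp add: vec_eq_iff)
    then have "q x = q (proj ?I x)" by (simp add: q_def)
    also have "proj ?I x = proj ?J x + proj ?K x" by (rule ext) (auto simp: vec_eq_iff)
    also have "q \<dots> = q (proj ?J x) + q (proj ?K x)" using X.dual_add[OF qd] X.X_proj[OF x] by blast
    finally show ?thesis .
  qed
  obtain a r\<^sub>1 where a: "a \<in> V" "r\<^sub>1 \<in> singular_dual M SX" "\<And>x. x \<in> X \<Longrightarrow> q (proj ?J x) = pairing M a x + r\<^sub>1 x"
    by (rule X.decompose[OF X.dual_proj[OF qd, of ?J]]) blast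
  obtain b r\<^sub>2 where b: "b \<in> V" "r\<^sub>2 \<in> singular_dual M SX" "\<And>x. x \<in> X \<Longrightarrow> q (proj ?K x) = pairing M b x + r\<^sub>2 x"
    by (rule X.decompose[OF X.dual_proj[OF qd, of ?K]]) blast
  have pp: "proj A (proj A x) = proj A x" for A and x :: "'w \<Rightarrow> real^'n" by (rule ext) (simp add: vec_eq_iff)
  \<comment> \<open>\<open>r\<^sub>1\<close> need not factor through the truncation; inserting
    \<open>proj ?J x\<close> for \<open>x\<close> yields a decomposition whose singular part
    does.\<close>
  have J: "q (proj ?J x) = pairing M (proj ?J a) x + r\<^sub>1 (proj ?J x)" if "x \<in> X" for x
    using a(3)[OF X.X_proj[OF that, of ?J]] by (simp add: pp X.proj_pairing)
  \<comment> \<open>The only candidate for a density of \<open>r\<^sub>2\<close>: on stage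
    \<open>t\<close> the functional \<open>q\<close> has the density
    \<open>- ?E (proj ?K v)\<close>, and \<open>b\<close> is split off from it. A singular
    functional given by a density vanishes.\<close>
  define g where "g \<omega> = - (?E (proj ?K v) \<omega>) - b \<omega>" for \<omega>
  have vK: "proj ?K v \<in> V" by (rule X.V_proj[OF v])
  have qK: "q (proj ?K x) = - pairing M (?E (proj ?K v)) x" if x: "x \<in> X" for x
  proof -
    have xa: "proj ?K (?E x) \<in> Xa" by (rule proj_cond_expect_adapted[OF t x])
    interpret G: sigma_finite_subalgebra M "F t" by (rule X.subalgebra_sigma_finite[OF sub])
    \<comment> \<open>Zero components stay zero under conditional expectation only almost surely,
      hence the detour through \<open>X.dual_ae\<close>.\<close>
    have "AE \<omega> in M. real_cond_exp M (F t) (\<lambda>\<omega>. 0) \<omega> = 0"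
      by (rule G.real_cond_exp_F_meas) auto
    then have "ae_eq M (proj ?I (?E (proj ?K x))) (proj ?K (?E x))"
      unfolding ae_eq_def by eventually_elim (auto simp: vec_eq_iff)
    then have "q (proj ?K x) = s (proj ?K (?E x))"
      unfolding q_def using x EX X.X_proj by (intro X.dual_ae[OF sd]) auto
    also have "\<dots> = - pairing M v (proj ?K (?E x))" using van[OF xa] by simp
    also have "\<dots> = - pairing M (?E (proj ?K v)) x"
      using X.cond_expect_pairing[OF sub EX x vK] by (simp add: X.proj_pairing)
    finally show ?thesis .
  qed
  have gi: "integrable M (\<lambda>\<omega>. x \<omega> $ i * g \<omega> $ i)" if x: "x \<in> X" for x i
  proof -
    have "integrable M (\<lambda>\<omega>. - (x \<omega> $ i * ?E (proj ?K v) \<omega> $ i) - x \<omega> $ i * b \<omega> $ i)"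
      using X.cond_expect_adjoint(1)[OF sub EX x vK, of i] X.product_integrable[OF x b(1), of i] by simp
    then show ?thesis by (simp add: g_def algebra_simps)
  qed
  have r2: "r\<^sub>2 x = 0" if x: "x \<in> X" for x
  proof (rule X.singular_eq_integral[OF b(2) x gi[OF x]])
    fix z assume z: "z \<in> X"
    have i: "integrable M (\<lambda>\<omega>. z \<omega> \<bullet> ?E (proj ?K v) \<omega>)"
      unfolding inner_vec_def inner_real_def
      by (rule Bochner_Integration.integrable_sum) (rule X.cond_expect_adjoint(1)[OF sub EX z vK])
    have "pairing M g z = - pairing M (?E (proj ?K v)) z - pairing M b z"
      unfolding pairing_def g_def inner_diff_right inner_minus_right
      using i X.pairing_integrable[OF z b(1)] by simp
    then show "r\<^sub>2 z = pairing M g z" using b(3)[OF z] qK[OF z] by simp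
  qed
  show "\<exists>a\<in>V. \<exists>s'\<in>singular_dual M SX. (\<forall>x\<in>X. q x = pairing M a x + s' x) \<and>
      (\<forall>x\<in>X. s' x = s' (proj ?J x))"
  proof (intro bexI conjI ballI)
    show "q x = pairing M (proj ?J a + b) x + r\<^sub>1 (proj ?J x)" if x: "x \<in> X" for x
    proof -
      have "pairing M (proj ?J a + b) x = pairing M (proj ?J a) x + pairing M b x"
        using X.pairing_integrable[OF x X.V_proj[OF a(1), of ?J]] X.pairing_integrable[OF x b(1)]
        by (simp add: pairing_def inner_add_right)
      then show ?thesis using q_split[OF x] J[OF x] b(3)[OF x] r2[OF x] by simp
    qed
    show "r\<^sub>1 (proj ?J x) = r\<^sub>1 (proj ?J (proj ?J x))" for x by (simp add: pp)
    show "proj ?J a + b \<in> V" by (intro X.V_add X.V_proj a b)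
    show "(\<lambda>x. r\<^sub>1 (proj ?J x)) \<in> singular_dual M SX" by (rule X.singular_proj[OF a(2)])
  qed
qed

text \<open>The singular part \<open>r\<close> of \<open>y\<close> is traded for a fresh multiplier:
  at \<open>u = ubar\<close> the bound on \<open>s + r\<close> is a bound on \<open>s\<close> alone,
  it passes to \<open>q\<close>, and \<open>y'\<close> carries it back to all of \<open>dom\<close>.
  The constants are arranged so that \<open>c' - y'' ubar = c - y ubar\<close>.\<close>

lemma singular_before_step:
  assumes t: "t \<le> T" and P: "singular_before R (Suc t)" shows "singular_before R t"
proof -
  let ?E = "cond_expect M (F t)"
  let ?I = "{i. stage i < Suc t}"
  obtain v s y c where v: "v \<in> V" and s: "s \<in> singular_dual M SX" and y: "y \<in> top_dual SU"
    and van: "\<And>x. x \<in> Xa \<Longrightarrow> pairing M v x + s x = 0" and supp: "\<And>x. x \<in> X \<Longrightarrow> s x = s (proj ?I x)"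
    and minor: "minorizes (\<lambda>x. pairing M v x + s x) y c" and R: "c - y ubar \<le> R"
    using P unfolding singular_before_def by blast
  have sd: "s \<in> top_dual SX" using s by (simp add: singular_dual_def)
  obtain w r where w: "w \<in> Y" and r: "r \<in> singular_dual M SU" and yd: "\<And>u. u \<in> U \<Longrightarrow> y u = pairing M w u + r u"
    by (rule U.decompose[OF y]) blast
  have minor': "minorizes (\<lambda>x. pairing M v x + s x) (\<lambda>u. pairing M w u + r u) c"
    using minor yd unfolding minorizes_def by simp
  obtain c\<^sub>1 where c1: "minorizes (pairing M v) (pairing M w) c\<^sub>1"
    and sr: "\<And>x u. (x, u) \<in> dom \<Longrightarrow> s x + r u \<le> c - c\<^sub>1"
    by (rule singular_part_support[OF v w s r minor']) blast
  define q where "q = (\<lambda>x. s (proj ?I (?E x)))"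
  have q1: "q \<in> top_dual SX" unfolding q_def
    by (rule cond_expect_singular_part(1)[OF t v s]) (fact van supp)+
  have q2: "q x = s x" if "x \<in> Xa" for x unfolding q_def
    by (rule cond_expect_singular_part(2)[OF t v s _ _ that]) (fact van supp)+
  have q3: "\<exists>a\<in>V. \<exists>s'\<in>singular_dual M SX. (\<forall>x\<in>X. q x = pairing M a x + s' x) \<and>
      (\<forall>x\<in>X. s' x = s' (proj {i. stage i < t} x))" unfolding q_def
    by (rule cond_expect_singular_part(3)[OF t v s]) (fact van supp)+
  define b where "b = c - c\<^sub>1 - r ubar"
  have qb: "q x \<le> b" if x: "(x, ubar) \<in> dom" for x
  proof -
    have xX: "x \<in> X" using x by (simp add: dom_iff)
    obtain z where z: "z \<in> X" "(z, ubar) \<in> dom" "\<And>i. stage i \<le> t \<Longrightarrow> AE \<omega> in M. z \<omega> $ i = ?E x \<omega> $ i"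
      using adapted_feasible[OF t xX x] by blast
    have "ae_eq M (proj ?I (?E x)) (proj ?I z)"
    proof (rule ae_eq_proj)
      fix i assume "i \<in> ?I"
      then have "AE \<omega> in M. z \<omega> $ i = ?E x \<omega> $ i" by (intro z(3)) simp
      then show "AE \<omega> in M. ?E x \<omega> $ i = z \<omega> $ i" by eventually_elim simp
    qed
    then have "q x = s (proj ?I z)" unfolding q_def
      by (intro X.dual_ae[OF sd]) (use z(1) X.X_proj cond_expect_X[OF t xX] in auto)
    also have "\<dots> = s z" using supp[OF z(1)] by simp
    also have "\<dots> \<le> b" using sr[OF z(2)] by (simp add: b_def)
    finally show ?thesis .
  qed
  \<comment> \<open>The absolutely continuous part \<open>(v, w, c\<^sub>1)\<close> acts as the
    affine minorant required for lower semicontinuity.\<close>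
  obtain y' where y': "y' \<in> top_dual SU" "\<And>x u. (x, u) \<in> dom \<Longrightarrow> q x + y' (u - ubar) \<le> b"
    by (rule constraint_multiplier[OF v w _ ubar q1 pos_linear pos_closed qb])
      (use c1 in \<open>auto simp: minorizes_def\<close>)
  obtain a s' where a: "a \<in> V" "s' \<in> singular_dual M SX" "\<And>x. x \<in> X \<Longrightarrow> q x = pairing M a x + s' x"
    "\<And>x. x \<in> X \<Longrightarrow> s' x = s' (proj {i. stage i < t} x)" using q3 by blast
  have va: "pairing M (v + a) x + s' x = pairing M v x + q x" if x: "x \<in> X" for x
    using X.pairing_integrable[OF x v] X.pairing_integrable[OF x a(1)] a(3)[OF x]
    by (simp add: pairing_def inner_add_right)
  define y'' where "y'' u = pairing M w u + y' u" for u
  define c' where "c' = c\<^sub>1 + b + y' ubar"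
  have wd: "pairing M w \<in> top_dual SU" by (rule U.pairing_dual[OF w])
  have "y'' \<in> top_dual SU"
  proof -
    have "continuous_map SU euclideanreal (pairing M w)" "continuous_map SU euclideanreal y'"
      using wd y'(1) by (auto simp: top_dual_def)
    then have "continuous_map SU euclideanreal y''" unfolding y''_def by (intro continuous_intros)
    moreover have "y'' (u + z) = y'' u + y'' z" "y'' (k *\<^sub>R u) = k * y'' u" if "u \<in> U" "z \<in> U" for u z k
      using U.dual_add[OF wd that] U.dual_add[OF y'(1) that] U.dual_scale[OF wd that(1)] U.dual_scale[OF y'(1) that(1)]
      by (simp_all add: y''_def algebra_simps)
    ultimately show ?thesis unfolding top_dual_def U.topspace by blast
  qed
  moreover have "minorizes (\<lambda>x. pairing M (v + a) x + s' x) y'' c'"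
    unfolding minorizes_iff_dom
  proof (intro ballI, clarify)
    fix x u assume xu: "(x, u) \<in> dom"
    obtain e where e: "Ef x u = ereal e" "pairing M v x + pairing M w u - c\<^sub>1 \<le> e" using minorizes_real[OF c1 xu] by blast
    have uU: "u \<in> U" and xX: "x \<in> X" using xu by (auto simp: dom_iff)
    have "y' (u - ubar) = y' u - y' ubar" by (rule U.dual_diff[OF y'(1) uU ubar])
    then have "pairing M (v + a) x + s' x + y'' u - c' \<le> e"
      using y'(2)[OF xu] e(2) va[OF xX] by (simp add: y''_def c'_def)
    then show "ereal (pairing M (v + a) x + s' x + y'' u - c') \<le> Ef x u" using e(1) by simp
  qed
  moreover have "\<forall>x\<in>Xa. pairing M (v + a) x + s' x = 0" using va van q2 by simp
  moreover have "c' - y'' ubar \<le> R" using R yd[OF ubar] by (simp add: y''_def c'_def b_def)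
  ultimately show ?thesis using a(2,4) X.V_add[OF v a(1)] unfolding singular_before_def by blast
qed

text \<open>\<open>p\<close> is constant on each set of points \<open>x\<close> with
  \<open>x - z\<close> adapted, over which \<open>value_function\<close> minimizes, so the inner
  infimum does not interact with it.\<close>

lemma minorizes_conjugate:
  assumes add: "\<And>x z. x \<in> X \<Longrightarrow> z \<in> X \<Longrightarrow> p (x - z) = p x - p z" and van: "\<And>x. x \<in> Xa \<Longrightarrow> p x = 0"
  shows "conjugate X U (value_function M F stage f X) p y \<le> ereal c \<longleftrightarrow> minorizes p y c"
proof
  assume le: "conjugate X U (value_function M F stage f X) p y \<le> ereal c"
  show "minorizes p y c" unfolding minorizes_def
  proof (intro ballI)
    fix x u assume xu: "x \<in> X" "u \<in> U"
    have "x - x \<in> adapted M F stage" by (auto simp: adapted_def ae_eq_def zero_fun_def intro!: bexI[of _ "\<lambda>_. 0"])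
    then have "value_function M F stage f X x u \<le> Ef x u"
      unfolding value_function_def using xu by (intro INF_lower) simp
    moreover have "ereal (p x) + ereal (y u) - value_function M F stage f X x u \<le> ereal c"
      using le xu unfolding conjugate_def SUP_le_iff by (auto dest!: bspec[of _ _ "(x, u)"])
    ultimately have "ereal (p x) + ereal (y u) - Ef x u \<le> ereal c"
      by (meson ereal_minus_mono order_refl order_trans)
    then show "ereal (p x + y u - c) \<le> Ef x u" by (cases "Ef x u") auto
  qed
next
  assume m: "minorizes p y c"
  show "conjugate X U (value_function M F stage f X) p y \<le> ereal c"
    unfolding conjugate_def
  proof (rule SUP_least, clarify)
    fix z u assume zu: "z \<in> X" "u \<in> U"
    have "ereal (p z + y u - c) \<le> value_function M F stage f X z u"
      unfolding value_function_def
    proof (rule INF_greatest)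
      fix x assume "x \<in> {x \<in> X. x - z \<in> adapted M F stage}"
      then have x: "x \<in> X" "x - z \<in> Xa" using zu X.X_diff by auto
      then have "p x = p z" using van[OF x(2)] add[OF x(1) zu(1)] by simp
      then show "ereal (p z + y u - c) \<le> Ef x u" using m x(1) zu(2) unfolding minorizes_def by metis
    qed
    then show "ereal (p z) + ereal (y u) - value_function M F stage f X z u \<le> ereal c"
      by (cases "value_function M F stage f X z u") auto
  qed
qed

theorem dual_reduction:
  assumes p: "p \<in> adapted_polar M F stage SX" and y: "y \<in> top_dual SU"
  shows "\<exists>p'\<in>adapted_annihilator M F stage X V. \<exists>y'\<in>Y.
      conjugate X U (value_function M F stage f X) (pairing M p') (pairing M y') - ereal (pairing M y' ubar)
        \<le> conjugate X U (value_function M F stage f X) p y - ereal (y ubar)"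
proof (cases "conjugate X U (value_function M F stage f X) p y")
  case PInf
  \<comment> \<open>Any admissible pair will do when the right-hand side is infinite.\<close>
  have "0 \<in> V" "0 \<in> Y" using X.subspace_V U.subspace_V by (auto simp: subspace_def)
  moreover from this(1) have "0 \<in> adapted_annihilator M F stage X V" by (simp add: adapted_annihilator_def pairing_def)
  ultimately show ?thesis using PInf by (intro bexI[of _ 0]) auto
next
  case MInf
  have pd: "p \<in> top_dual SX" and van: "\<And>x. x \<in> Xa \<Longrightarrow> p x = 0" using p by (auto simp: adapted_polar_def X.topspace)
  obtain x\<^sub>0 where x0: "(x\<^sub>0, ubar) \<in> dom" by (rule feasible_point)
  \<comment> \<open>The value \<open>- \<infinity>\<close> is impossible: \<open>Ef\<close> would
    exceed every real number at the feasible point.\<close>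
  have "minorizes p y c" for c
    using minorizes_conjugate[of p y c] X.dual_diff[OF pd] van MInf by simp
  from minorizes_real[OF this x0] obtain e where e: "\<And>c. Ef x\<^sub>0 ubar = ereal (e c) \<and> p x\<^sub>0 + y ubar - c \<le> e c" by metis
  then have "e c = e 0" for c by (metis ereal.inject)
  then have "p x\<^sub>0 + y ubar - (p x\<^sub>0 + y ubar - e 0 - 1) \<le> e 0" using e by metis
  then show ?thesis by simp
next
  case (real c)
  have pd: "p \<in> top_dual SX" and van: "\<And>x. x \<in> Xa \<Longrightarrow> p x = 0" using p by (auto simp: adapted_polar_def X.topspace)
  have m: "minorizes p y c" using minorizes_conjugate[of p y c] X.dual_diff[OF pd] van real by simp
  let ?R = "c - y ubar"
  have top: "singular_before ?R (Suc T)"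
  proof -
    obtain v s where vs: "v \<in> V" "s \<in> singular_dual M SX" "\<And>x. x \<in> X \<Longrightarrow> p x = pairing M v x + s x"
      by (rule X.decompose[OF pd]) blast
    have "proj {i. stage i < Suc T} x = x" for x :: "'w \<Rightarrow> real^'n"
      using stage by (intro ext) (simp add: vec_eq_iff less_Suc_eq_le)
    moreover have "minorizes (\<lambda>x. pairing M v x + s x) y c" using m vs(3) by (simp add: minorizes_def)
    moreover have "\<forall>x\<in>Xa. pairing M v x + s x = 0" using van vs(3) by force
    ultimately show ?thesis unfolding singular_before_def using vs(1,2) y by force
  qed
  \<comment> \<open>Truncated subtraction: the counter reaches 0 at \<open>k = Suc T\<close> and
    rests there, so nothing is left to do for \<open>k > T\<close>.\<close>
  have "singular_before ?R (Suc T - k)" for k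
  proof (induction k)
    case (Suc k)
    show ?case
    proof (cases "k \<le> T")
      case True
      then have "Suc T - k = Suc (T - k)" by simp
      then have "singular_before ?R (T - k)" using singular_before_step[of "T - k" ?R] Suc by simp
      then show ?thesis by simp
    qed (use Suc in simp)
  qed (use top in simp)
  from this[of "Suc T"] have "singular_before ?R 0" by simp
  then obtain v s y' c' where v: "v \<in> V" and s: "s \<in> singular_dual M SX" and y': "y' \<in> top_dual SU"
    and van': "\<And>x. x \<in> Xa \<Longrightarrow> pairing M v x + s x = 0" and supp: "\<And>x. x \<in> X \<Longrightarrow> s x = s (proj {i. stage i < 0} x)"
    and minor: "minorizes (\<lambda>x. pairing M v x + s x) y' c'" and R: "c' - y' ubar \<le> ?R"
    unfolding singular_before_def by blast
  have s0: "s x = 0" if "x \<in> X" for x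
  proof -
    have "proj {i. stage i < 0} x = 0" by (rule ext) (simp add: vec_eq_iff)
    moreover have "s 0 = 0" using s by (intro X.dual_0) (simp add: singular_dual_def)
    ultimately show ?thesis using supp[OF that] by simp
  qed
  obtain w r where w: "w \<in> Y" and r: "r \<in> singular_dual M SU" and yd: "\<And>u. u \<in> U \<Longrightarrow> y' u = pairing M w u + r u"
    by (rule U.decompose[OF y']) blast
  have minor': "minorizes (\<lambda>x. pairing M v x + s x) (\<lambda>u. pairing M w u + r u) c'"
    using minor yd unfolding minorizes_def by simp
  obtain c\<^sub>1 where c1: "minorizes (pairing M v) (pairing M w) c\<^sub>1"
    and sr: "\<And>x u. (x, u) \<in> dom \<Longrightarrow> s x + r u \<le> c' - c\<^sub>1"
    by (rule singular_part_support[OF v w s r minor']) blast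
  obtain x\<^sub>0 where x0: "(x\<^sub>0, ubar) \<in> dom" by (rule feasible_point)
  \<comment> \<open>With \<open>s = 0\<close> the support bound at the feasible point reads
    \<open>r ubar \<le> c' - c\<^sub>1\<close>, which pays for the removal of
    \<open>r\<close>.\<close>
  have "c\<^sub>1 - pairing M w ubar \<le> c - y ubar"
    using sr[OF x0] s0[of x\<^sub>0] x0 R yd[OF ubar] by (simp add: dom_iff)
  moreover have vanv: "pairing M v x = 0" if "x \<in> Xa" for x using van'[OF that] s0 that by simp
  moreover have "conjugate X U (value_function M F stage f X) (pairing M v) (pairing M w) \<le> ereal c\<^sub>1"
    using minorizes_conjugate[of "pairing M v" "pairing M w" c\<^sub>1] X.dual_diff[OF X.pairing_dual[OF v]] vanv c1 by simp
  then have "conjugate X U (value_function M F stage f X) (pairing M v) (pairing M w) - ereal (pairing M w ubar)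
      \<le> ereal c\<^sub>1 - ereal (pairing M w ubar)" by (rule ereal_minus_mono) simp
  ultimately have "conjugate X U (value_function M F stage f X) (pairing M v) (pairing M w) - ereal (pairing M w ubar)
      \<le> conjugate X U (value_function M F stage f X) p y - ereal (y ubar)"
    unfolding real by (auto intro: order_trans)
  moreover have "v \<in> adapted_annihilator M F stage X V" using v vanv by (simp add: adapted_annihilator_def)
  ultimately show ?thesis using w by blast
qed

end

theorem theorem25:
  fixes M :: "'w measure" and F :: "nat \<Rightarrow> 'w measure" and T :: nat
    and stage :: "'n::finite \<Rightarrow> nat"
    and f :: "real^'n \<Rightarrow> real^'m::finite \<Rightarrow> 'w \<Rightarrow> ereal"
    and X V :: "('w \<Rightarrow> real^'n) set" and U Y :: "('w \<Rightarrow> real^'m) set"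
    and SX :: "('w \<Rightarrow> real^'n) topology" and SU :: "('w \<Rightarrow> real^'m) topology"
    and ubar :: "'w \<Rightarrow> real^'m"
  assumes "prob_space M"
    and "filtration_upto M F T"
    and "\<forall>i. stage i \<le> T"
    and "convex_normal_integrand M f"
    and "random_variable_space M X" and "random_variable_space M V"
    and "random_variable_space M U" and "random_variable_space M Y"
    and "separating_duality M X V" and "separating_duality M U Y"
    and "decomposable M X" and "decomposable M V" and "decomposable M U" and "decomposable M Y"
    and "solid M X" and "solid M V" and "solid M U" and "solid M Y"
    and "strong_topology M X V SX" and "strong_topology M U Y SU"
    and "\<forall>t\<le>T. \<forall>x\<in>X. cond_expect M (F t) x \<in> X"
    and "ubar \<in> U"
    and pos_linear: "subspace (pos_hull ((\<lambda>u. u - ubar) ` snd ` dom_Ef M f X U))"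
    and pos_closed: "closedin SU (pos_hull ((\<lambda>u. u - ubar) ` snd ` dom_Ef M f X U))"
    and adapted_feasible: "\<forall>t\<le>T. \<forall>z\<in>X. (z, ubar) \<in> dom_Ef M f X U \<longrightarrow>
      (\<exists>zbar\<in>X. (zbar, ubar) \<in> dom_Ef M f X U \<and>
         (\<forall>i. stage i \<le> t \<longrightarrow> (AE \<omega> in M. zbar \<omega> $ i = cond_expect M (F t) z \<omega> $ i)))"
  shows "\<forall>p\<in>adapted_polar M F stage SX. \<forall>y\<in>top_dual SU.
    \<exists>p'\<in>adapted_annihilator M F stage X V. \<exists>y'\<in>Y.
      conjugate X U (value_function M F stage f X) (pairing M p') (pairing M y') -
          ereal (pairing M y' ubar)
        \<le> conjugate X U (value_function M F stage f X) p y - ereal (y ubar)"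
proof -
  obtain dX where dX: "rv_duality M X V SX dX"
    using rv_duality_exists[of M X V SX] assms by blast
  obtain dU where dU: "rv_duality M U Y SU dU"
    using rv_duality_exists[of M U Y SU] assms by blast
  have "integrand_duality M X V SX dX U Y SU dU f"
    using dX dU assms by (intro integrand_duality.intro integrand_duality_axioms.intro)
  then have "adapted_program M X V SX dX U Y SU dU f F T stage ubar"
    using assms by (intro adapted_program.intro adapted_program_axioms.intro) simp_all
  then show ?thesis using adapted_program.dual_reduction by blast
qed

end
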